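(* For any Coxeter group $W$ the ideal $\mathbf{J}(W)$ of $\hat{\mathbf{H}}(W)$ generated by $\mathbf{K}(W)\cap \operatorname{Ker}\varepsilon$ is a Hopf ideal; therefore, the quotient algebra $\underline{\mathbf{H}}(W)=\hat{\mathbf{H}}(W)/\mathbf{J}(W)$ is a Hopf algebra.
   Context: A Coxeter group $W$ is generated by $s_i$, $i\in I$, subject to relations $(s_is_j)^{m_{ij}}=1$, where $m_{ij}=m_{ji}\in\mathbb{Z}_{\ge 0}$ are such that $m_{ij}=1$ iff $i=j$ ($m_{ij}=0$ imposes no relation). $\hat{\mathbf{H}}(W)$ is the (unital associative) $\mathbb{Z}$-algebra generated by $s_i,D_i$, $i\in I$, subject to relations: (i) $s_i^2=1$, $D_i^2=D_i$, $s_iD_i+D_is_i=s_i-1$ for $i\in I$; (ii) $(s_is_j)^{m_{ij}}=1$; (iii) $\underbrace{D_is_js_i\cdots s_{j'}}_{m_{ij}}=\underbrace{s_j\cdots s_{i'}s_{j'}D_{i'}}_{m_{ij}}$ for all distinct $i,j\in I$ with $m_{ij}\ne 0$, where $i'=i$ if $m_{ij}$ is even, $i'=j$ if $m_{ij}$ is odd, and $\{i',j'\}=\{i,j\}$ (each side has $m_{ij}$ factors with indices alternating between $i$ and $j$). It is a Hopf algebra over $\mathbb{Z}$ with $\Delta(s_i)=s_i\otimes s_i$, $\Delta(D_i)=D_i\otimes 1+s_i\otimes D_i$, $\varepsilon(s_i)=1$, $\varepsilon(D_i)=0$, $S(s_i)=s_i$, $S(D_i)=-s_iD_i$. $\mathcal{S}:=\{ws_iw^{-1}\mid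 w\in W,i\in I\}$ is the set of all reflections in $W$. For each $s\in\mathcal{S}$ there is a unique element $D_s\in\hat{\mathbf{H}}(W)$ such that $D_{s_i}=D_i$ for $i\in I$ and $D_{s_iss_i}=s_iD_ss_i$ for any $i\in I$, $s\in\mathcal{S}\setminus\{s_i\}$. $\hat{\mathbf{D}}(W)$ is the subalgebra of $\hat{\mathbf{H}}(W)$ generated by all $D_s$, $s\in\mathcal{S}$, and $\mathbf{K}(W):=\bigcap_{w\in W}w\hat{\mathbf{D}}(W)w^{-1}$. *)

theory Defs
  imports "HOL-Algebra.Algebra"
begin

section \<open>Monoid rings, free rings and tensor products over \<open>\<int>\<close>\<close>

definition monoid_ring :: "('a, 'b) monoid_scheme \<Rightarrow> ('a \<Rightarrow>\<^sub>0 int) ring" where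
  "monoid_ring M =
    \<lparr>carrier = {p. Poly_Mapping.keys p \<subseteq> carrier M},
     monoid.mult = (\<lambda>p q. frag_extend (\<lambda>a. frag_extend (\<lambda>b. frag_of (a \<otimes>\<^bsub>M\<^esub> b)) q) p),
     one = frag_of \<one>\<^bsub>M\<^esub>, ring.zero = 0, ring.add = (+)\<rparr>"

definition word_monoid :: "'x set \<Rightarrow> 'x list monoid" where
  "word_monoid A = \<lparr>carrier = lists A, monoid.mult = (@), one = []\<rparr>"

definition free_ring :: "'x set \<Rightarrow> ('x list \<Rightarrow>\<^sub>0 int) ring" where
  "free_ring A = monoid_ring (word_monoid A)"

definition linear_extension :: "('r, 'm) ring_scheme \<Rightarrow> ('k \<Rightarrow> 'r) \<Rightarrow> ('k \<Rightarrow>\<^sub>0 int) \<Rightarrow> 'r" where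
  "linear_extension R \<phi> p =
    (\<Oplus>\<^bsub>R\<^esub>k \<in> Poly_Mapping.keys p. [Poly_Mapping.lookup p k] \<cdot>\<^bsub>R\<^esub> \<phi> k)"

definition word_eval :: "('r, 'm) monoid_scheme \<Rightarrow> ('x \<Rightarrow> 'r) \<Rightarrow> 'x list \<Rightarrow> 'r" where
  "word_eval M v w = foldr (\<lambda>x y. v x \<otimes>\<^bsub>M\<^esub> y) w \<one>\<^bsub>M\<^esub>"

text \<open>The map induced by \<open>f\<close> on a quotient whose elements are cosets (it is meaningful
  only if \<open>f\<close> is constant on each coset).\<close>

definition induced :: "('a \<Rightarrow> 'b) \<Rightarrow> 'a set \<Rightarrow> 'b" where
  "induced f Y = the_elem (f ` Y)"

text \<open>The tensor product over \<open>\<int>\<close> is the free abelian group on pairs modulo the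
  biadditivity relations. The additive subgroup spanned by these relations is already an
  ideal of the monoid ring of the product of the two multiplicative monoids, so dividing by
  the generated ideal gives the usual tensor product together with the multiplication
  \<open>(a \<otimes> b) (a' \<otimes> b') = a a' \<otimes> b b'\<close>.\<close>

definition biadditive_relations ::
  "('a, 'm) ring_scheme \<Rightarrow> ('b, 'n) ring_scheme \<Rightarrow> ('a \<times> 'b \<Rightarrow>\<^sub>0 int) set" where
  "biadditive_relations A B =
    {frag_of (a \<oplus>\<^bsub>A\<^esub> a', b) - frag_of (a, b) - frag_of (a', b) | a a' b.
       a \<in> carrier A \<and> a' \<in> carrier A \<and> b \<in> carrier B} \<union>
    {frag_of (a, b \<oplus>\<^bsub>B\<^esub> b') - frag_of (a, b) - frag_of (a, b') | a b b'.
       a \<in> carrier A \<and> b \<in> carrier B \<and> b' \<in> carrier B}"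

definition tensor_ideal ::
  "('a, 'm) ring_scheme \<Rightarrow> ('b, 'n) ring_scheme \<Rightarrow> ('a \<times> 'b \<Rightarrow>\<^sub>0 int) set" where
  "tensor_ideal A B = Idl\<^bsub>monoid_ring (A \<times>\<times> B)\<^esub> (biadditive_relations A B)"

definition tensor_ring ::
  "('a, 'm) ring_scheme \<Rightarrow> ('b, 'n) ring_scheme \<Rightarrow> ('a \<times> 'b \<Rightarrow>\<^sub>0 int) set ring" where
  "tensor_ring A B = monoid_ring (A \<times>\<times> B) Quot tensor_ideal A B"

definition tensor ::
  "('a, 'm) ring_scheme \<Rightarrow> ('b, 'n) ring_scheme \<Rightarrow> 'a \<Rightarrow> 'b \<Rightarrow> ('a \<times> 'b \<Rightarrow>\<^sub>0 int) set" where
  "tensor A B a b = tensor_ideal A B +>\<^bsub>monoid_ring (A \<times>\<times> B)\<^esub> frag_of (a, b)"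

text \<open>The additive map out of a tensor product given by a biadditive map \<open>\<phi>\<close> into \<open>C\<close>.\<close>

definition tensor_lift ::
  "('c, 'm) ring_scheme \<Rightarrow> ('a \<Rightarrow> 'b \<Rightarrow> 'c) \<Rightarrow> ('a \<times> 'b \<Rightarrow>\<^sub>0 int) set \<Rightarrow> 'c" where
  "tensor_lift C \<phi> = induced (linear_extension C (\<lambda>(a, b). \<phi> a b))"

text \<open>\<open>f \<otimes> g\<close> with values in \<open>C \<otimes> D\<close>.\<close>

definition tensor_map ::
  "('c, 'm) ring_scheme \<Rightarrow> ('d, 'n) ring_scheme \<Rightarrow> ('a \<Rightarrow> 'c) \<Rightarrow> ('b \<Rightarrow> 'd)
    \<Rightarrow> ('a \<times> 'b \<Rightarrow>\<^sub>0 int) set \<Rightarrow> ('c \<times> 'd \<Rightarrow>\<^sub>0 int) set" where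
  "tensor_map C D f g = tensor_lift (tensor_ring C D) (\<lambda>a b. tensor C D (f a) (g b))"

text \<open>The isomorphism \<open>(A \<otimes> B) \<otimes> C \<rightarrow> A \<otimes> (B \<otimes> C)\<close>.\<close>

definition tensor_assoc ::
  "('a, 'm) ring_scheme \<Rightarrow> ('b, 'n) ring_scheme \<Rightarrow> ('c, 'o) ring_scheme
    \<Rightarrow> (('a \<times> 'b \<Rightarrow>\<^sub>0 int) set \<times> 'c \<Rightarrow>\<^sub>0 int) set
    \<Rightarrow> ('a \<times> ('b \<times> 'c \<Rightarrow>\<^sub>0 int) set \<Rightarrow>\<^sub>0 int) set" where
  "tensor_assoc A B C =
    (let T = tensor_ring A (tensor_ring B C) in
      tensor_lift T
        (\<lambda>t c. tensor_lift T (\<lambda>a b. tensor A (tensor_ring B C) a (tensor B C b c)) t))"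

text \<open>The image of \<open>U \<otimes> V\<close> in \<open>A \<otimes> B\<close>, for subsets \<open>U\<close> of \<open>A\<close> and \<open>V\<close> of \<open>B\<close>.\<close>

definition tensor_span ::
  "('a, 'm) ring_scheme \<Rightarrow> ('b, 'n) ring_scheme \<Rightarrow> 'a set \<Rightarrow> 'b set
    \<Rightarrow> ('a \<times> 'b \<Rightarrow>\<^sub>0 int) set set" where
  "tensor_span A B U V =
    generate (add_monoid (tensor_ring A B)) {tensor A B u v | u v. u \<in> U \<and> v \<in> V}"


section \<open>Hopf algebras over \<open>\<int>\<close>\<close>

text \<open>A \<open>\<int>\<close>-algebra is the same thing as a ring. The scalar multiples occurring in the
  counit and antipode axioms are integer multiples in the additive group.\<close>

locale hopf_algebra = ring H
  for H :: "('a, 'm) ring_scheme" (structure) +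
  fixes \<Delta> :: "'a \<Rightarrow> ('a \<times> 'a \<Rightarrow>\<^sub>0 int) set"
    and \<epsilon> :: "'a \<Rightarrow> int"
    and S :: "'a \<Rightarrow> 'a"
  assumes comult_hom: "\<Delta> \<in> ring_hom H (tensor_ring H H)"
    and counit_hom: "\<epsilon> \<in> ring_hom H \<Z>"
    and antipode_additive: "S \<in> hom (add_monoid H) (add_monoid H)"
    and coassoc: "x \<in> carrier H \<Longrightarrow>
      tensor_assoc H H H (tensor_map (tensor_ring H H) H \<Delta> id (\<Delta> x)) =
      tensor_map H (tensor_ring H H) id \<Delta> (\<Delta> x)"
    and counit_left: "x \<in> carrier H \<Longrightarrow> tensor_lift H (\<lambda>a b. [\<epsilon> a] \<cdot> b) (\<Delta> x) = x"
    and counit_right: "x \<in> carrier H \<Longrightarrow> tensor_lift H (\<lambda>a b. [\<epsilon> b] \<cdot> a) (\<Delta> x) = x"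
    and antipode_left: "x \<in> carrier H \<Longrightarrow> tensor_lift H (\<lambda>a b. S a \<otimes> b) (\<Delta> x) = [\<epsilon> x] \<cdot> \<one>"
    and antipode_right: "x \<in> carrier H \<Longrightarrow> tensor_lift H (\<lambda>a b. a \<otimes> S b) (\<Delta> x) = [\<epsilon> x] \<cdot> \<one>"

locale hopf_ideal = hopf_algebra H \<Delta> \<epsilon> S + ideal J H
  for H :: "('a, 'm) ring_scheme" (structure) and \<Delta> and \<epsilon> and S and J +
  assumes comult_ideal: "\<Delta> ` J \<subseteq>
      tensor_span H H J (carrier H) <+>\<^bsub>tensor_ring H H\<^esub> tensor_span H H (carrier H) J"
    and counit_ideal: "\<epsilon> ` J \<subseteq> {0}"
    and antipode_ideal: "S ` J \<subseteq> J"

text \<open>The structure maps induced on \<open>H / J\<close>.\<close>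

definition quot_comult ::
  "('a, 'm) ring_scheme \<Rightarrow> 'a set \<Rightarrow> ('a \<Rightarrow> ('a \<times> 'a \<Rightarrow>\<^sub>0 int) set)
    \<Rightarrow> 'a set \<Rightarrow> ('a set \<times> 'a set \<Rightarrow>\<^sub>0 int) set" where
  "quot_comult H J \<Delta> =
    induced (\<lambda>x. tensor_map (H Quot J) (H Quot J) (\<lambda>a. J +>\<^bsub>H\<^esub> a) (\<lambda>a. J +>\<^bsub>H\<^esub> a) (\<Delta> x))"

definition quot_counit :: "('a \<Rightarrow> int) \<Rightarrow> 'a set \<Rightarrow> int" where
  "quot_counit \<epsilon> = induced \<epsilon>"

definition quot_antipode ::
  "('a, 'm) ring_scheme \<Rightarrow> 'a set \<Rightarrow> ('a \<Rightarrow> 'a) \<Rightarrow> 'a set \<Rightarrow> 'a set" where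
  "quot_antipode H J S = induced (\<lambda>x. J +>\<^bsub>H\<^esub> S x)"


section \<open>Coxeter groups\<close>

text \<open>\<open>m i j = 0\<close> stands for the absence of a relation between \<open>i\<close> and \<open>j\<close>.\<close>

definition coxeter_matrix :: "'i set \<Rightarrow> ('i \<Rightarrow> 'i \<Rightarrow> nat) \<Rightarrow> bool" where
  "coxeter_matrix I m \<longleftrightarrow>
    (\<forall>i\<in>I. \<forall>j\<in>I. m i j = m j i \<and> (m i j = 1 \<longleftrightarrow> i = j))"

text \<open>The congruence on words in the generators generated by \<open>(s\<^sub>i s\<^sub>j)\<^bsup>m i j\<^esup> = 1\<close>. As
  \<open>m i i = 1\<close>, it identifies \<open>[i, i]\<close> with \<open>[]\<close>; hence the monoid presented by these
  relations is a group, and it is the group presented by them.\<close>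

inductive coxeter_eq :: "'i set \<Rightarrow> ('i \<Rightarrow> 'i \<Rightarrow> nat) \<Rightarrow> 'i list \<Rightarrow> 'i list \<Rightarrow> bool"
  for I m where
  refl: "u \<in> lists I \<Longrightarrow> coxeter_eq I m u u"
| sym: "coxeter_eq I m u v \<Longrightarrow> coxeter_eq I m v u"
| trans: "coxeter_eq I m u v \<Longrightarrow> coxeter_eq I m v w \<Longrightarrow> coxeter_eq I m u w"
| rel: "u \<in> lists I \<Longrightarrow> v \<in> lists I \<Longrightarrow> i \<in> I \<Longrightarrow> j \<in> I \<Longrightarrow>
    coxeter_eq I m (u @ concat (replicate (m i j) [i, j]) @ v) (u @ v)"

definition coxeter_class :: "'i set \<Rightarrow> ('i \<Rightarrow> 'i \<Rightarrow> nat) \<Rightarrow> 'i list \<Rightarrow> 'i list set" where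
  "coxeter_class I m u = {v. coxeter_eq I m u v}"

definition coxeter_group :: "'i set \<Rightarrow> ('i \<Rightarrow> 'i \<Rightarrow> nat) \<Rightarrow> 'i list set monoid" where
  "coxeter_group I m =
    \<lparr>carrier = coxeter_class I m ` lists I,
     monoid.mult = (\<lambda>A B. \<Union>a\<in>A. \<Union>b\<in>B. coxeter_class I m (a @ b)),
     one = coxeter_class I m []\<rparr>"

definition simple_refl :: "'i set \<Rightarrow> ('i \<Rightarrow> 'i \<Rightarrow> nat) \<Rightarrow> 'i \<Rightarrow> 'i list set" where
  "simple_refl I m i = coxeter_class I m [i]"

definition reflections :: "'i set \<Rightarrow> ('i \<Rightarrow> 'i \<Rightarrow> nat) \<Rightarrow> 'i list set set" where
  "reflections I m =
    {w \<otimes>\<^bsub>coxeter_group I m\<^esub> simple_refl I m i \<otimes>\<^bsub>coxeter_group I m\<^esub> inv\<^bsub>coxeter_group I m\<^esub> w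
      | w i. w \<in> carrier (coxeter_group I m) \<and> i \<in> I}"


section \<open>The Hopf algebra \<open>hecke_hat\<close> of a Coxeter group\<close>

datatype 'i gen = GS 'i | GD 'i

definition gens :: "'i set \<Rightarrow> 'i gen set" where
  "gens I = GS ` I \<union> GD ` I"

text \<open>\<open>alt i j n\<close> is the word \<open>i j i j \<dots>\<close> of length \<open>n\<close>.\<close>

definition alt :: "'i \<Rightarrow> 'i \<Rightarrow> nat \<Rightarrow> 'i list" where
  "alt i j n = map (\<lambda>k. if even k then i else j) [0..<n]"

text \<open>In the last family both sides have \<open>m i j\<close> factors, \<open>m i j - 1\<close> of which are the letters
  \<open>s\<^sub>j s\<^sub>i s\<^sub>j \<dots>\<close>; on the left they follow \<open>D\<^sub>i\<close>, on the right they precede \<open>D\<^sub>i\<close> or \<open>D\<^sub>j\<close>,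
  according to the parity of \<open>m i j\<close>.\<close>

definition hecke_relations :: "'i set \<Rightarrow> ('i \<Rightarrow> 'i \<Rightarrow> nat) \<Rightarrow> ('i gen list \<Rightarrow>\<^sub>0 int) set" where
  "hecke_relations I m =
    {frag_of [GS i, GS i] - frag_of [] | i. i \<in> I} \<union>
    {frag_of [GD i, GD i] - frag_of [GD i] | i. i \<in> I} \<union>
    {frag_of [GS i, GD i] + frag_of [GD i, GS i] - (frag_of [GS i] - frag_of []) | i. i \<in> I} \<union>
    {frag_of (concat (replicate (m i j) [GS i, GS j])) - frag_of [] | i j. i \<in> I \<and> j \<in> I} \<union>
    {frag_of (GD i # map GS (alt j i (m i j - 1))) -
     frag_of (map GS (alt j i (m i j - 1)) @ [GD (if even (m i j) then i else j)])
       | i j. i \<in> I \<and> j \<in> I \<and> i \<noteq> j \<and> m i j \<noteq> 0}"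

definition hecke_ideal :: "'i set \<Rightarrow> ('i \<Rightarrow> 'i \<Rightarrow> nat) \<Rightarrow> ('i gen list \<Rightarrow>\<^sub>0 int) set" where
  "hecke_ideal I m = Idl\<^bsub>free_ring (gens I)\<^esub> (hecke_relations I m)"

definition hecke_hat :: "'i set \<Rightarrow> ('i \<Rightarrow> 'i \<Rightarrow> nat) \<Rightarrow> ('i gen list \<Rightarrow>\<^sub>0 int) set ring" where
  "hecke_hat I m = free_ring (gens I) Quot hecke_ideal I m"

definition gen_el ::
  "'i set \<Rightarrow> ('i \<Rightarrow> 'i \<Rightarrow> nat) \<Rightarrow> 'i gen \<Rightarrow> ('i gen list \<Rightarrow>\<^sub>0 int) set" where
  "gen_el I m g = hecke_ideal I m +>\<^bsub>free_ring (gens I)\<^esub> frag_of [g]"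

abbreviation s_el where "s_el I m i \<equiv> gen_el I m (GS i)"
abbreviation D_el where "D_el I m i \<equiv> gen_el I m (GD i)"

text \<open>The structure maps are the (anti)homomorphisms with the prescribed values on the
  generators, descended from the free ring.\<close>

definition hecke_comult ::
  "'i set \<Rightarrow> ('i \<Rightarrow> 'i \<Rightarrow> nat) \<Rightarrow> ('i gen list \<Rightarrow>\<^sub>0 int) set
    \<Rightarrow> (('i gen list \<Rightarrow>\<^sub>0 int) set \<times> ('i gen list \<Rightarrow>\<^sub>0 int) set \<Rightarrow>\<^sub>0 int) set" where
  "hecke_comult I m =
    (let H = hecke_hat I m; T = tensor_ring H H;
         v = (\<lambda>g. case g of
            GS i \<Rightarrow> tensor H H (s_el I m i) (s_el I m i)
          | GD i \<Rightarrow> tensor H H (D_el I m i) \<one>\<^bsub>H\<^esub> \<oplus>\<^bsub>T\<^esub> tensor H H (s_el I m i) (D_el I m i))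
     in induced (linear_extension T (word_eval T v)))"

definition hecke_counit ::
  "'i set \<Rightarrow> ('i \<Rightarrow> 'i \<Rightarrow> nat) \<Rightarrow> ('i gen list \<Rightarrow>\<^sub>0 int) set \<Rightarrow> int" where
  "hecke_counit I m =
    induced (linear_extension \<Z> (word_eval \<Z> (\<lambda>g. case g of GS i \<Rightarrow> 1 | GD i \<Rightarrow> 0)))"

definition hecke_antipode ::
  "'i set \<Rightarrow> ('i \<Rightarrow> 'i \<Rightarrow> nat) \<Rightarrow> ('i gen list \<Rightarrow>\<^sub>0 int) set \<Rightarrow> ('i gen list \<Rightarrow>\<^sub>0 int) set" where
  "hecke_antipode I m =
    (let H = hecke_hat I m;
         v = (\<lambda>g. case g of
            GS i \<Rightarrow> s_el I m i
          | GD i \<Rightarrow> \<ominus>\<^bsub>H\<^esub> (s_el I m i \<otimes>\<^bsub>H\<^esub> D_el I m i))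
     in induced (linear_extension H (\<lambda>w. word_eval H v (rev w))))"


section \<open>The subalgebras \<open>D_hat\<close> and \<open>K_alg\<close> and the ideal \<open>J_ideal\<close>\<close>

text \<open>The homomorphism from \<open>W\<close> to the units of \<open>hecke_hat\<close> sending \<open>s\<^sub>i\<close> to \<open>s\<^sub>i\<close>.\<close>

definition group_el ::
  "'i set \<Rightarrow> ('i \<Rightarrow> 'i \<Rightarrow> nat) \<Rightarrow> 'i list set \<Rightarrow> ('i gen list \<Rightarrow>\<^sub>0 int) set" where
  "group_el I m = induced (word_eval (hecke_hat I m) (s_el I m))"

text \<open>The family \<open>(D\<^sub>s)\<close> indexed by the reflections, as the unique one with the two defining
  properties.\<close>

definition D_refl ::
  "'i set \<Rightarrow> ('i \<Rightarrow> 'i \<Rightarrow> nat) \<Rightarrow> 'i list set \<Rightarrow> ('i gen list \<Rightarrow>\<^sub>0 int) set" where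
  "D_refl I m =
    (let W = coxeter_group I m; H = hecke_hat I m; \<sigma> = simple_refl I m in
      THE D. D \<in> reflections I m \<rightarrow>\<^sub>E carrier H \<and>
        (\<forall>i\<in>I. D (\<sigma> i) = D_el I m i) \<and>
        (\<forall>i\<in>I. \<forall>s\<in>reflections I m - {\<sigma> i}.
          D (\<sigma> i \<otimes>\<^bsub>W\<^esub> s \<otimes>\<^bsub>W\<^esub> \<sigma> i) = s_el I m i \<otimes>\<^bsub>H\<^esub> D s \<otimes>\<^bsub>H\<^esub> s_el I m i))"

definition D_hat :: "'i set \<Rightarrow> ('i \<Rightarrow> 'i \<Rightarrow> nat) \<Rightarrow> ('i gen list \<Rightarrow>\<^sub>0 int) set set" where
  "D_hat I m = generate_ring (hecke_hat I m) (D_refl I m ` reflections I m)"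

definition K_alg :: "'i set \<Rightarrow> ('i \<Rightarrow> 'i \<Rightarrow> nat) \<Rightarrow> ('i gen list \<Rightarrow>\<^sub>0 int) set set" where
  "K_alg I m =
    (let W = coxeter_group I m; H = hecke_hat I m in
      \<Inter>w\<in>carrier W.
        (\<lambda>x. group_el I m w \<otimes>\<^bsub>H\<^esub> x \<otimes>\<^bsub>H\<^esub> group_el I m (inv\<^bsub>W\<^esub> w)) ` D_hat I m)"

definition J_ideal :: "'i set \<Rightarrow> ('i \<Rightarrow> 'i \<Rightarrow> nat) \<Rightarrow> ('i gen list \<Rightarrow>\<^sub>0 int) set set" where
  "J_ideal I m = Idl\<^bsub>hecke_hat I m\<^esub> (K_alg I m \<inter> {x. hecke_counit I m x = 0})"

definition hecke_hopf ::
  "'i set \<Rightarrow> ('i \<Rightarrow> 'i \<Rightarrow> nat) \<Rightarrow> ('i gen list \<Rightarrow>\<^sub>0 int) set set ring" where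
  "hecke_hopf I m = hecke_hat I m Quot J_ideal I m"

end

(*
  Each D_s satisfies Delta(D_s) = D_s (x) 1 + s (x) D_s, so the subalgebra D of hecke_hat generated by the D_s
  is a left coideal, and so are its conjugates w D w^-1. As hecke_hat is free over the integers,
  tensoring with it commutes with intersections, whence Delta(K) lies in H (x) K. For k in K with
  counit 0 this gives Delta(k) in H (x) (K, counit 0) + k (x) 1, so J is a coideal; applying the
  antipode axiom to this formula gives S(k) in H J = J.

  For the existence of the D_s one needs that w D_i w^-1 = D_j whenever w maps the simple root of i to
  that of j. This is reduced to rank two, i.e. to the defining relations, by an induction on the
  length of w; it requires that s_i s_j has order exactly m_ij, which is read off the geometric
  representation. In place of freeness it suffices to have a dual basis, and this is obtained from
  an explicit action of hecke_hat on the free module on the products D_t ... D_t' w, the relations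
  being checked by means of the action of W on signed reflections.
*)
theory Submission
  imports Defs
begin

section \<open>Additive maps, linear extensions and quotients\<close>

text \<open>The structure maps of \<open>hecke_hat\<close> and its action on the free module come
  from one principle: values on the generators that satisfy the relations in some ring
  (\<open>hecke_rep\<close>). The antipode fits in through the opposite ring. Identities between
  ring homomorphisms are then checked on generators, those between additive maps on a tensor product
  on pure tensors.

  Positivity of roots is handled without roots: \<open>W\<close> acts on pairs of a reflection and a
  sign, and the resulting cocycle \<open>neg\<close> yields the exchange condition and a meaning for
  "w carries one simple root to another".

  The obstacle in constructing the action is that s_i D_i produces three terms, so the Coxeter
  relations among the operators \<open>s_op\<close> cannot be read off. They become visible once
  each D_t has a companion for the negative root of t; but the companion contains t itself, which
  acts in a well-defined way only if the relations are known. Filtering by the number of factors D_t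
  breaks this circle.

  Flatness alone would not handle the possibly infinite intersection defining \<open>K_alg\<close>;
  expansion in a dual basis does.\<close>

abbreviation add_hom where "add_hom R S \<equiv> hom (add_monoid R) (add_monoid S)"

lemma add_homI:
  assumes "\<And>x. x \<in> carrier R \<Longrightarrow> h x \<in> carrier S"
    and "\<And>x y. x \<in> carrier R \<Longrightarrow> y \<in> carrier R \<Longrightarrow> h (x \<oplus>\<^bsub>R\<^esub> y) = h x \<oplus>\<^bsub>S\<^esub> h y"
  shows "h \<in> add_hom R S"
  using assms by (auto simp: hom_def)

lemma add_hom_closed: "h \<in> add_hom R S \<Longrightarrow> x \<in> carrier R \<Longrightarrow> h x \<in> carrier S"
  by (auto simp: hom_def)

lemma add_hom_add:
  "h \<in> add_hom R S \<Longrightarrow> x \<in> carrier R \<Longrightarrow> y \<in> carrier R \<Longrightarrow> h (x \<oplus>\<^bsub>R\<^esub> y) = h x \<oplus>\<^bsub>S\<^esub> h y"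
  by (auto simp: hom_def)

context
  fixes R :: "('a, 'm) ring_scheme" and S :: "('b, 'n) ring_scheme" and h
  assumes R: "abelian_group R" and S: "abelian_group S" and h: "h \<in> add_hom R S"
begin

interpretation abelian_group_hom R S h
  using R S h by (intro abelian_group_homI) (auto simp: group_hom_def group_hom_axioms_def abelian_group.a_group)

lemma add_hom_zero: "h \<zero>\<^bsub>R\<^esub> = \<zero>\<^bsub>S\<^esub>"
  by simp

lemma add_hom_neg: "x \<in> carrier R \<Longrightarrow> h (\<ominus>\<^bsub>R\<^esub> x) = \<ominus>\<^bsub>S\<^esub> h x"
  by simp

lemma add_hom_diff:
  "x \<in> carrier R \<Longrightarrow> y \<in> carrier R \<Longrightarrow> h (x \<ominus>\<^bsub>R\<^esub> y) = h x \<ominus>\<^bsub>S\<^esub> h y"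
  by (simp add: a_minus_def R S abelian_group.a_inv_closed)

end

lemma add_hom_comp: "f \<in> add_hom R S \<Longrightarrow> g \<in> add_hom S T \<Longrightarrow> (\<lambda>x. g (f x)) \<in> add_hom R T"
  by (auto simp: hom_def Pi_def)

lemma ring_hom_add_hom: "h \<in> ring_hom R S \<Longrightarrow> h \<in> add_hom R S"
  by (auto simp: hom_def ring_hom_def)

lemma ring_hom_comp: "f \<in> ring_hom R S \<Longrightarrow> g \<in> ring_hom S T \<Longrightarrow> (\<lambda>x. g (f x)) \<in> ring_hom R T"
  by (auto simp: ring_hom_def Pi_def)

lemma frag_extend_diff_fun:
  fixes f g :: "'a \<Rightarrow> 'b \<Rightarrow>\<^sub>0 int"
  shows "frag_extend (\<lambda>a. f a - g a) p = frag_extend f p - frag_extend g p"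
proof -
  have "frag_cmul c (x - y) = frag_cmul c x - frag_cmul c y" for c and x y :: "'b \<Rightarrow>\<^sub>0 int"
    by (rule poly_mapping_eqI) (simp add: lookup_minus right_diff_distrib)
  then show ?thesis by (simp add: frag_extend_def sum_subtractf)
qed

lemma carrier_monoid_ring [simp]:
  "carrier (monoid_ring M) = {p. Poly_Mapping.keys p \<subseteq> carrier M}"
  and zero_monoid_ring [simp]: "\<zero>\<^bsub>monoid_ring M\<^esub> = 0"
  and add_monoid_ring [simp]: "x \<oplus>\<^bsub>monoid_ring M\<^esub> y = x + y"
  and one_monoid_ring [simp]: "\<one>\<^bsub>monoid_ring M\<^esub> = frag_of \<one>\<^bsub>M\<^esub>"
  by (simp_all add: monoid_ring_def)

lemma mult_monoid_ring:
  "p \<otimes>\<^bsub>monoid_ring M\<^esub> q = frag_extend (\<lambda>a. frag_extend (\<lambda>b. frag_of (a \<otimes>\<^bsub>M\<^esub> b)) q) p"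
  by (simp add: monoid_ring_def)

lemma mult_frag_of [simp]: "frag_of a \<otimes>\<^bsub>monoid_ring M\<^esub> frag_of b = frag_of (a \<otimes>\<^bsub>M\<^esub> b)"
  by (simp add: mult_monoid_ring)

lemma mult_zero_monoid_ring [simp]:
  "p \<otimes>\<^bsub>monoid_ring M\<^esub> 0 = 0" "0 \<otimes>\<^bsub>monoid_ring M\<^esub> p = 0"
  by (simp_all add: mult_monoid_ring frag_extend_def)

lemma mult_monoid_ring_diff:
  "(p - p') \<otimes>\<^bsub>monoid_ring M\<^esub> q = p \<otimes>\<^bsub>monoid_ring M\<^esub> q - p' \<otimes>\<^bsub>monoid_ring M\<^esub> q"
  "p \<otimes>\<^bsub>monoid_ring M\<^esub> (q - q') = p \<otimes>\<^bsub>monoid_ring M\<^esub> q - p \<otimes>\<^bsub>monoid_ring M\<^esub> q'"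
  by (simp_all add: mult_monoid_ring frag_extend_diff frag_extend_diff_fun)

lemma keys_diff_subset:
  "Poly_Mapping.keys p \<subseteq> A \<Longrightarrow> Poly_Mapping.keys q \<subseteq> A \<Longrightarrow> Poly_Mapping.keys (p - q :: _ \<Rightarrow>\<^sub>0 int) \<subseteq> A"
  using keys_diff[of p q] by blast

lemma keys_add_subset:
  "Poly_Mapping.keys p \<subseteq> A \<Longrightarrow> Poly_Mapping.keys q \<subseteq> A \<Longrightarrow> Poly_Mapping.keys (p + q :: _ \<Rightarrow>\<^sub>0 int) \<subseteq> A"
  using keys_add[of p q] by blast

text \<open>Multiplication is additive in each argument, so every law reduces to basis elements,
  where it is the law of the monoid. The reduction principle \<open>frag_induction\<close> proceeds
  by zero, basis element and difference, which is why \<open>mult_monoid_ring_diff\<close> is stated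
  for differences.\<close>

lemma ring_monoid_ring:
  assumes "monoid M"
  shows "ring (monoid_ring M)"
proof -
  interpret monoid M by fact
  have closed: "p \<otimes>\<^bsub>monoid_ring M\<^esub> q \<in> carrier (monoid_ring M)"
    if "p \<in> carrier (monoid_ring M)" "q \<in> carrier (monoid_ring M)" for p q
    using that keys_frag_extend[of _ p] keys_frag_extend[of _ q]
    by (fastforce simp: mult_monoid_ring)
  have distr: "(p + q) \<otimes>\<^bsub>monoid_ring M\<^esub> r = p \<otimes>\<^bsub>monoid_ring M\<^esub> r + q \<otimes>\<^bsub>monoid_ring M\<^esub> r"
    "r \<otimes>\<^bsub>monoid_ring M\<^esub> (p + q) = r \<otimes>\<^bsub>monoid_ring M\<^esub> p + r \<otimes>\<^bsub>monoid_ring M\<^esub> q" for p q r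
  proof -
    \<comment> \<open>A sum is a twofold difference, so the difference rules already give
      distributivity.\<close>
    have "p + q = p - (0 - q)" by simp
    then show "(p + q) \<otimes>\<^bsub>monoid_ring M\<^esub> r = p \<otimes>\<^bsub>monoid_ring M\<^esub> r + q \<otimes>\<^bsub>monoid_ring M\<^esub> r"
      "r \<otimes>\<^bsub>monoid_ring M\<^esub> (p + q) = r \<otimes>\<^bsub>monoid_ring M\<^esub> p + r \<otimes>\<^bsub>monoid_ring M\<^esub> q"
      by (simp_all only: mult_monoid_ring_diff mult_zero_monoid_ring) simp_all
  qed
  have one: "frag_of \<one>\<^bsub>M\<^esub> \<otimes>\<^bsub>monoid_ring M\<^esub> p = p \<and> p \<otimes>\<^bsub>monoid_ring M\<^esub> frag_of \<one>\<^bsub>M\<^esub> = p"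
    if "p \<in> carrier (monoid_ring M)" for p
    using that[simplified] by (induction p rule: frag_induction) (auto simp: mult_monoid_ring_diff)
  have assoc: "(p \<otimes>\<^bsub>monoid_ring M\<^esub> q) \<otimes>\<^bsub>monoid_ring M\<^esub> r = p \<otimes>\<^bsub>monoid_ring M\<^esub> (q \<otimes>\<^bsub>monoid_ring M\<^esub> r)"
    if p: "Poly_Mapping.keys p \<subseteq> carrier M" and q: "Poly_Mapping.keys q \<subseteq> carrier M" and r: "Poly_Mapping.keys r \<subseteq> carrier M" for p q r
    using p
  proof (induction p rule: frag_induction)
    case (one x)
    from q show ?case
    proof (induction q rule: frag_induction)
      case (one y)
      from r show ?case
        by (induction r rule: frag_induction) (use \<open>x \<in> _\<close> one in \<open>auto simp: mult_monoid_ring_diff m_assoc\<close>)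
    qed (auto simp: mult_monoid_ring_diff)
  qed (auto simp: mult_monoid_ring_diff)
  show ?thesis
  proof (rule ringI)
    show "abelian_group (monoid_ring M)"
    proof (rule abelian_groupI)
      show "\<exists>y\<in>carrier (monoid_ring M). y \<oplus>\<^bsub>monoid_ring M\<^esub> x = \<zero>\<^bsub>monoid_ring M\<^esub>"
        if "x \<in> carrier (monoid_ring M)" for x
        by (rule bexI[of _ "- x"]) (use that in auto)
    qed (auto simp: keys_add_subset dest: subsetD[OF keys_add])
    show "monoid (monoid_ring M)"
      using closed one assoc by unfold_locales auto
  qed (use distr in auto)
qed

lemma minus_monoid_ring:
  assumes "monoid M" "p \<in> carrier (monoid_ring M)" "q \<in> carrier (monoid_ring M)"
  shows "\<ominus>\<^bsub>monoid_ring M\<^esub> p = - p" "p \<ominus>\<^bsub>monoid_ring M\<^esub> q = p - q"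
proof -
  interpret ring "monoid_ring M" by (rule ring_monoid_ring) fact
  have *: "\<ominus>\<^bsub>monoid_ring M\<^esub> p = - p" if "p \<in> carrier (monoid_ring M)" for p
    by (rule minus_equality) (use that in auto)
  show "\<ominus>\<^bsub>monoid_ring M\<^esub> p = - p"
    using *[OF assms(2)] .
  show "p \<ominus>\<^bsub>monoid_ring M\<^esub> q = p - q"
    using *[OF assms(3)] by (simp add: a_minus_def)
qed

context abelian_group
begin

lemma linear_extension_zero [simp]: "linear_extension G \<phi> 0 = \<zero>"
  by (simp add: linear_extension_def)

context
  fixes \<phi> :: "'k \<Rightarrow> 'a" and K
  assumes \<phi>: "\<And>k. k \<in> K \<Longrightarrow> \<phi> k \<in> carrier G"
begin

text \<open>The supports of \<open>p\<close>, \<open>q\<close> and \<open>p + q\<close> differ;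
  summing over a common larger finite set makes additivity a termwise statement.\<close>

lemma linear_extension_superset:
  assumes "finite U" "Poly_Mapping.keys p \<subseteq> U" "U \<subseteq> K"
  shows "linear_extension G \<phi> p = (\<Oplus>k\<in>U. [Poly_Mapping.lookup p k] \<cdot>\<^bsub>G\<^esub> \<phi> k)"
  unfolding linear_extension_def
proof (rule add.finprod_mono_neutral_cong_left)
  show "\<And>i. i \<in> U - Poly_Mapping.keys p \<Longrightarrow> [Poly_Mapping.lookup p i] \<cdot>\<^bsub>G\<^esub> \<phi> i = \<zero>"
    by (simp add: in_keys_iff add_pow_def)
qed (use assms \<phi> in \<open>auto simp: Pi_iff intro!: add.int_pow_closed\<close>)

lemma linear_extension_closed:
  "Poly_Mapping.keys p \<subseteq> K \<Longrightarrow> linear_extension G \<phi> p \<in> carrier G"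
  unfolding linear_extension_def by (rule finsum_closed) (use \<phi> in \<open>auto intro!: add.int_pow_closed\<close>)

lemma linear_extension_add:
  assumes "Poly_Mapping.keys p \<subseteq> K" "Poly_Mapping.keys q \<subseteq> K"
  shows "linear_extension G \<phi> (p + q) = linear_extension G \<phi> p \<oplus> linear_extension G \<phi> q"
proof -
  let ?U = "Poly_Mapping.keys p \<union> Poly_Mapping.keys q"
  have "linear_extension G \<phi> (p + q) = (\<Oplus>k\<in>?U. [Poly_Mapping.lookup p k] \<cdot>\<^bsub>G\<^esub> \<phi> k \<oplus> [Poly_Mapping.lookup q k] \<cdot>\<^bsub>G\<^esub> \<phi> k)"
    by (subst linear_extension_superset[where U = ?U])
      (use assms \<phi> keys_add[of p q] in \<open>auto simp: lookup_add add.int_pow_mult intro!: finsum_cong'\<close>)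
  also have "\<dots> = linear_extension G \<phi> p \<oplus> linear_extension G \<phi> q"
    by (subst finsum_addf)
      (use assms \<phi> in \<open>auto simp: linear_extension_superset[where U = ?U] intro!: add.int_pow_closed\<close>)
  finally show ?thesis .
qed

lemma linear_extension_of [simp]: "k \<in> K \<Longrightarrow> linear_extension G \<phi> (frag_of k) = \<phi> k"
  using \<phi>[of k] by (simp add: linear_extension_def)

lemma linear_extension_diff:
  assumes "Poly_Mapping.keys p \<subseteq> K" "Poly_Mapping.keys q \<subseteq> K"
  shows "linear_extension G \<phi> (p - q) = linear_extension G \<phi> p \<ominus> linear_extension G \<phi> q"
proof -
  have "linear_extension G \<phi> p = linear_extension G \<phi> (p - q) \<oplus> linear_extension G \<phi> q"
    using linear_extension_add[OF keys_diff_subset[OF assms] assms(2)] by simp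
  then show ?thesis
    using assms keys_diff_subset[OF assms] by (simp add: linear_extension_closed add.inv_solve_right a_minus_def)
qed

end

end

lemma linear_extension_add_hom:
  assumes "abelian_group R" "\<And>k. k \<in> carrier M \<Longrightarrow> \<phi> k \<in> carrier R"
  shows "linear_extension R \<phi> \<in> add_hom (monoid_ring M) R"
  using assms abelian_group.linear_extension_closed[OF assms] abelian_group.linear_extension_add[OF assms]
  by (intro add_homI) auto

text \<open>The universal property of the monoid ring. Both sides of the product rule are additive
  in each factor, so basis elements suffice. The support condition is carried along in the two
  inductions because the difference case of \<open>frag_induction\<close> offers only what the
  induction statement contains.\<close>

lemma linear_extension_ring_hom:
  assumes R: "ring R" and M: "monoid M" and \<phi>: "\<phi> \<in> hom M R" "\<phi> \<one>\<^bsub>M\<^esub> = \<one>\<^bsub>R\<^esub>"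
  shows "linear_extension R \<phi> \<in> ring_hom (monoid_ring M) R"
proof -
  interpret R: ring R by fact
  interpret M: monoid M by fact
  interpret MR: ring "monoid_ring M" by (rule ring_monoid_ring) fact
  note cl = R.linear_extension_closed[where K = "carrier M" and \<phi> = \<phi>]
  note of = R.linear_extension_of[where K = "carrier M" and \<phi> = \<phi>]
  note diff = R.linear_extension_diff[where K = "carrier M" and \<phi> = \<phi>]
  have c: "\<And>k. k \<in> carrier M \<Longrightarrow> \<phi> k \<in> carrier R" using \<phi> by (auto simp: hom_def)
  have mult: "linear_extension R \<phi> (p \<otimes>\<^bsub>monoid_ring M\<^esub> q) = linear_extension R \<phi> p \<otimes>\<^bsub>R\<^esub> linear_extension R \<phi> q"
    if p: "Poly_Mapping.keys p \<subseteq> carrier M" and q: "Poly_Mapping.keys q \<subseteq> carrier M" for p q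
  proof -
    have pr: "Poly_Mapping.keys (x \<otimes>\<^bsub>monoid_ring M\<^esub> y) \<subseteq> carrier M"
      if "Poly_Mapping.keys x \<subseteq> carrier M" "Poly_Mapping.keys y \<subseteq> carrier M" for x y
      using MR.m_closed[of x y] that by simp
    have "linear_extension R \<phi> (p \<otimes>\<^bsub>monoid_ring M\<^esub> q) = linear_extension R \<phi> p \<otimes>\<^bsub>R\<^esub> linear_extension R \<phi> q \<and> Poly_Mapping.keys p \<subseteq> carrier M"
      using p
    proof (induction p rule: frag_induction)
      case (one x)
      have "linear_extension R \<phi> (frag_of x \<otimes>\<^bsub>monoid_ring M\<^esub> q) = linear_extension R \<phi> (frag_of x) \<otimes>\<^bsub>R\<^esub> linear_extension R \<phi> q \<and> Poly_Mapping.keys q \<subseteq> carrier M"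
        using q
      proof (induction q rule: frag_induction)
        case (one y)
        then show ?case using \<open>x \<in> _\<close> c \<phi> of by (auto simp: hom_def)
      next
        case (diff a b)
        then show ?case using \<open>x \<in> _\<close> c cl of
          by (simp add: mult_monoid_ring_diff R.linear_extension_diff[where K = "carrier M", OF c] pr R.r_distr R.r_minus a_minus_def keys_diff_subset)
      qed (use \<open>x \<in> _\<close> c cl of in \<open>auto simp: R.linear_extension_zero\<close>)
      then show ?case using one by simp
    next
      case (diff a b)
      then show ?case using q c cl
        by (simp add: mult_monoid_ring_diff R.linear_extension_diff[where K = "carrier M", OF c] pr R.l_distr R.l_minus a_minus_def keys_diff_subset)
    qed (use q c cl in \<open>auto simp: R.linear_extension_zero\<close>)
    then show ?thesis ..
  qed
  show ?thesis
    by (rule ring_hom_memI)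
      (use c cl \<phi>(2) mult in \<open>auto simp: R.linear_extension_add[where K = "carrier M"] R.linear_extension_of[where K = "carrier M"]\<close>)
qed

lemma carrier_quot: "carrier (R Quot I) = (\<lambda>x. I +>\<^bsub>R\<^esub> x) ` carrier R"
  by (auto simp: FactRing_simps)

context ideal
begin

text \<open>Additivity and vanishing on \<open>I\<close> make \<open>h\<close> constant on the
  coset, and \<open>x\<close> lies in it; so the image is a singleton and \<open>the_elem\<close> is
  meaningful.\<close>

lemma induced_coset:
  assumes S: "abelian_group S" and h: "h \<in> add_hom R S" "\<And>x. x \<in> I \<Longrightarrow> h x = \<zero>\<^bsub>S\<^esub>"
    and x: "x \<in> carrier R"
  shows "induced h (I +> x) = h x"
proof -
  interpret S: abelian_group S by fact
  have "h y = h x" if "y \<in> I +> x" for y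
  proof -
    from that obtain a where a: "a \<in> I" "y = a \<oplus> x" by (auto simp: a_r_coset_def')
    then show ?thesis using h x add_hom_closed[OF h(1)] by (simp add: add_hom_add[OF h(1)])
  qed
  moreover have "x \<in> I +> x" using a_rcos_self x by simp
  ultimately have "h ` (I +> x) = {h x}"
    using image_cong[OF HOL.refl, of "I +> x" h "\<lambda>_. h x"] image_constant[of x "I +> x" "h x"] by metis
  then show ?thesis by (simp add: induced_def)
qed

lemma quot_simps:
  "x \<in> carrier R \<Longrightarrow> y \<in> carrier R \<Longrightarrow> (I +> x) \<oplus>\<^bsub>R Quot I\<^esub> (I +> y) = I +> (x \<oplus> y)"
  "x \<in> carrier R \<Longrightarrow> y \<in> carrier R \<Longrightarrow> (I +> x) \<otimes>\<^bsub>R Quot I\<^esub> (I +> y) = I +> (x \<otimes> y)"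
  "\<one>\<^bsub>R Quot I\<^esub> = I +> \<one>"
  using rcos_ring_hom by (auto simp: ring_hom_def)

lemma induced_add_hom:
  assumes S: "abelian_group S" and h: "h \<in> add_hom R S" "\<And>x. x \<in> I \<Longrightarrow> h x = \<zero>\<^bsub>S\<^esub>"
  shows "induced h \<in> add_hom (R Quot I) S"
  by (rule add_homI)
    (auto simp: carrier_quot induced_coset[OF S h] quot_simps add_hom_closed[OF h(1)] add_hom_add[OF h(1)])

lemma induced_ring_hom:
  assumes S: "ring S" and h: "h \<in> ring_hom R S" "\<And>x. x \<in> I \<Longrightarrow> h x = \<zero>\<^bsub>S\<^esub>"
  shows "induced h \<in> ring_hom (R Quot I) S"
proof -
  note * = induced_coset[OF ring.is_abelian_group[OF S] ring_hom_add_hom[OF h(1)] h(2)]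
  show ?thesis
    by (rule ring_hom_memI)
      (use h(1) in \<open>auto simp: carrier_quot * quot_simps ring_hom_add ring_hom_mult ring_hom_one ring_hom_closed\<close>)
qed

end

text \<open>The kernel of \<open>h\<close> is an ideal containing \<open>U\<close>.\<close>

lemma vanish_genideal:
  assumes "ring R" "ring S" "h \<in> ring_hom R S" "U \<subseteq> carrier R" "\<And>x. x \<in> U \<Longrightarrow> h x = \<zero>\<^bsub>S\<^esub>"
    and "x \<in> Idl\<^bsub>R\<^esub> U"
  shows "h x = \<zero>\<^bsub>S\<^esub>"
proof -
  interpret ring_hom_ring R S h by (rule ring_hom_ringI2) (fact assms)+
  have "U \<subseteq> a_kernel R S h"
    unfolding a_kernel_def' using assms(4,5) by blast
  from R.genideal_minimal[OF kernel_is_ideal this] assms(6) show ?thesis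
    unfolding a_kernel_def' by blast
qed

section \<open>Tensor products\<close>

definition biadditive where
  "biadditive A B C \<phi> \<longleftrightarrow>
    (\<forall>a\<in>carrier A. \<forall>b\<in>carrier B. \<phi> a b \<in> carrier C) \<and>
    (\<forall>a\<in>carrier A. \<forall>a'\<in>carrier A. \<forall>b\<in>carrier B. \<phi> (a \<oplus>\<^bsub>A\<^esub> a') b = \<phi> a b \<oplus>\<^bsub>C\<^esub> \<phi> a' b) \<and>
    (\<forall>a\<in>carrier A. \<forall>b\<in>carrier B. \<forall>b'\<in>carrier B. \<phi> a (b \<oplus>\<^bsub>B\<^esub> b') = \<phi> a b \<oplus>\<^bsub>C\<^esub> \<phi> a b')"

lemma biadditiveI:
  assumes "\<And>a b. a \<in> carrier A \<Longrightarrow> b \<in> carrier B \<Longrightarrow> \<phi> a b \<in> carrier C"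
    and "\<And>a a' b. a \<in> carrier A \<Longrightarrow> a' \<in> carrier A \<Longrightarrow> b \<in> carrier B \<Longrightarrow> \<phi> (a \<oplus>\<^bsub>A\<^esub> a') b = \<phi> a b \<oplus>\<^bsub>C\<^esub> \<phi> a' b"
    and "\<And>a b b'. a \<in> carrier A \<Longrightarrow> b \<in> carrier B \<Longrightarrow> b' \<in> carrier B \<Longrightarrow> \<phi> a (b \<oplus>\<^bsub>B\<^esub> b') = \<phi> a b \<oplus>\<^bsub>C\<^esub> \<phi> a b'"
  shows "biadditive A B C \<phi>"
  using assms by (simp add: biadditive_def)

locale ring_pair = A: ring A + B: ring B
  for A :: "('a, 'm) ring_scheme" and B :: "('b, 'n) ring_scheme"
begin

abbreviation "MR \<equiv> monoid_ring (A \<times>\<times> B)"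
abbreviation "T \<equiv> tensor_ring A B"

lemma monoid_pair: "monoid (A \<times>\<times> B)"
  by (rule DirProd_monoid) (rule A.monoid_axioms B.monoid_axioms)+

sublocale MR: ring MR
  by (rule ring_monoid_ring) (rule monoid_pair)

lemma carrier_pair [simp]: "carrier (A \<times>\<times> B) = carrier A \<times> carrier B"
  by (simp add: DirProd_def)

lemma mult_pair [simp]: "(a, b) \<otimes>\<^bsub>A \<times>\<times> B\<^esub> (a', b') = (a \<otimes>\<^bsub>A\<^esub> a', b \<otimes>\<^bsub>B\<^esub> b')"
  and one_pair [simp]: "\<one>\<^bsub>A \<times>\<times> B\<^esub> = (\<one>\<^bsub>A\<^esub>, \<one>\<^bsub>B\<^esub>)"
  by (simp_all add: DirProd_def)

lemma biadditive_relations_subset: "biadditive_relations A B \<subseteq> carrier MR"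
proof
  fix p assume "p \<in> biadditive_relations A B"
  then show "p \<in> carrier MR"
    unfolding biadditive_relations_def
    by (elim UnE CollectE exE conjE) (simp_all add: keys_diff_subset keys_frag_of)
qed

sublocale tensor_ideal: ideal "tensor_ideal A B" MR
  unfolding tensor_ideal_def by (rule MR.genideal_ideal) (rule biadditive_relations_subset)

lemma tensor_ring_ring: "ring T"
  unfolding tensor_ring_def by (rule tensor_ideal.quotient_is_ring)

sublocale T: ring T
  by (rule tensor_ring_ring)

lemma tensor_closed [simp, intro]:
  "a \<in> carrier A \<Longrightarrow> b \<in> carrier B \<Longrightarrow> tensor A B a b \<in> carrier T"
  by (auto simp: tensor_def tensor_ring_def carrier_quot keys_frag_of)

lemma tensor_mult [simp]:
  assumes "a \<in> carrier A" "b \<in> carrier B" "a' \<in> carrier A" "b' \<in> carrier B"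
  shows "tensor A B a b \<otimes>\<^bsub>T\<^esub> tensor A B a' b' = tensor A B (a \<otimes>\<^bsub>A\<^esub> a') (b \<otimes>\<^bsub>B\<^esub> b')"
  using assms by (simp add: tensor_def tensor_ring_def tensor_ideal.quot_simps keys_frag_of)

lemma tensor_one: "\<one>\<^bsub>T\<^esub> = tensor A B \<one>\<^bsub>A\<^esub> \<one>\<^bsub>B\<^esub>"
  by (simp add: tensor_def tensor_ring_def tensor_ideal.quot_simps)

lemma tensor_ideal_eqI:
  assumes "p \<in> carrier MR" "q \<in> carrier MR" "p - q \<in> tensor_ideal A B"
  shows "tensor_ideal A B +>\<^bsub>MR\<^esub> p = tensor_ideal A B +>\<^bsub>MR\<^esub> q"
  using assms by (simp add: MR.quotient_eq_iff_same_a_r_cos[OF tensor_ideal.ideal_axioms, symmetric] minus_monoid_ring[OF monoid_pair])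

lemma tensor_add_left:
  assumes "a \<in> carrier A" "a' \<in> carrier A" "b \<in> carrier B"
  shows "tensor A B (a \<oplus>\<^bsub>A\<^esub> a') b = tensor A B a b \<oplus>\<^bsub>T\<^esub> tensor A B a' b"
proof -
  have "frag_of (a \<oplus>\<^bsub>A\<^esub> a', b) - (frag_of (a, b) + frag_of (a', b)) \<in> tensor_ideal A B"
    unfolding tensor_ideal_def
    by (rule subsetD[OF MR.genideal_self[OF biadditive_relations_subset]])
      (use assms in \<open>auto simp: biadditive_relations_def diff_diff_eq\<close>)
  from tensor_ideal_eqI[OF _ _ this] show ?thesis using assms
    by (simp add: tensor_def tensor_ring_def tensor_ideal.quot_simps keys_frag_of keys_add_subset)
qed

lemma tensor_add_right:
  assumes "a \<in> carrier A" "b \<in> carrier B" "b' \<in> carrier B"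
  shows "tensor A B a (b \<oplus>\<^bsub>B\<^esub> b') = tensor A B a b \<oplus>\<^bsub>T\<^esub> tensor A B a b'"
proof -
  have "frag_of (a, b \<oplus>\<^bsub>B\<^esub> b') - (frag_of (a, b) + frag_of (a, b')) \<in> tensor_ideal A B"
    unfolding tensor_ideal_def
    by (rule subsetD[OF MR.genideal_self[OF biadditive_relations_subset]])
      (use assms in \<open>auto simp: biadditive_relations_def diff_diff_eq\<close>)
  from tensor_ideal_eqI[OF _ _ this] show ?thesis using assms
    by (simp add: tensor_def tensor_ring_def tensor_ideal.quot_simps keys_frag_of keys_add_subset)
qed

lemma biadditive_tensor: "biadditive A B T (tensor A B)"
  by (rule biadditiveI) (auto simp: tensor_add_left tensor_add_right)

lemma tensor_left_add_hom: "b \<in> carrier B \<Longrightarrow> (\<lambda>a. tensor A B a b) \<in> add_hom A T"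
  and tensor_right_add_hom: "a \<in> carrier A \<Longrightarrow> tensor A B a \<in> add_hom B T"
  by (rule add_homI; simp add: tensor_add_left tensor_add_right)+

lemma tensor_zero_left: "b \<in> carrier B \<Longrightarrow> tensor A B \<zero>\<^bsub>A\<^esub> b = \<zero>\<^bsub>T\<^esub>"
  and tensor_zero_right: "a \<in> carrier A \<Longrightarrow> tensor A B a \<zero>\<^bsub>B\<^esub> = \<zero>\<^bsub>T\<^esub>"
  using add_hom_zero[OF A.is_abelian_group T.is_abelian_group tensor_left_add_hom]
    add_hom_zero[OF B.is_abelian_group T.is_abelian_group tensor_right_add_hom] by auto

lemma tensor_induct [consumes 1, case_names tensor diff]:
  assumes U: "U \<in> carrier T"
    and t: "\<And>a b. a \<in> carrier A \<Longrightarrow> b \<in> carrier B \<Longrightarrow> P (tensor A B a b)"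
    and d: "\<And>U V. U \<in> carrier T \<Longrightarrow> V \<in> carrier T \<Longrightarrow> P U \<Longrightarrow> P V \<Longrightarrow> P (U \<ominus>\<^bsub>T\<^esub> V)"
  shows "P U"
proof -
  let ?c = "\<lambda>p. tensor_ideal A B +>\<^bsub>MR\<^esub> p"
  obtain p where p: "Poly_Mapping.keys p \<subseteq> carrier (A \<times>\<times> B)" "U = ?c p"
    using U by (auto simp: tensor_ring_def carrier_quot)
  have "P (?c p) \<and> Poly_Mapping.keys p \<subseteq> carrier (A \<times>\<times> B)" using p(1)
  proof (induction p rule: frag_induction)
    case zero
    have "P (tensor A B \<zero>\<^bsub>A\<^esub> \<zero>\<^bsub>B\<^esub>)" by (rule t) auto
    then have "P \<zero>\<^bsub>T\<^esub>" by (simp add: tensor_zero_left)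
    moreover have "tensor_ideal A B +>\<^bsub>MR\<^esub> 0 = tensor_ideal A B"
      using tensor_ideal.a_rcos_const[of 0] tensor_ideal.zero_closed by simp
    ultimately show ?case by (simp add: tensor_ring_def FactRing_def)
  next
    case (one x)
    then show ?case using t[of "fst x" "snd x"] by (auto simp: tensor_def)
  next
    case (diff a b)
    have c: "?c \<in> ring_hom MR T" unfolding tensor_ring_def by (rule tensor_ideal.rcos_ring_hom)
    have "?c (a - b) = ?c a \<ominus>\<^bsub>T\<^esub> ?c b"
      using add_hom_diff[OF MR.is_abelian_group T.is_abelian_group ring_hom_add_hom[OF c], of a b] diff
      by (simp add: minus_monoid_ring[OF monoid_pair])
    then show ?case using diff d[of "?c a" "?c b"] ring_hom_closed[OF c] by (auto simp: keys_diff_subset)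
  qed
  then show ?thesis using p by simp
qed

lemma add_hom_eqI:
  assumes "abelian_group S" "f \<in> add_hom T S" "g \<in> add_hom T S"
    and "\<And>a b. a \<in> carrier A \<Longrightarrow> b \<in> carrier B \<Longrightarrow> f (tensor A B a b) = g (tensor A B a b)"
    and "U \<in> carrier T"
  shows "f U = g U"
  using assms(5)
  by (induction U rule: tensor_induct)
    (simp_all add: assms(4) add_hom_diff[OF T.is_abelian_group assms(1,2)] add_hom_diff[OF T.is_abelian_group assms(1,3)])

text \<open>The linear extension is only additive, so its kernel need not be an ideal, while
  \<open>tensor_ideal\<close> is generated as an ideal. The remedy is to treat all biadditive maps
  at once: the common kernel \<open>N\<close> of all their linear extensions is an ideal.\<close>

lemma linear_extension_vanish:
  assumes C: "ring C" and \<phi>: "biadditive A B C \<phi>" and p: "p \<in> tensor_ideal A B"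
  shows "linear_extension C (\<lambda>(a, b). \<phi> a b) p = \<zero>\<^bsub>C\<^esub>"
proof -
  interpret C: ring C by fact
  let ?L = "\<lambda>\<phi>. linear_extension C (\<lambda>(a, b). \<phi> a b)"
  have L: "?L \<phi> \<in> add_hom MR C" if "biadditive A B C \<phi>" for \<phi>
    by (rule linear_extension_add_hom) (use that C.is_abelian_group in \<open>auto simp: biadditive_def\<close>)
  note Ldiff = add_hom_diff[OF MR.is_abelian_group C.is_abelian_group L]
  have Ldiff: "?L \<phi> (x - y) = ?L \<phi> x \<ominus>\<^bsub>C\<^esub> ?L \<phi> y" if "biadditive A B C \<phi>" "x \<in> carrier MR" "y \<in> carrier MR" for \<phi> x y
    using Ldiff[OF that] that by (simp add: minus_monoid_ring[OF monoid_pair])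
  have Lof: "?L \<phi> (frag_of (a, b)) = \<phi> a b" if "biadditive A B C \<phi>" "a \<in> carrier A" "b \<in> carrier B" for \<phi> a b
    using C.linear_extension_of[of "carrier A \<times> carrier B" "\<lambda>(a, b). \<phi> a b" "(a, b)"] that
    by (auto simp: biadditive_def)
  have L0: "?L \<phi> 0 = \<zero>\<^bsub>C\<^esub>" for \<phi>
    by (simp add: linear_extension_def)
  have Lc: "?L \<phi> x \<in> carrier C" if "biadditive A B C \<phi>" "x \<in> carrier MR" for \<phi> x
    using add_hom_closed[OF L] that by blast
  define N where "N = {p \<in> carrier MR. \<forall>\<phi>. biadditive A B C \<phi> \<longrightarrow> ?L \<phi> p = \<zero>\<^bsub>C\<^esub>}"
  have N_diff: "x - y \<in> N" if "x \<in> N" "y \<in> N" for x y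
    using that by (simp add: N_def Ldiff keys_diff_subset C.minus_eq)
  \<comment> \<open>Multiplying by a basis pair on either side amounts to replacing
    \<open>\<phi>\<close> by another biadditive map; this is why the common kernel is closed under
    multiplication.\<close>
  have mult_basis: "?L \<phi> (frag_of (c, d) \<otimes>\<^bsub>MR\<^esub> p) = ?L (\<lambda>a b. \<phi> (c \<otimes>\<^bsub>A\<^esub> a) (d \<otimes>\<^bsub>B\<^esub> b)) p \<and>
      ?L \<phi> (p \<otimes>\<^bsub>MR\<^esub> frag_of (c, d)) = ?L (\<lambda>a b. \<phi> (a \<otimes>\<^bsub>A\<^esub> c) (b \<otimes>\<^bsub>B\<^esub> d)) p \<and> p \<in> carrier MR"
    if p: "p \<in> carrier MR" and \<phi>: "biadditive A B C \<phi>" and c: "c \<in> carrier A" and d: "d \<in> carrier B" for p \<phi> c d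
  proof -
    have b: "biadditive A B C (\<lambda>a b. \<phi> (c \<otimes>\<^bsub>A\<^esub> a) (d \<otimes>\<^bsub>B\<^esub> b))" "biadditive A B C (\<lambda>a b. \<phi> (a \<otimes>\<^bsub>A\<^esub> c) (b \<otimes>\<^bsub>B\<^esub> d))"
      using \<phi> c d by (auto simp: biadditive_def A.r_distr B.r_distr A.l_distr B.l_distr)
    have cd: "frag_of (c, d) \<in> carrier MR" using c d by (simp add: keys_frag_of)
    show ?thesis
      using p[simplified]
    proof (induction p rule: frag_induction)
      case (one x)
      then show ?case using c d \<phi> b by (cases x) (auto simp: Lof keys_frag_of)
    next
      case (diff x y)
      then show ?case using cd MR.m_closed[of "frag_of (c, d)"] MR.m_closed[of _ "frag_of (c, d)"]
        by (simp add: mult_monoid_ring_diff Ldiff \<phi> b keys_diff_subset)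
    qed (simp add: L0)
  qed
  have N_mult: "x \<otimes>\<^bsub>MR\<^esub> p \<in> N \<and> p \<otimes>\<^bsub>MR\<^esub> x \<in> N" if "p \<in> N" "x \<in> carrier MR" for x p
    using that(2)[simplified]
  proof (induction x rule: frag_induction)
    case zero
    then show ?case using that by (auto simp: N_def L0)
  next
    case (one x)
    obtain c d where [simp]: "x = (c, d)" by force
    have cd: "c \<in> carrier A" "d \<in> carrier B" using one by auto
    have b: "biadditive A B C (\<lambda>a b. \<phi> (c \<otimes>\<^bsub>A\<^esub> a) (d \<otimes>\<^bsub>B\<^esub> b))" "biadditive A B C (\<lambda>a b. \<phi> (a \<otimes>\<^bsub>A\<^esub> c) (b \<otimes>\<^bsub>B\<^esub> d))"
      if \<phi>: "biadditive A B C \<phi>" for \<phi>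
      using \<phi> cd by (auto simp: biadditive_def A.r_distr B.r_distr A.l_distr B.l_distr)
    have "frag_of (c, d) \<in> carrier MR" using cd by (simp add: keys_frag_of)
    then show ?case
      using \<open>p \<in> N\<close> mult_basis[of p _ c d] cd b MR.m_closed[of "frag_of (c, d)" p] MR.m_closed[of p "frag_of (c, d)"]
      by (auto simp: N_def)
  qed (auto simp: mult_monoid_ring_diff N_diff)
  have "ideal N MR"
  proof (rule idealI)
    show "subgroup N (add_monoid MR)"
    proof (rule subgroup.intro)
      have "0 \<in> N" by (simp add: N_def L0)
      then have neg: "- x \<in> N" if "x \<in> N" for x using N_diff[of 0 x] that by simp
      show "x \<otimes>\<^bsub>add_monoid MR\<^esub> y \<in> N" if "x \<in> N" "y \<in> N" for x y
        using N_diff[OF that(1) neg[OF that(2)]] by simp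
      show "inv\<^bsub>add_monoid MR\<^esub> x \<in> N" if "x \<in> N" for x
      proof -
        have "x \<in> carrier MR" using that by (simp add: N_def)
        from minus_monoid_ring(1)[OF monoid_pair this this] show ?thesis
          using neg[OF that] by (simp add: a_inv_def)
      qed
    qed (auto simp: N_def L0)
  qed (use N_mult MR.ring_axioms in auto)
  moreover have "biadditive_relations A B \<subseteq> N"
  proof -
    have "p \<in> N" if "p \<in> biadditive_relations A B" for p
    proof -
      have "?L \<phi> p = \<zero>\<^bsub>C\<^esub>" if \<phi>: "biadditive A B C \<phi>" for \<phi>
      proof -
        have cl: "\<And>a b. a \<in> carrier A \<Longrightarrow> b \<in> carrier B \<Longrightarrow> \<phi> a b \<in> carrier C"
          using \<phi> by (simp add: biadditive_def)
        have "(x \<oplus>\<^bsub>C\<^esub> y) \<ominus>\<^bsub>C\<^esub> x \<ominus>\<^bsub>C\<^esub> y = \<zero>\<^bsub>C\<^esub>" if "x \<in> carrier C" "y \<in> carrier C" for x y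
          using that by (simp add: C.minus_eq C.a_assoc C.a_comm[of x] C.r_neg C.r_neg1 C.r_neg2 C.l_neg)
        then show ?thesis
          using \<open>p \<in> biadditive_relations A B\<close> \<phi> cl
          by (auto simp: biadditive_relations_def Ldiff Lof keys_frag_of keys_diff_subset biadditive_def)
      qed
      then show ?thesis using that biadditive_relations_subset by (auto simp: N_def)
    qed
    then show ?thesis by blast
  qed
  ultimately have "tensor_ideal A B \<subseteq> N"
    unfolding tensor_ideal_def by (rule MR.genideal_minimal)
  then show ?thesis using p \<phi> by (auto simp: N_def)
qed

context
  fixes C :: "('c, 'o) ring_scheme" and \<phi>
  assumes C: "ring C" and \<phi>: "biadditive A B C \<phi>"
begin

interpretation C: ring C by (fact C)

lemma tensor_lift_add_hom: "tensor_lift C \<phi> \<in> add_hom T C"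
  unfolding tensor_lift_def tensor_ring_def
  by (rule tensor_ideal.induced_add_hom[OF C.is_abelian_group linear_extension_add_hom[OF C.is_abelian_group]])
    (use \<phi> linear_extension_vanish[OF C \<phi>] in \<open>auto simp: biadditive_def\<close>)

lemma tensor_lift_tensor:
  assumes "a \<in> carrier A" "b \<in> carrier B"
  shows "tensor_lift C \<phi> (tensor A B a b) = \<phi> a b"
proof -
  have "tensor_lift C \<phi> (tensor A B a b) = linear_extension C (\<lambda>(a, b). \<phi> a b) (frag_of (a, b))"
    unfolding tensor_lift_def tensor_def
    by (rule tensor_ideal.induced_coset[OF C.is_abelian_group linear_extension_add_hom[OF C.is_abelian_group]])
      (use \<phi> linear_extension_vanish[OF C \<phi>] assms in \<open>auto simp: biadditive_def keys_frag_of\<close>)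
  also have "\<dots> = \<phi> a b"
    using C.linear_extension_of[of "carrier A \<times> carrier B" "\<lambda>(a, b). \<phi> a b" "(a, b)"] \<phi> assms
    by (auto simp: biadditive_def)
  finally show ?thesis .
qed

end

lemma ring_homI_tensor:
  assumes C: "ring C" and f: "f \<in> add_hom T C" and one: "f \<one>\<^bsub>T\<^esub> = \<one>\<^bsub>C\<^esub>"
    and mult: "\<And>a b a' b'. a \<in> carrier A \<Longrightarrow> b \<in> carrier B \<Longrightarrow> a' \<in> carrier A \<Longrightarrow> b' \<in> carrier B \<Longrightarrow>
      f (tensor A B (a \<otimes>\<^bsub>A\<^esub> a') (b \<otimes>\<^bsub>B\<^esub> b')) = f (tensor A B a b) \<otimes>\<^bsub>C\<^esub> f (tensor A B a' b')"
  shows "f \<in> ring_hom T C"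
proof -
  interpret C: ring C by fact
  note cl = add_hom_closed[OF f] and diff = add_hom_diff[OF T.is_abelian_group C.is_abelian_group f]
  have "f (U \<otimes>\<^bsub>T\<^esub> V) = f U \<otimes>\<^bsub>C\<^esub> f V" if U: "U \<in> carrier T" and V: "V \<in> carrier T" for U V
    using U
  proof (induction U rule: tensor_induct)
    case (tensor a b)
    from V show ?case
    proof (induction V rule: tensor_induct)
      case (tensor a' b')
      then show ?case using \<open>a \<in> _\<close> \<open>b \<in> _\<close> mult by simp
    next
      case (diff U V)
      have "tensor A B a b \<otimes>\<^bsub>T\<^esub> (U \<ominus>\<^bsub>T\<^esub> V) = tensor A B a b \<otimes>\<^bsub>T\<^esub> U \<ominus>\<^bsub>T\<^esub> tensor A B a b \<otimes>\<^bsub>T\<^esub> V"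
        using diff tensor by (simp add: T.minus_eq T.r_distr T.r_minus)
      then show ?case using diff tensor cl
        by (simp add: \<open>\<And>y x. _ \<Longrightarrow> _ \<Longrightarrow> f (x \<ominus>\<^bsub>T\<^esub> y) = _\<close> C.minus_eq C.r_distr C.r_minus)
    qed
  next
    case (diff U1 U2)
    have "(U1 \<ominus>\<^bsub>T\<^esub> U2) \<otimes>\<^bsub>T\<^esub> V = U1 \<otimes>\<^bsub>T\<^esub> V \<ominus>\<^bsub>T\<^esub> U2 \<otimes>\<^bsub>T\<^esub> V"
      using diff V by (simp add: T.minus_eq T.l_distr T.l_minus)
    then show ?case using diff V cl
      by (simp add: \<open>\<And>y x. _ \<Longrightarrow> _ \<Longrightarrow> f (x \<ominus>\<^bsub>T\<^esub> y) = _\<close> C.minus_eq C.l_distr C.l_minus)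
  qed
  then show ?thesis using one cl add_hom_add[OF f] by (intro ring_hom_memI) auto
qed

lemma tensor_lift_ring_hom:
  assumes C: "ring C" and \<phi>: "biadditive A B C \<phi>" and one: "\<phi> \<one>\<^bsub>A\<^esub> \<one>\<^bsub>B\<^esub> = \<one>\<^bsub>C\<^esub>"
    and mult: "\<And>a b a' b'. a \<in> carrier A \<Longrightarrow> b \<in> carrier B \<Longrightarrow> a' \<in> carrier A \<Longrightarrow> b' \<in> carrier B \<Longrightarrow>
      \<phi> (a \<otimes>\<^bsub>A\<^esub> a') (b \<otimes>\<^bsub>B\<^esub> b') = \<phi> a b \<otimes>\<^bsub>C\<^esub> \<phi> a' b'"
  shows "tensor_lift C \<phi> \<in> ring_hom T C"
  by (rule ring_homI_tensor[OF C tensor_lift_add_hom[OF C \<phi>]])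
    (simp_all add: tensor_one tensor_lift_tensor[OF C \<phi>] one mult)

end

lemma ring_pairI: "ring A \<Longrightarrow> ring B \<Longrightarrow> ring_pair A B"
  by (simp add: ring_pair_def)

lemma add_hom_int_pow:
  fixes n :: int
  assumes R: "abelian_group R" and S: "abelian_group S" and h: "h \<in> add_hom R S" and x: "x \<in> carrier R"
  shows "h ([n] \<cdot>\<^bsub>R\<^esub> x) = [n] \<cdot>\<^bsub>S\<^esub> h x"
proof -
  interpret R: abelian_group R by fact
  interpret S: abelian_group S by fact
  interpret group_hom "add_monoid R" "add_monoid S" h
    using h R.a_group S.a_group by (simp add: group_hom_def group_hom_axioms_def)
  show ?thesis using hom_int_pow[of x n] x by (simp add: add_pow_def)
qed

lemma biadditive_comp:
  assumes "biadditive A B C \<phi>" "f \<in> add_hom A' A" "g \<in> add_hom B' B" "h \<in> add_hom C C'"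
  shows "biadditive A' B' C' (\<lambda>a b. h (\<phi> (f a) (g b)))"
  using assms
  by (intro biadditiveI) (auto simp: biadditive_def add_hom_closed add_hom_add[of f] add_hom_add[of g] add_hom_add[of h])

lemma biadditive_scale:
  assumes H: "ring H" and f: "f \<in> add_hom H \<Z>"
  shows "biadditive H H H (\<lambda>a b. [f a] \<cdot>\<^bsub>H\<^esub> b)" "biadditive H H H (\<lambda>a b. [f b] \<cdot>\<^bsub>H\<^esub> a)"
proof -
  interpret ring H by fact
  have "f (a \<oplus>\<^bsub>H\<^esub> b) = f a + f b" if "a \<in> carrier H" "b \<in> carrier H" for a b
    using add_hom_add[OF f that] by simp
  then show "biadditive H H H (\<lambda>a b. [f a] \<cdot>\<^bsub>H\<^esub> b)" "biadditive H H H (\<lambda>a b. [f b] \<cdot>\<^bsub>H\<^esub> a)"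
    by (auto intro!: biadditiveI add.int_pow_closed simp: add.int_pow_mult add.int_pow_distrib)
qed

lemma add_hom_id: "id \<in> add_hom R R"
  by (simp add: hom_def)

section \<open>Tensor products of maps, and subgroups spanned by pure tensors\<close>

context ring_pair
begin

lemma biadditive_tensor_map:
  assumes "ring_pair C D" and f: "f \<in> add_hom A C" and g: "g \<in> add_hom B D"
  shows "biadditive A B (tensor_ring C D) (\<lambda>a b. tensor C D (f a) (g b))"
  using biadditive_comp[OF ring_pair.biadditive_tensor[OF assms(1)] f g add_hom_id] by simp

lemma tensor_map_add_hom:
  assumes "ring_pair C D" and f: "f \<in> add_hom A C" and g: "g \<in> add_hom B D"
  shows "tensor_map C D f g \<in> add_hom T (tensor_ring C D)"
  unfolding tensor_map_def
  by (rule tensor_lift_add_hom[OF ring_pair.tensor_ring_ring[OF assms(1)] biadditive_tensor_map[OF assms]])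

lemma tensor_map_tensor:
  assumes "ring_pair C D" and f: "f \<in> add_hom A C" and g: "g \<in> add_hom B D"
    and "a \<in> carrier A" "b \<in> carrier B"
  shows "tensor_map C D f g (tensor A B a b) = tensor C D (f a) (g b)"
  unfolding tensor_map_def
  by (rule tensor_lift_tensor[OF ring_pair.tensor_ring_ring[OF assms(1)] biadditive_tensor_map[OF assms(1-3)]]) fact+

lemma tensor_map_ring_hom:
  assumes CD: "ring_pair C D" and f: "f \<in> ring_hom A C" and g: "g \<in> ring_hom B D"
  shows "tensor_map C D f g \<in> ring_hom T (tensor_ring C D)"
proof -
  interpret CD: ring_pair C D by fact
  note t = tensor_map_tensor[OF CD ring_hom_add_hom[OF f] ring_hom_add_hom[OF g]]
  show ?thesis
    by (rule ring_homI_tensor[OF CD.tensor_ring_ring tensor_map_add_hom[OF CD ring_hom_add_hom[OF f] ring_hom_add_hom[OF g]]])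
      (simp_all add: tensor_one t CD.tensor_one ring_hom_one[OF f] ring_hom_one[OF g] ring_hom_closed[OF f]
        ring_hom_closed[OF g] ring_hom_mult[OF f] ring_hom_mult[OF g])
qed

lemma tensor_span_mono:
  assumes "U \<subseteq> U'" "V \<subseteq> V'"
  shows "tensor_span A B U V \<subseteq> tensor_span A B U' V'"
  unfolding tensor_span_def by (rule T.add.mono_generate) (use assms in blast)

lemma tensor_span_incl: "u \<in> U \<Longrightarrow> v \<in> V \<Longrightarrow> tensor A B u v \<in> tensor_span A B U V"
  unfolding tensor_span_def by (rule generate.incl) blast

lemma subgroup_tensor_span:
  assumes "U \<subseteq> carrier A" "V \<subseteq> carrier B"
  shows "subgroup (tensor_span A B U V) (add_monoid T)"
  unfolding tensor_span_def by (rule T.add.generate_is_subgroup) (use assms in auto)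

lemma tensor_span_closed:
  assumes "U \<subseteq> carrier A" "V \<subseteq> carrier B"
  shows "P \<in> tensor_span A B U V \<Longrightarrow> P \<in> carrier T"
    and "\<zero>\<^bsub>T\<^esub> \<in> tensor_span A B U V"
    and "P \<in> tensor_span A B U V \<Longrightarrow> Q \<in> tensor_span A B U V \<Longrightarrow> P \<oplus>\<^bsub>T\<^esub> Q \<in> tensor_span A B U V"
    and "P \<in> tensor_span A B U V \<Longrightarrow> \<ominus>\<^bsub>T\<^esub> P \<in> tensor_span A B U V"
  using subgroup.subset[OF subgroup_tensor_span[OF assms]] subgroup.one_closed[OF subgroup_tensor_span[OF assms]]
    subgroup.m_closed[OF subgroup_tensor_span[OF assms]] subgroup.m_inv_closed[OF subgroup_tensor_span[OF assms]]
  by (auto simp: a_inv_def)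

lemma tensor_span_induct [consumes 3, case_names zero tensor neg add]:
  assumes "P \<in> tensor_span A B U V" and UV: "U \<subseteq> carrier A" "V \<subseteq> carrier B"
    and "Q \<zero>\<^bsub>T\<^esub>" "\<And>u v. u \<in> U \<Longrightarrow> v \<in> V \<Longrightarrow> Q (tensor A B u v)"
    and "\<And>x. x \<in> carrier T \<Longrightarrow> Q x \<Longrightarrow> Q (\<ominus>\<^bsub>T\<^esub> x)"
    and "\<And>x y. x \<in> carrier T \<Longrightarrow> y \<in> carrier T \<Longrightarrow> Q x \<Longrightarrow> Q y \<Longrightarrow> Q (x \<oplus>\<^bsub>T\<^esub> y)"
  shows "Q P"
proof -
  have sub: "P \<in> carrier T" if "P \<in> generate (add_monoid T) {tensor A B u v |u v. u \<in> U \<and> v \<in> V}" for P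
    using tensor_span_closed(1)[OF UV, of P] that unfolding tensor_span_def by blast
  from assms(1) show ?thesis unfolding tensor_span_def
  proof (induction rule: generate.induct)
    case (inv h)
    then have "h \<in> carrier T" using UV by auto
    then show ?case using inv assms(5,6) by (fastforce simp: a_inv_def)
  qed (use assms sub in auto)
qed

end

section \<open>The associativity isomorphism\<close>

context
  fixes A :: "('a, 'm) ring_scheme" and B :: "('b, 'n) ring_scheme" and C :: "('c, 'o) ring_scheme"
  assumes A: "ring A" and B: "ring B" and C: "ring C"
begin

interpretation AB: ring_pair A B by (rule ring_pairI) fact+
interpretation BC: ring_pair B C by (rule ring_pairI) fact+
interpretation ABC: ring_pair "tensor_ring A B" C by (rule ring_pairI) (rule AB.tensor_ring_ring C)+
interpretation ABC': ring_pair A "tensor_ring B C" by (rule ring_pairI) (rule A BC.tensor_ring_ring)+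

lemma biadditive_assoc_inner:
  assumes "c \<in> carrier C"
  shows "biadditive A B ABC'.T (\<lambda>a b. tensor A BC.T a (tensor B C b c))"
  by (rule biadditive_comp[OF ABC'.biadditive_tensor add_hom_id BC.tensor_left_add_hom[OF assms] add_hom_id, simplified])

text \<open>The associator is a lift whose values are lifts themselves. Additivity in the first
  argument is that of the inner lift; additivity in the second is an equation between additive maps
  of the first and is checked on pure tensors.\<close>

lemma biadditive_assoc_outer:
  "biadditive AB.T C ABC'.T (\<lambda>t c. tensor_lift ABC'.T (\<lambda>a b. tensor A BC.T a (tensor B C b c)) t)"
proof (rule biadditiveI)
  note l = AB.tensor_lift_add_hom[OF ABC'.tensor_ring_ring biadditive_assoc_inner]
  note t = AB.tensor_lift_tensor[OF ABC'.tensor_ring_ring biadditive_assoc_inner]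
  fix c assume c: "c \<in> carrier C"
  fix x y assume x: "x \<in> carrier AB.T"
  show "tensor_lift ABC'.T (\<lambda>a b. tensor A BC.T a (tensor B C b c)) x \<in> carrier ABC'.T"
    by (rule add_hom_closed[OF l[OF c] x])
  show "tensor_lift ABC'.T (\<lambda>a b. tensor A BC.T a (tensor B C b c)) (x \<oplus>\<^bsub>AB.T\<^esub> y) =
    tensor_lift ABC'.T (\<lambda>a b. tensor A BC.T a (tensor B C b c)) x \<oplus>\<^bsub>ABC'.T\<^esub>
    tensor_lift ABC'.T (\<lambda>a b. tensor A BC.T a (tensor B C b c)) y" if "y \<in> carrier AB.T"
    by (rule add_hom_add[OF l[OF c] x that])
next
  note l = AB.tensor_lift_add_hom[OF ABC'.tensor_ring_ring biadditive_assoc_inner]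
  note t = AB.tensor_lift_tensor[OF ABC'.tensor_ring_ring biadditive_assoc_inner]
  fix x c c' assume x: "x \<in> carrier AB.T" and c: "c \<in> carrier C" "c' \<in> carrier C"
  then have cc: "c \<oplus>\<^bsub>C\<^esub> c' \<in> carrier C" by simp
  show "tensor_lift ABC'.T (\<lambda>a b. tensor A BC.T a (tensor B C b (c \<oplus>\<^bsub>C\<^esub> c'))) x =
    tensor_lift ABC'.T (\<lambda>a b. tensor A BC.T a (tensor B C b c)) x \<oplus>\<^bsub>ABC'.T\<^esub>
    tensor_lift ABC'.T (\<lambda>a b. tensor A BC.T a (tensor B C b c')) x"
  proof (rule AB.add_hom_eqI[OF ABC'.T.is_abelian_group l[OF cc] _ _ x, where g = "\<lambda>x. _ x \<oplus>\<^bsub>ABC'.T\<^esub> _ x"])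
    show "(\<lambda>x. tensor_lift ABC'.T (\<lambda>a b. tensor A BC.T a (tensor B C b c)) x \<oplus>\<^bsub>ABC'.T\<^esub>
        tensor_lift ABC'.T (\<lambda>a b. tensor A BC.T a (tensor B C b c')) x) \<in> add_hom AB.T ABC'.T"
      by (rule add_homI; simp add: add_hom_closed[OF l] c add_hom_add[OF l] ABC'.T.a_ac)
  qed (simp add: t c cc BC.tensor_add_right ABC'.tensor_add_right)
qed

lemma tensor_assoc_add_hom: "tensor_assoc A B C \<in> add_hom ABC.T ABC'.T"
  unfolding tensor_assoc_def Let_def
  by (rule ABC.tensor_lift_add_hom[OF ABC'.tensor_ring_ring biadditive_assoc_outer])

lemma tensor_assoc_tensor:
  assumes "a \<in> carrier A" "b \<in> carrier B" "c \<in> carrier C"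
  shows "tensor_assoc A B C (tensor AB.T C (tensor A B a b) c) = tensor A BC.T a (tensor B C b c)"
  unfolding tensor_assoc_def Let_def
  by (simp add: ABC.tensor_lift_tensor[OF ABC'.tensor_ring_ring biadditive_assoc_outer]
      AB.tensor_lift_tensor[OF ABC'.tensor_ring_ring biadditive_assoc_inner] assms)

lemma triple_add_hom_eqI:
  assumes "abelian_group S" "f \<in> add_hom ABC.T S" "g \<in> add_hom ABC.T S"
    and "\<And>a b c. a \<in> carrier A \<Longrightarrow> b \<in> carrier B \<Longrightarrow> c \<in> carrier C \<Longrightarrow>
      f (tensor AB.T C (tensor A B a b) c) = g (tensor AB.T C (tensor A B a b) c)"
    and "P \<in> carrier ABC.T"
  shows "f P = g P"
proof (rule ABC.add_hom_eqI[OF assms(1-3) _ assms(5)])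
  fix t c assume t: "t \<in> carrier AB.T" and c: "c \<in> carrier C"
  show "f (tensor AB.T C t c) = g (tensor AB.T C t c)"
    by (rule AB.add_hom_eqI[OF assms(1) add_hom_comp[OF ABC.tensor_left_add_hom[OF c] assms(2)]
          add_hom_comp[OF ABC.tensor_left_add_hom[OF c] assms(3)] assms(4)[OF _ _ c] t])
qed

text \<open>Multiplicativity allows coassociativity to be tested on algebra generators. It is
  obtained by reducing first \<open>x\<close> and then \<open>y\<close> to pure tensors, the other
  variables being held fixed.\<close>

lemma tensor_assoc_ring_hom: "tensor_assoc A B C \<in> ring_hom ABC.T ABC'.T"
proof (rule ABC.ring_homI_tensor[OF ABC'.tensor_ring_ring tensor_assoc_add_hom])
  note al = add_hom_closed[OF tensor_assoc_add_hom]
  note AG = ABC'.T.is_abelian_group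
  show "tensor_assoc A B C \<one>\<^bsub>ABC.T\<^esub> = \<one>\<^bsub>ABC'.T\<^esub>"
    by (simp add: ABC.tensor_one AB.tensor_one tensor_assoc_tensor BC.tensor_one ABC'.tensor_one)
  fix x c y d assume x: "x \<in> carrier AB.T" and c: "c \<in> carrier C" and y: "y \<in> carrier AB.T" and d: "d \<in> carrier C"
  let ?a = "tensor_assoc A B C"
  have h1: "(\<lambda>x. ?a (tensor AB.T C x e)) \<in> add_hom AB.T ABC'.T" if "e \<in> carrier C" for e
    by (rule add_hom_comp[OF ABC.tensor_left_add_hom tensor_assoc_add_hom]) fact
  have mr: "(\<lambda>x. x \<otimes>\<^bsub>AB.T\<^esub> y) \<in> add_hom AB.T AB.T" if "y \<in> carrier AB.T" for y
    by (rule add_homI; simp add: that AB.T.l_distr)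
  have ml: "(\<lambda>x. y \<otimes>\<^bsub>AB.T\<^esub> x) \<in> add_hom AB.T AB.T" if "y \<in> carrier AB.T" for y
    by (rule add_homI; simp add: that AB.T.r_distr)
  have mr': "(\<lambda>x. x \<otimes>\<^bsub>ABC'.T\<^esub> y) \<in> add_hom ABC'.T ABC'.T" if "y \<in> carrier ABC'.T" for y
    by (rule add_homI; simp add: that ABC'.T.l_distr)
  have ml': "(\<lambda>x. y \<otimes>\<^bsub>ABC'.T\<^esub> x) \<in> add_hom ABC'.T ABC'.T" if "y \<in> carrier ABC'.T" for y
    by (rule add_homI; simp add: that ABC'.T.r_distr)
  have cd: "c \<otimes>\<^bsub>C\<^esub> d \<in> carrier C" using c d by simp
  show "?a (tensor AB.T C (x \<otimes>\<^bsub>AB.T\<^esub> y) (c \<otimes>\<^bsub>C\<^esub> d)) = ?a (tensor AB.T C x c) \<otimes>\<^bsub>ABC'.T\<^esub> ?a (tensor AB.T C y d)"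
  proof (rule AB.add_hom_eqI[OF AG add_hom_comp[OF mr[OF y] h1[OF cd]] add_hom_comp[OF h1[OF c] mr'] _ x])
    fix a b assume a: "a \<in> carrier A" and b: "b \<in> carrier B"
    show "?a (tensor AB.T C (tensor A B a b \<otimes>\<^bsub>AB.T\<^esub> y) (c \<otimes>\<^bsub>C\<^esub> d)) =
      ?a (tensor AB.T C (tensor A B a b) c) \<otimes>\<^bsub>ABC'.T\<^esub> ?a (tensor AB.T C y d)"
      by (rule AB.add_hom_eqI[OF AG add_hom_comp[OF ml h1[OF cd]] add_hom_comp[OF h1[OF d] ml'] _ y])
        (simp_all add: a b c d tensor_assoc_tensor)
  qed (use al y d in simp)
qed

end

section \<open>Quotients of Hopf algebras by Hopf ideals\<close>

context hopf_algebra
begin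

sublocale HH: ring_pair H H
  by (rule ring_pairI) (rule ring_axioms)+

lemmas comult_add_hom = ring_hom_add_hom[OF comult_hom]
lemmas counit_add_hom = ring_hom_add_hom[OF counit_hom]

lemma biadditive_antipode:
  "biadditive H H H (\<lambda>a b. S a \<otimes> b)" "biadditive H H H (\<lambda>a b. a \<otimes> S b)"
  by (rule biadditiveI; simp add: add_hom_closed[OF antipode_additive] add_hom_add[OF antipode_additive] l_distr r_distr)+

end

text \<open>Each axiom at a coset \<open>\<pi> x\<close> is the image of the axiom at
  \<open>x\<close>: the induced maps commute with the projections \<open>\<pi>\<close> and
  \<open>\<Theta>\<close>, and the squares needed for this commute because both ways round are
  additive and agree on pure tensors. The three conditions on \<open>J\<close> make the induced maps
  constant on cosets.\<close>

lemma hopf_algebra_quotient: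
  assumes "hopf_ideal H \<Delta> \<epsilon> S J"
  shows "hopf_algebra (H Quot J) (quot_comult H J \<Delta>) (quot_counit \<epsilon>) (quot_antipode H J S)"
proof -
  interpret hopf_ideal H \<Delta> \<epsilon> S J by fact
  let ?Q = "H Quot J"
  let ?\<Delta> = "quot_comult H J \<Delta>" and ?\<epsilon> = "quot_counit \<epsilon>" and ?S = "quot_antipode H J S"
  define \<pi> where "\<pi> = (\<lambda>x. J +>\<^bsub>H\<^esub> x)"
  have Q: "ring ?Q" by (rule quotient_is_ring)
  interpret Q: ring ?Q by (rule Q)
  interpret QQ: ring_pair ?Q ?Q by (rule ring_pairI) (rule Q)+
  interpret QQQ: ring_pair QQ.T ?Q by (rule ring_pairI) (rule QQ.tensor_ring_ring Q)+
  interpret QQQ': ring_pair ?Q QQ.T by (rule ring_pairI) (rule QQ.tensor_ring_ring Q)+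
  interpret HHH: ring_pair HH.T H by (rule ring_pairI) (rule HH.tensor_ring_ring ring_axioms)+
  interpret HHH': ring_pair H HH.T by (rule ring_pairI) (rule HH.tensor_ring_ring ring_axioms)+
  have \<pi>: "\<pi> \<in> ring_hom H ?Q" unfolding \<pi>_def by (rule rcos_ring_hom)
  note \<pi>a = ring_hom_add_hom[OF \<pi>]
  have \<pi>J: "\<pi> x = \<zero>\<^bsub>?Q\<^esub>" if "x \<in> J" for x
    using a_rcos_const[OF that] by (simp add: \<pi>_def FactRing_def)
  have \<pi>S: "\<exists>x. x \<in> carrier H \<and> y = \<pi> x" if "y \<in> carrier ?Q" for y
    using that by (auto simp: carrier_quot \<pi>_def)
  define \<Theta> where "\<Theta> = tensor_map ?Q ?Q \<pi> \<pi>"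
  have \<Theta>: "\<Theta> \<in> ring_hom HH.T QQ.T"
    unfolding \<Theta>_def by (rule HH.tensor_map_ring_hom[OF QQ.ring_pair_axioms \<pi> \<pi>])
  note \<Theta>a = ring_hom_add_hom[OF \<Theta>]
  have \<Theta>t: "\<Theta> (tensor H H a b) = tensor ?Q ?Q (\<pi> a) (\<pi> b)" if "a \<in> carrier H" "b \<in> carrier H" for a b
    unfolding \<Theta>_def by (rule HH.tensor_map_tensor[OF QQ.ring_pair_axioms \<pi>a \<pi>a that])
  have Jsub: "J \<subseteq> carrier H" using a_subset .
  \<comment> \<open>A pure tensor with a factor in \<open>J\<close> is killed, as
    \<open>\<pi>\<close> sends that factor to zero; this disposes of both summands in
    \<open>comult_ideal\<close>.\<close>
  have \<Theta>0: "\<Theta> P = \<zero>\<^bsub>QQ.T\<^esub>" if "P \<in> tensor_span H H U V" "U \<subseteq> carrier H" "V \<subseteq> carrier H" "U \<subseteq> J \<or> V \<subseteq> J" for P U V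
    using that(1-3)
  proof (induction P rule: HH.tensor_span_induct)
    case (tensor u v)
    with that(2,3) have uv: "u \<in> carrier H" "v \<in> carrier H" by auto
    from tensor that(4) have "\<pi> u = \<zero>\<^bsub>?Q\<^esub> \<or> \<pi> v = \<zero>\<^bsub>?Q\<^esub>" using \<pi>J by auto
    then show ?case using uv
      by (auto simp: \<Theta>t QQ.tensor_zero_left QQ.tensor_zero_right ring_hom_closed[OF \<pi>])
  qed (simp_all add: add_hom_zero[OF HH.T.is_abelian_group QQ.T.is_abelian_group \<Theta>a]
      add_hom_neg[OF HH.T.is_abelian_group QQ.T.is_abelian_group \<Theta>a] add_hom_add[OF \<Theta>a])
  have \<Theta>\<Delta>: "\<Theta> (\<Delta> x) = \<zero>\<^bsub>QQ.T\<^esub>" if "x \<in> J" for x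
  proof -
    from that comult_ideal obtain P P' where P: "P \<in> tensor_span H H J (carrier H)"
      "P' \<in> tensor_span H H (carrier H) J" "\<Delta> x = P \<oplus>\<^bsub>HH.T\<^esub> P'"
      by (auto simp: set_add_def')
    then have "P \<in> carrier HH.T" "P' \<in> carrier HH.T" using HH.tensor_span_closed(1) Jsub by blast+
    then show ?thesis using P \<Theta>0[OF P(1)] \<Theta>0[OF P(2)] Jsub by (simp add: add_hom_add[OF \<Theta>a])
  qed
  have comp: "(\<lambda>x. \<Theta> (\<Delta> x)) \<in> ring_hom H QQ.T" by (rule ring_hom_comp[OF comult_hom \<Theta>])
  have \<Delta>': "?\<Delta> \<in> ring_hom ?Q QQ.T"
    using induced_ring_hom[OF QQ.tensor_ring_ring comp \<Theta>\<Delta>] by (simp add: quot_comult_def \<Theta>_def \<pi>_def)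
  have \<Delta>\<pi>: "?\<Delta> (\<pi> x) = \<Theta> (\<Delta> x)" if "x \<in> carrier H" for x
    using induced_coset[OF QQ.T.is_abelian_group ring_hom_add_hom[OF comp] \<Theta>\<Delta> that]
    by (simp add: quot_comult_def \<Theta>_def \<pi>_def)
  interpret int: ring \<Z> by (rule int.ring_axioms)
  have \<epsilon>0: "\<epsilon> x = \<zero>\<^bsub>\<Z>\<^esub>" if "x \<in> J" for x using that counit_ideal by auto
  have \<epsilon>': "?\<epsilon> \<in> ring_hom ?Q \<Z>"
    unfolding quot_counit_def by (rule induced_ring_hom[OF int.ring_axioms counit_hom \<epsilon>0])
  have \<epsilon>\<pi>: "?\<epsilon> (\<pi> x) = \<epsilon> x" if "x \<in> carrier H" for x
    unfolding quot_counit_def \<pi>_def by (rule induced_coset[OF int.is_abelian_group counit_add_hom \<epsilon>0 that])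
  have \<pi>S0: "\<pi> (S x) = \<zero>\<^bsub>?Q\<^esub>" if "x \<in> J" for x using that antipode_ideal \<pi>J by auto
  have S': "?S \<in> add_hom ?Q ?Q"
    unfolding quot_antipode_def \<pi>_def[symmetric]
    using induced_add_hom[OF Q.is_abelian_group add_hom_comp[OF antipode_additive \<pi>a] \<pi>S0] by (simp add: \<pi>_def)
  have S\<pi>: "?S (\<pi> x) = \<pi> (S x)" if "x \<in> carrier H" for x
    using induced_coset[OF Q.is_abelian_group add_hom_comp[OF antipode_additive \<pi>a] \<pi>S0 that]
    by (simp add: quot_antipode_def \<pi>_def)
  note \<Delta>'a = ring_hom_add_hom[OF \<Delta>'] and \<epsilon>'a = ring_hom_add_hom[OF \<epsilon>']
  note cl [simp] = ring_hom_closed[OF \<pi>] ring_hom_closed[OF \<Theta>] ring_hom_closed[OF comult_hom]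
    add_hom_closed[OF antipode_additive] add_hom_closed[OF S'] ring_hom_closed[OF \<Delta>']
  note mapQ = QQ.tensor_map_add_hom[OF QQQ.ring_pair_axioms \<Delta>'a add_hom_id]
    QQ.tensor_map_add_hom[OF QQQ'.ring_pair_axioms add_hom_id \<Delta>'a]
  note mapH = HH.tensor_map_add_hom[OF HHH.ring_pair_axioms comult_add_hom add_hom_id]
    HH.tensor_map_add_hom[OF HHH'.ring_pair_axioms add_hom_id comult_add_hom]
  note mapHQ = HHH.tensor_map_add_hom[OF QQQ.ring_pair_axioms \<Theta>a \<pi>a]
    HHH'.tensor_map_add_hom[OF QQQ'.ring_pair_axioms \<pi>a \<Theta>a]
  note tQ = QQ.tensor_map_tensor[OF QQQ.ring_pair_axioms \<Delta>'a add_hom_id]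
    QQ.tensor_map_tensor[OF QQQ'.ring_pair_axioms add_hom_id \<Delta>'a]
    HH.tensor_map_tensor[OF HHH.ring_pair_axioms comult_add_hom add_hom_id]
    HH.tensor_map_tensor[OF HHH'.ring_pair_axioms add_hom_id comult_add_hom]
    HHH.tensor_map_tensor[OF QQQ.ring_pair_axioms \<Theta>a \<pi>a]
    HHH'.tensor_map_tensor[OF QQQ'.ring_pair_axioms \<pi>a \<Theta>a]
  have left: "tensor_map QQ.T ?Q ?\<Delta> id (\<Theta> P) = tensor_map QQ.T ?Q \<Theta> \<pi> (tensor_map HH.T H \<Delta> id P)"
    if "P \<in> carrier HH.T" for P
    by (rule HH.add_hom_eqI[OF QQQ.T.is_abelian_group add_hom_comp[OF \<Theta>a mapQ(1)] add_hom_comp[OF mapH(1) mapHQ(1)] _ that])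
      (simp add: \<Theta>t tQ \<Delta>\<pi>)
  have right: "tensor_map ?Q QQ.T id ?\<Delta> (\<Theta> P) = tensor_map ?Q QQ.T \<pi> \<Theta> (tensor_map H HH.T id \<Delta> P)"
    if "P \<in> carrier HH.T" for P
    by (rule HH.add_hom_eqI[OF QQQ'.T.is_abelian_group add_hom_comp[OF \<Theta>a mapQ(2)] add_hom_comp[OF mapH(2) mapHQ(2)] _ that])
      (simp add: \<Theta>t tQ \<Delta>\<pi>)
  note H = ring_axioms
  have nat: "tensor_assoc ?Q ?Q ?Q (tensor_map QQ.T ?Q \<Theta> \<pi> P) = tensor_map ?Q QQ.T \<pi> \<Theta> (tensor_assoc H H H P)"
    if "P \<in> carrier HHH.T" for P
    by (rule triple_add_hom_eqI[OF H H H QQQ'.T.is_abelian_group add_hom_comp[OF mapHQ(1) tensor_assoc_add_hom[OF Q Q Q]]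
          add_hom_comp[OF tensor_assoc_add_hom[OF H H H] mapHQ(2)] _ that])
      (simp add: \<Theta>t tQ tensor_assoc_tensor[OF H H H] tensor_assoc_tensor[OF Q Q Q])
  \<comment> \<open>One square serves both counit and both antipode axioms: \<open>\<phi>\<close>
    and \<open>\<psi>\<close> are the corresponding pairings on the quotient and on
    \<open>H\<close>.\<close>
  have push: "tensor_lift ?Q \<phi> (\<Theta> P) = \<pi> (tensor_lift H \<psi> P)"
    if "biadditive ?Q ?Q ?Q \<phi>" "biadditive H H H \<psi>" "P \<in> carrier HH.T"
      "\<And>a b. a \<in> carrier H \<Longrightarrow> b \<in> carrier H \<Longrightarrow> \<phi> (\<pi> a) (\<pi> b) = \<pi> (\<psi> a b)" for \<phi> \<psi> P
    by (rule HH.add_hom_eqI[OF Q.is_abelian_group add_hom_comp[OF \<Theta>a QQ.tensor_lift_add_hom[OF Q that(1)]]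
          add_hom_comp[OF HH.tensor_lift_add_hom[OF H that(2)] \<pi>a] _ that(3)])
      (simp add: \<Theta>t QQ.tensor_lift_tensor[OF Q that(1)] HH.tensor_lift_tensor[OF H that(2)] that(4))
  note \<pi>scale = add_hom_int_pow[OF is_abelian_group Q.is_abelian_group \<pi>a, symmetric]
  have bS: "biadditive ?Q ?Q ?Q (\<lambda>a b. ?S a \<otimes>\<^bsub>?Q\<^esub> b)" "biadditive ?Q ?Q ?Q (\<lambda>a b. a \<otimes>\<^bsub>?Q\<^esub> ?S b)"
    by (rule biadditiveI; simp add: Q.l_distr Q.r_distr add_hom_add[OF S'])+
  show ?thesis
  proof (unfold_locales)
    fix y assume "y \<in> carrier ?Q"
    then obtain x where x: "x \<in> carrier H" and y: "y = \<pi> x" using \<pi>S by blast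
    show "tensor_assoc ?Q ?Q ?Q (tensor_map QQ.T ?Q ?\<Delta> id (?\<Delta> y)) = tensor_map ?Q QQ.T id ?\<Delta> (?\<Delta> y)"
      using x by (simp add: y \<Delta>\<pi> left right nat add_hom_closed[OF mapH(1)] coassoc)
    show "tensor_lift ?Q (\<lambda>a b. [?\<epsilon> a] \<cdot>\<^bsub>?Q\<^esub> b) (?\<Delta> y) = y"
      using x by (simp add: y \<Delta>\<pi> push[OF biadditive_scale(1)[OF Q \<epsilon>'a] biadditive_scale(1)[OF H counit_add_hom]] \<epsilon>\<pi> \<pi>scale counit_left)
    show "tensor_lift ?Q (\<lambda>a b. [?\<epsilon> b] \<cdot>\<^bsub>?Q\<^esub> a) (?\<Delta> y) = y"
      using x by (simp add: y \<Delta>\<pi> push[OF biadditive_scale(2)[OF Q \<epsilon>'a] biadditive_scale(2)[OF H counit_add_hom]] \<epsilon>\<pi> \<pi>scale counit_right)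
    show "tensor_lift ?Q (\<lambda>a b. ?S a \<otimes>\<^bsub>?Q\<^esub> b) (?\<Delta> y) = [?\<epsilon> y] \<cdot>\<^bsub>?Q\<^esub> \<one>\<^bsub>?Q\<^esub>"
      using x by (simp add: y \<Delta>\<pi> push[OF bS(1) biadditive_antipode(1)] S\<pi> ring_hom_mult[OF \<pi>] antipode_left \<epsilon>\<pi>
          \<pi>scale flip: ring_hom_one[OF \<pi>])
    show "tensor_lift ?Q (\<lambda>a b. a \<otimes>\<^bsub>?Q\<^esub> ?S b) (?\<Delta> y) = [?\<epsilon> y] \<cdot>\<^bsub>?Q\<^esub> \<one>\<^bsub>?Q\<^esub>"
      using x by (simp add: y \<Delta>\<pi> push[OF bS(2) biadditive_antipode(2)] S\<pi> ring_hom_mult[OF \<pi>] antipode_right \<epsilon>\<pi>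
          \<pi>scale flip: ring_hom_one[OF \<pi>])
  qed (rule \<Delta>' \<epsilon>' S')+
qed

section \<open>Coxeter groups\<close>

locale coxeter_system =
  fixes I :: "'i set" and m :: "'i \<Rightarrow> 'i \<Rightarrow> nat"
  assumes coxeter_matrix: "coxeter_matrix I m"
begin

abbreviation "W \<equiv> coxeter_group I m"
abbreviation "\<sigma> \<equiv> simple_refl I m"
abbreviation "cls \<equiv> coxeter_class I m"
abbreviation "relator i j \<equiv> concat (replicate (m i j) [i, j])"

lemma m_sym: "i \<in> I \<Longrightarrow> j \<in> I \<Longrightarrow> m i j = m j i"
  and m_eq_1_iff: "i \<in> I \<Longrightarrow> j \<in> I \<Longrightarrow> m i j = 1 \<longleftrightarrow> i = j"
  using coxeter_matrix by (auto simp: coxeter_matrix_def)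

lemma relator_lists: "i \<in> I \<Longrightarrow> j \<in> I \<Longrightarrow> concat (replicate n [i, j]) \<in> lists I"
  by (induction n) auto

lemma coxeter_eq_lists: "coxeter_eq I m u v \<Longrightarrow> u \<in> lists I \<and> v \<in> lists I"
  by (induction rule: coxeter_eq.induct) (auto simp: relator_lists)

lemma coxeter_eq_context:
  "coxeter_eq I m u v \<Longrightarrow> x \<in> lists I \<Longrightarrow> y \<in> lists I \<Longrightarrow> coxeter_eq I m (x @ u @ y) (x @ v @ y)"
proof (induction rule: coxeter_eq.induct)
  case (rel u v i j)
  then show ?case using coxeter_eq.rel[of "x @ u" I "v @ y" i j m] by simp
next
  case (trans u v w)
  then show ?case by (meson coxeter_eq.trans)
next
  case (sym u v)
  then show ?case by (meson coxeter_eq.sym)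
qed (simp add: coxeter_eq.refl)

lemma rev_in_lists [simp]: "rev u \<in> lists A \<longleftrightarrow> u \<in> lists A"
  by (simp add: in_lists_conv_set)

lemma coxeter_eq_append:
  assumes "coxeter_eq I m u u'" "coxeter_eq I m v v'"
  shows "coxeter_eq I m (u @ v) (u' @ v')"
  using coxeter_eq_context[OF assms(1), of "[]" v] coxeter_eq_context[OF assms(2), of u' "[]"]
    coxeter_eq_lists[OF assms(1)] coxeter_eq_lists[OF assms(2)] by (auto intro: coxeter_eq.trans)

text \<open>The way in which \<open>W\<close> is made to act: for operators that keep
  \<open>P\<close> invariant and satisfy the relators on \<open>P\<close>, only the class of the
  word matters. It serves the geometric representation, the signed reflections, the words in the
  \<open>s_el\<close> and the operators \<open>s_op\<close>.\<close>

lemma coxeter_eq_foldr: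
  assumes eq: "coxeter_eq I m u v"
    and cl: "\<And>i x. i \<in> I \<Longrightarrow> x \<in> P \<Longrightarrow> a i x \<in> P"
    and rel: "\<And>i j x. i \<in> I \<Longrightarrow> j \<in> I \<Longrightarrow> x \<in> P \<Longrightarrow> foldr a (relator i j) x = x"
    and x: "x \<in> P"
  shows "foldr a u x = foldr a v x"
proof -
  have cl': "foldr a w y \<in> P" if "w \<in> lists I" "y \<in> P" for w y
    using that by (induction w) (auto intro: cl)
  show ?thesis using eq
    by (induction rule: coxeter_eq.induct) (auto simp: rel cl' x)
qed

lemma foldr_relator: "foldr a (concat (replicate n [i, j])) x = ((\<lambda>x. a i (a j x)) ^^ n) x"
  by (induction n) auto

lemma cls_eq_iff: "u \<in> lists I \<Longrightarrow> cls u = cls v \<longleftrightarrow> coxeter_eq I m u v"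
  unfolding coxeter_class_def by (auto intro: coxeter_eq.intros dest: coxeter_eq.trans)

lemma cls_closed [simp]: "u \<in> lists I \<Longrightarrow> cls u \<in> carrier W"
  by (simp add: coxeter_group_def)

lemma carrierE:
  assumes "w \<in> carrier W"
  obtains u where "u \<in> lists I" "w = cls u"
  using assms by (auto simp: coxeter_group_def)

lemma cls_append: 
  assumes "u \<in> lists I" "v \<in> lists I"
  shows "cls (u @ v) = cls u \<otimes>\<^bsub>W\<^esub> cls v"
proof -
  have "cls (a @ b) = cls (u @ v)" if "a \<in> cls u" "b \<in> cls v" for a b
  proof -
    have "coxeter_eq I m (u @ v) (a @ b)"
      using that by (intro coxeter_eq_append) (auto simp: coxeter_class_def)
    then show ?thesis using cls_eq_iff[of "u @ v" "a @ b"] assms by simp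
  qed
  moreover have "u \<in> cls u" "v \<in> cls v"
    using assms by (auto simp: coxeter_class_def intro: coxeter_eq.refl)
  ultimately have "(\<Union>a\<in>cls u. \<Union>b\<in>cls v. cls (a @ b)) = cls (u @ v)"
    by (intro antisym UN_least) blast+
  then show ?thesis by (simp add: coxeter_group_def)
qed

lemma one_cls: "\<one>\<^bsub>W\<^esub> = cls []"
  by (simp add: coxeter_group_def)

lemma monoid_W: "monoid W"
proof (rule monoidI)
  fix x y z assume "x \<in> carrier W" "y \<in> carrier W" "z \<in> carrier W"
  then show "x \<otimes>\<^bsub>W\<^esub> y \<otimes>\<^bsub>W\<^esub> z = x \<otimes>\<^bsub>W\<^esub> (y \<otimes>\<^bsub>W\<^esub> z)"
    by (elim carrierE) (simp flip: cls_append)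
next
  fix x y assume "x \<in> carrier W" "y \<in> carrier W"
  then show "x \<otimes>\<^bsub>W\<^esub> y \<in> carrier W"
    by (elim carrierE) (simp flip: cls_append)
next
  fix x assume "x \<in> carrier W"
  then show "\<one>\<^bsub>W\<^esub> \<otimes>\<^bsub>W\<^esub> x = x" "x \<otimes>\<^bsub>W\<^esub> \<one>\<^bsub>W\<^esub> = x"
    by (elim carrierE; simp add: one_cls flip: cls_append)+
qed (simp add: one_cls)

lemma cls_square: "i \<in> I \<Longrightarrow> cls [i, i] = \<one>\<^bsub>W\<^esub>"
  using coxeter_eq.rel[of "[]" I "[]" i i m] m_eq_1_iff[of i i] by (simp add: one_cls cls_eq_iff)

lemma cls_rev: "u \<in> lists I \<Longrightarrow> cls (rev u) \<otimes>\<^bsub>W\<^esub> cls u = \<one>\<^bsub>W\<^esub>"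
proof (induction u)
  case (Cons i u)
  interpret monoid W by (rule monoid_W)
  have "cls (rev (i # u)) \<otimes>\<^bsub>W\<^esub> cls (i # u) = cls (rev u @ [i, i] @ u)"
    using cls_append[of "rev (i # u)" "i # u"] Cons.prems by simp
  also have "\<dots> = cls (rev u) \<otimes>\<^bsub>W\<^esub> (cls [i, i] \<otimes>\<^bsub>W\<^esub> cls u)"
    using Cons.prems cls_append[of "rev u" "[i, i] @ u"] cls_append[of "[i, i]" u] by simp
  finally show ?case using Cons by (simp add: cls_square)
qed (simp add: one_cls flip: cls_append)

sublocale W: group W
proof (rule group.intro[OF monoid_W], unfold_locales)
  interpret monoid W by (rule monoid_W)
  have "x \<in> Units W" if "x \<in> carrier W" for x
  proof -
    from that obtain u where u: "u \<in> lists I" "x = cls u" by (rule carrierE)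
    from cls_rev[of u] cls_rev[of "rev u"] u show ?thesis
      unfolding Units_def by (intro CollectI conjI bexI[of _ "cls (rev u)"]) simp_all
  qed
  then show "carrier W \<subseteq> Units W" by blast
qed

lemma inv_cls: "u \<in> lists I \<Longrightarrow> inv\<^bsub>W\<^esub> cls u = cls (rev u)"
  by (rule W.inv_equality) (simp_all add: cls_rev)

lemma \<sigma>_closed [simp]: "i \<in> I \<Longrightarrow> \<sigma> i \<in> carrier W"
  by (simp add: simple_refl_def)

lemma cls_Cons: "i \<in> I \<Longrightarrow> u \<in> lists I \<Longrightarrow> cls (i # u) = \<sigma> i \<otimes>\<^bsub>W\<^esub> cls u"
  using cls_append[of "[i]" u] by (simp add: simple_refl_def)

lemma cls_snoc: "i \<in> I \<Longrightarrow> u \<in> lists I \<Longrightarrow> cls (u @ [i]) = cls u \<otimes>\<^bsub>W\<^esub> \<sigma> i"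
  using cls_append[of u "[i]"] by (simp add: simple_refl_def)

lemma \<sigma>_square [simp]: "i \<in> I \<Longrightarrow> \<sigma> i \<otimes>\<^bsub>W\<^esub> \<sigma> i = \<one>\<^bsub>W\<^esub>"
  using cls_square[of i] cls_Cons[of i "[i]"] by (simp add: simple_refl_def)

lemma \<sigma>_cancel [simp]: "i \<in> I \<Longrightarrow> w \<in> carrier W \<Longrightarrow> \<sigma> i \<otimes>\<^bsub>W\<^esub> (\<sigma> i \<otimes>\<^bsub>W\<^esub> w) = w"
  by (simp flip: W.m_assoc)

lemma inv_\<sigma> [simp]: "i \<in> I \<Longrightarrow> inv\<^bsub>W\<^esub> \<sigma> i = \<sigma> i"
  by (rule W.inv_equality) simp_all

lemma cls_replicate: "i \<in> I \<Longrightarrow> j \<in> I \<Longrightarrow>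
    cls (concat (replicate n [i, j])) = (\<sigma> i \<otimes>\<^bsub>W\<^esub> \<sigma> j) [^]\<^bsub>W\<^esub> n"
proof (induction n)
  case (Suc n)
  have "cls (concat (replicate (Suc n) [i, j])) = cls (i # j # concat (replicate n [i, j]))" by simp
  also have "\<dots> = (\<sigma> i \<otimes>\<^bsub>W\<^esub> \<sigma> j) \<otimes>\<^bsub>W\<^esub> (\<sigma> i \<otimes>\<^bsub>W\<^esub> \<sigma> j) [^]\<^bsub>W\<^esub> n"
    using Suc by (simp add: cls_Cons relator_lists W.m_assoc)
  also have "\<dots> = (\<sigma> i \<otimes>\<^bsub>W\<^esub> \<sigma> j) [^]\<^bsub>W\<^esub> Suc n"
    using Suc.prems W.nat_pow_Suc2[of "\<sigma> i \<otimes>\<^bsub>W\<^esub> \<sigma> j" n] by simp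
  finally show ?case .
qed (simp add: one_cls)

lemma \<sigma>_pow_m: "i \<in> I \<Longrightarrow> j \<in> I \<Longrightarrow> (\<sigma> i \<otimes>\<^bsub>W\<^esub> \<sigma> j) [^]\<^bsub>W\<^esub> m i j = \<one>\<^bsub>W\<^esub>"
  using coxeter_eq.rel[of "[]" I "[]" i j m]
  by (simp flip: cls_replicate add: one_cls cls_eq_iff relator_lists)

subsection \<open>The order of a product of two generators\<close>

text \<open>The dual of the geometric representation: \<open>geom i\<close> acts on functions \<open>f\<close>, thought of as
  \<open>f k = \<langle>f, \<alpha>\<^sub>k\<rangle>\<close>. The coefficient is \<open>-2\<close> for \<open>k = i\<close> and \<open>2\<close> for \<open>m i k = 0\<close>.\<close>

definition coef :: "'i \<Rightarrow> 'i \<Rightarrow> real" where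
  "coef i k = (if m i k = 0 then 2 else 2 * cos (pi / real (m i k)))"

definition geom :: "'i \<Rightarrow> ('i \<Rightarrow> real) \<Rightarrow> 'i \<Rightarrow> real" where
  "geom i f = (\<lambda>k. if k \<in> I then f k + coef i k * f i else 0)"

definition geom2 :: "'i \<Rightarrow> 'i \<Rightarrow> ('i \<Rightarrow> real) \<Rightarrow> 'i \<Rightarrow> real" where
  "geom2 i j f = geom i (geom j f)"

lemma coef_diag: "i \<in> I \<Longrightarrow> coef i i = - 2"
  using m_eq_1_iff[of i i] by (simp add: coef_def)

lemma coef_sym: "i \<in> I \<Longrightarrow> j \<in> I \<Longrightarrow> coef i j = coef j i"
  by (simp add: coef_def m_sym)

lemma geom2_step:
  assumes "i \<in> I" "j \<in> I" and c: "c = coef i j"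
  shows "geom2 i j f j = - f j + c * (f i + c * f j)" "geom2 i j f i = - (f i + c * f j)"
    "k \<in> I \<Longrightarrow> geom2 i j f k = f k + coef j k * f j + coef i k * (f i + c * f j)"
  using assms coef_sym[of i j] by (simp_all add: geom2_def geom_def coef_diag)

text \<open>Each step changes a coordinate by multiples of the coordinates at \<open>i\<close> and
  \<open>j\<close> only, so the drift after \<open>n\<close> steps is governed by the sums of those
  two sequences.\<close>

lemma geom2_sum:
  assumes "i \<in> I" "j \<in> I" "k \<in> I"
  shows "(geom2 i j ^^ n) f k = f k + coef j k * (\<Sum>q<n. (geom2 i j ^^ q) f j)
     + coef i k * (\<Sum>q<n. (geom2 i j ^^ q) f i + coef i j * (geom2 i j ^^ q) f j)"
  by (induction n) (use geom2_step(3)[OF assms(1,2) HOL.refl assms(3)] in \<open>simp_all add: algebra_simps\<close>)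

text \<open>On the coordinates at \<open>i\<close> and \<open>j\<close> the product of the two
  reflections is a rotation by 2 \<theta> in a suitable basis, and \<open>p\<close>,
  \<open>q\<close> parametrise the starting point. The induction step is the formula 2 cos \<theta>
  cos x = cos (x + \<theta>) + cos (x - \<theta>) with its analogue for the sine.\<close>

lemma geom2_trig:
  assumes ij: "i \<in> I" "j \<in> I" "i \<noteq> j" and m: "m i j \<noteq> 0" and th: "\<theta> = pi / real (m i j)"
    and p: "f j = p" and q: "- f i = p * cos \<theta> - q * sin \<theta>"
  shows "(geom2 i j ^^ n) f j = p * cos (2 * n * \<theta>) + q * sin (2 * n * \<theta>) \<and>
    (geom2 i j ^^ n) f i = - (p * cos (2 * n * \<theta> - \<theta>) + q * sin (2 * n * \<theta> - \<theta>))"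
proof (induction n)
  case 0
  then show ?case using p q by simp
next
  case (Suc n)
  let ?F = "(geom2 i j ^^ n) f" and ?t = "2 * real n * \<theta>"
  have c: "2 * cos \<theta> = coef i j" using m th by (simp add: coef_def)
  have 1: "?F i + 2 * cos \<theta> * ?F j = p * cos (?t + \<theta>) + q * sin (?t + \<theta>)"
    using Suc by (simp add: cos_add cos_diff sin_add sin_diff algebra_simps)
  have s: "2 * real (Suc n) * \<theta> - \<theta> = ?t + \<theta>" "2 * real (Suc n) * \<theta> = ?t + \<theta> + \<theta>"
    by (simp_all add: algebra_simps)
  have ss: "sin \<theta> * sin \<theta> = 1 - cos \<theta> * cos \<theta>"
    using sin_squared_eq[of \<theta>] by (simp add: power2_eq_square)
  have "2 * cos \<theta> * cos x = cos (x + \<theta>) + cos (x - \<theta>)" "2 * cos \<theta> * sin x = sin (x + \<theta>) + sin (x - \<theta>)" for x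
    by (simp_all add: cos_add cos_diff sin_add sin_diff)
  from this[of "?t + \<theta>"] have 2: "2 * cos \<theta> * (p * cos (?t + \<theta>) + q * sin (?t + \<theta>)) =
    p * (cos (?t + \<theta> + \<theta>) + cos ?t) + q * (sin (?t + \<theta> + \<theta>) + sin ?t)"
    by (simp add: algebra_simps)
  have "geom2 i j ?F j = - ?F j + 2 * cos \<theta> * (?F i + 2 * cos \<theta> * ?F j)"
    "geom2 i j ?F i = - (?F i + 2 * cos \<theta> * ?F j)"
    using geom2_step(1,2)[OF ij(1,2) c] by auto
  then show ?case unfolding s 1 2 using Suc by (simp add: algebra_simps)
qed

text \<open>After \<open>m i j\<close> steps the angle is 2 pi, so the coordinates at
  \<open>i\<close> and \<open>j\<close> return. Any other coordinate has drifted by a combination of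
  the sums \<open>Sx\<close> and \<open>Sy\<close> over one period. Invariance of a full period
  under an index shift gives two linear equations for these sums, whose only solution is zero
  because 4 - 4 cos^2 \<theta> is positive.\<close>

lemma geom2_order:
  assumes ij: "i \<in> I" "j \<in> I" "i \<noteq> j" and f: "\<And>k. k \<notin> I \<Longrightarrow> f k = 0" and m: "m i j \<noteq> 0"
  shows "(geom2 i j ^^ m i j) f = f"
proof
  fix k
  define \<theta> where "\<theta> = pi / real (m i j)"
  have m2: "m i j \<ge> 2" using m m_eq_1_iff[OF ij(1,2)] ij(3) by linarith
  have th: "0 < \<theta>" "\<theta> < pi" using m2 by (auto simp: \<theta>_def field_simps)
  have s: "sin \<theta> > 0" by (rule sin_gt_zero) fact+
  define c where "c = coef i j"
  have c: "c = 2 * cos \<theta>" using m by (simp add: c_def coef_def \<theta>_def)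
  let ?x = "\<lambda>n. (geom2 i j ^^ n) f j" and ?y = "\<lambda>n. (geom2 i j ^^ n) f i"
  \<comment> \<open>Division by sin \<theta> solves the starting condition of
    \<open>geom2_trig\<close> for \<open>q\<close>.\<close>
  have "- f i = f j * cos \<theta> - (f j * cos \<theta> + f i) / sin \<theta> * sin \<theta>" using s by simp
  note trig = geom2_trig[OF ij m \<theta>_def HOL.refl this]
  have per: "2 * real (m i j) * \<theta> = 2 * pi" using m by (simp add: \<theta>_def)
  have x: "?x (m i j) = f j" and y: "?y (m i j) = f i"
    using trig[of "m i j"] trig[of 0] unfolding per by simp_all
  define Sx where "Sx = (\<Sum>q<m i j. ?x q)"
  define Sy where "Sy = (\<Sum>q<m i j. ?y q)"
  have shift: "(\<Sum>q<n. g (Suc q)) = (\<Sum>q<n. g q)" if "g n = g 0" for g :: "nat \<Rightarrow> real" and n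
    using that sum.lessThan_Suc_shift[of g n] by simp
  have "Sx = (\<Sum>q<m i j. ?x (Suc q))" unfolding Sx_def by (rule shift[symmetric]) (simp add: x)
  also have "\<dots> = (\<Sum>q<m i j. - ?x q + c * (?y q + c * ?x q))"
    using geom2_step(1)[OF ij(1,2) c_def] by simp
  also have "\<dots> = - Sx + c * (Sy + c * Sx)"
    by (simp add: Sx_def Sy_def sum.distrib sum_negf sum_subtractf sum_distrib_left algebra_simps)
  finally have 1: "2 * Sx = c * (Sy + c * Sx)" by simp
  have "Sy = (\<Sum>q<m i j. ?y (Suc q))" unfolding Sy_def by (rule shift[symmetric]) (simp add: y)
  also have "\<dots> = (\<Sum>q<m i j. - (?y q + c * ?x q))"
    using geom2_step(2)[OF ij(1,2) c_def] by simp
  also have "\<dots> = - (Sy + c * Sx)"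
    by (simp add: Sx_def Sy_def sum.distrib sum_negf sum_distrib_left sum_subtractf)
  finally have 2: "2 * Sy = - c * Sx" by simp
  have "cos \<theta> ^ 2 < 1" using s sin_cos_squared_add[of \<theta>] zero_less_power[of "sin \<theta>" 2] by linarith
  moreover have "2 * (2 * Sx) = c * (2 * Sy) + 2 * (c * (c * Sx))" by (subst 1) (simp add: algebra_simps)
  then have "4 * Sx = c * c * Sx" unfolding 2 by simp
  then have "(4 - 4 * cos \<theta> ^ 2) * Sx = 0" by (simp add: c power2_eq_square algebra_simps)
  ultimately have Sx0: "Sx = 0" by simp
  with 2 have Sy0: "Sy = 0" by simp
  show "(geom2 i j ^^ m i j) f k = f k"
  proof (cases "k \<in> I")
    case True
    have "(\<Sum>q<m i j. ?y q + c * ?x q) = Sy + c * Sx"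
      by (simp add: Sx_def Sy_def sum.distrib sum_distrib_left)
    with geom2_sum[OF ij(1,2) True, of "m i j" f] Sx0 Sy0 show ?thesis
      by (simp add: Sx_def c_def)
  next
    case False
    \<comment> \<open>Outside \<open>I\<close> every \<open>geom\<close> returns 0, and as
      \<open>m i j\<close> is nonzero the iterate contains at least one application.\<close>
    moreover obtain n where "m i j = Suc n" using m by (cases "m i j") auto
    ultimately show ?thesis using f by (simp add: geom2_def geom_def)
  qed
qed

lemma geom_relator:
  assumes "i \<in> I" "j \<in> I" "\<And>k. k \<notin> I \<Longrightarrow> f k = 0"
  shows "foldr geom (relator i j) f = f"
proof (cases "i = j")
  case True
  then have "m i j = 1" using m_eq_1_iff assms by simp
  then show ?thesis
    using True assms by (auto simp: geom_def coef_diag fun_eq_iff algebra_simps)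
next
  case False
  then show ?thesis using geom2_order[OF assms(1,2) False assms(3)]
    by (cases "m i j = 0") (auto simp: foldr_relator geom2_def[abs_def])
qed

text \<open>The defining relations only bound the order from above. That it is not smaller is seen
  in the geometric representation, on a vector whose orbit under the product can be
  computed.\<close>

lemma \<sigma>_pow_eq_one_iff:
  assumes ij: "i \<in> I" "j \<in> I" "i \<noteq> j"
  shows "(\<sigma> i \<otimes>\<^bsub>W\<^esub> \<sigma> j) [^]\<^bsub>W\<^esub> n = \<one>\<^bsub>W\<^esub> \<longleftrightarrow> m i j dvd n"
proof
  assume "m i j dvd n"
  then obtain k where "n = m i j * k" ..
  then show "(\<sigma> i \<otimes>\<^bsub>W\<^esub> \<sigma> j) [^]\<^bsub>W\<^esub> n = \<one>\<^bsub>W\<^esub>"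
    using ij by (simp add: \<sigma>_pow_m flip: W.nat_pow_pow)
next
  assume "(\<sigma> i \<otimes>\<^bsub>W\<^esub> \<sigma> j) [^]\<^bsub>W\<^esub> n = \<one>\<^bsub>W\<^esub>"
  then have eq: "coxeter_eq I m (concat (replicate n [i, j])) []"
    using ij by (simp flip: cls_replicate add: one_cls cls_eq_iff relator_lists)
  have fix_f: "(geom2 i j ^^ n) f = f" if "\<And>k. k \<notin> I \<Longrightarrow> f k = 0" for f
    using coxeter_eq_foldr[OF eq, of "{f. \<forall>k. k \<notin> I \<longrightarrow> f k = 0}" geom f] geom_relator that
    by (auto simp: geom_def foldr_relator geom2_def[abs_def])
  show "m i j dvd n"
  proof (cases "m i j = 0")
    case True
    then have c: "2 = coef i j" by (simp add: coef_def)
    \<comment> \<open>For \<open>m i j = 0\<close> the product has no periodicity: the coordinate of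
      this vector at \<open>j\<close> grows linearly.\<close>
    define f where "f = (\<lambda>k. if k = j then 1 else 0 :: real)"
    have "(geom2 i j ^^ q) f j = 2 * real q + 1 \<and> (geom2 i j ^^ q) f i = - 2 * real q" for q
      by (induction q) (use geom2_step(1,2)[OF ij(1,2) c] ij(3) in \<open>simp_all add: f_def\<close>)
    moreover have "(geom2 i j ^^ n) f = f" by (rule fix_f) (use ij in \<open>auto simp: f_def\<close>)
    ultimately have "2 * real n + 1 = f j" by metis
    then show ?thesis using True by (simp add: f_def)
  next
    case False
    define \<theta> where "\<theta> = pi / real (m i j)"
    have m2: "m i j \<ge> 2" using False m_eq_1_iff[OF ij(1,2)] ij(3) by linarith
    have th: "0 < \<theta>" "\<theta> < pi" using m2 by (auto simp: \<theta>_def field_simps)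
    have s: "sin \<theta> > 0" by (rule sin_gt_zero) fact+
    \<comment> \<open>The factor sin \<theta> gives \<open>p = 0\<close> and \<open>q = 1\<close> in
      \<open>geom2_trig\<close>, so the coordinates are plain sines.\<close>
    define f where "f = (\<lambda>k. if k = i then sin \<theta> else 0 :: real)"
    have "f j = 0" "- f i = 0 * cos \<theta> - 1 * sin \<theta>" using ij(3) by (auto simp: f_def)
    note trig = geom2_trig[OF ij False \<theta>_def this, of n]
    have "(geom2 i j ^^ n) f = f" by (rule fix_f) (use ij in \<open>auto simp: f_def\<close>)
    with trig ij have "sin (2 * n * \<theta>) = 0" "sin (2 * n * \<theta> - \<theta>) = - sin \<theta>" by (auto simp: f_def)
    then have "cos (2 * n * \<theta>) * sin \<theta> = sin \<theta>" by (simp add: sin_diff)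
    then have "cos (2 * n * \<theta>) = 1" using s by simp
    then obtain k :: int where "2 * n * \<theta> = of_int k * 2 * pi" by (auto simp: cos_one_2pi_int)
    then have "real n = of_int k * real (m i j)" using False by (simp add: \<theta>_def field_simps)
    then have "int n = k * int (m i j)" by (metis of_int_eq_iff of_int_mult of_int_of_nat_eq)
    then have "int (m i j) dvd int n" by simp
    then show ?thesis by simp
  qed
qed

subsection \<open>The action on signed reflections\<close>

text \<open>A pair \<open>(t, b)\<close> stands for the root of the reflection \<open>t\<close> that is positive if \<open>b\<close> is
  \<open>False\<close> and negative otherwise; a simple reflection \<open>s\<^sub>i\<close> changes the sign of its own root only.\<close>

definition ract :: "'i \<Rightarrow> 'i list set \<times> bool \<Rightarrow> 'i list set \<times> bool" where
  "ract i = (\<lambda>(t, b). (\<sigma> i \<otimes>\<^bsub>W\<^esub> t \<otimes>\<^bsub>W\<^esub> \<sigma> i, b \<noteq> (t = \<sigma> i)))"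

lemma \<sigma>_conj_eq_iff:
  assumes "i \<in> I" "t \<in> carrier W" "u \<in> carrier W"
  shows "\<sigma> i \<otimes>\<^bsub>W\<^esub> t \<otimes>\<^bsub>W\<^esub> \<sigma> i = u \<longleftrightarrow> t = \<sigma> i \<otimes>\<^bsub>W\<^esub> u \<otimes>\<^bsub>W\<^esub> \<sigma> i"
  using assms by (auto simp: W.m_assoc)

lemma \<sigma>_pow_swap:
  assumes "i \<in> I" "j \<in> I"
  shows "\<sigma> j \<otimes>\<^bsub>W\<^esub> (\<sigma> i \<otimes>\<^bsub>W\<^esub> \<sigma> j) [^]\<^bsub>W\<^esub> (n::nat) = (\<sigma> j \<otimes>\<^bsub>W\<^esub> \<sigma> i) [^]\<^bsub>W\<^esub> n \<otimes>\<^bsub>W\<^esub> \<sigma> j"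
  by (induction n) (use assms in \<open>simp_all add: W.m_assoc\<close>, metis W.m_assoc W.m_closed W.nat_pow_closed \<sigma>_closed)

lemma \<sigma>_pow_inverse:
  assumes "i \<in> I" "j \<in> I"
  shows "(\<sigma> i \<otimes>\<^bsub>W\<^esub> \<sigma> j) [^]\<^bsub>W\<^esub> (n::nat) \<otimes>\<^bsub>W\<^esub> (\<sigma> j \<otimes>\<^bsub>W\<^esub> \<sigma> i) [^]\<^bsub>W\<^esub> n = \<one>\<^bsub>W\<^esub>"
proof -
  have "(\<sigma> i \<otimes>\<^bsub>W\<^esub> \<sigma> j) [^]\<^bsub>W\<^esub> n \<otimes>\<^bsub>W\<^esub> (\<sigma> j \<otimes>\<^bsub>W\<^esub> \<sigma> i) [^]\<^bsub>W\<^esub> n =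
      ((\<sigma> i \<otimes>\<^bsub>W\<^esub> \<sigma> j) \<otimes>\<^bsub>W\<^esub> (\<sigma> j \<otimes>\<^bsub>W\<^esub> \<sigma> i)) [^]\<^bsub>W\<^esub> n"
    by (rule W.pow_mult_distrib[symmetric]) (use assms in \<open>simp_all add: W.m_assoc\<close>)
  then show ?thesis using assms by (simp add: W.m_assoc)
qed

text \<open>Pulling the test for a sign change back through the letters already applied gives a
  condition on the original \<open>t\<close>: the \<open>q\<close>-th letter, counted from 0, flips
  the sign exactly if \<open>t\<close> is the \<open>q\<close>-th power of \<open>d\<close> times
  \<open>\<sigma> j\<close>. The flips are added up because only their parity matters.\<close>

lemma ract_pow:
  assumes ij: "i \<in> I" "j \<in> I" and t: "t \<in> carrier W"
  defines "d \<equiv> \<sigma> j \<otimes>\<^bsub>W\<^esub> \<sigma> i"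
  shows "((\<lambda>x. ract i (ract j x)) ^^ n) (t, b) =
    ((\<sigma> i \<otimes>\<^bsub>W\<^esub> \<sigma> j) [^]\<^bsub>W\<^esub> n \<otimes>\<^bsub>W\<^esub> t \<otimes>\<^bsub>W\<^esub> d [^]\<^bsub>W\<^esub> n,
     b \<noteq> odd (\<Sum>q<2 * n. of_bool (t = d [^]\<^bsub>W\<^esub> q \<otimes>\<^bsub>W\<^esub> \<sigma> j) :: nat))"
proof (induction n)
  case (Suc n)
  let ?e = "\<sigma> i \<otimes>\<^bsub>W\<^esub> \<sigma> j"
  let ?x = "?e [^]\<^bsub>W\<^esub> n \<otimes>\<^bsub>W\<^esub> t \<otimes>\<^bsub>W\<^esub> d [^]\<^bsub>W\<^esub> n"
  have d: "d \<in> carrier W" and e: "?e \<in> carrier W" using ij by (auto simp: d_def)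
  have ed: "?e [^]\<^bsub>W\<^esub> n \<otimes>\<^bsub>W\<^esub> d [^]\<^bsub>W\<^esub> n = \<one>\<^bsub>W\<^esub>" and de: "d [^]\<^bsub>W\<^esub> n \<otimes>\<^bsub>W\<^esub> ?e [^]\<^bsub>W\<^esub> n = \<one>\<^bsub>W\<^esub>"
    unfolding d_def using \<sigma>_pow_inverse ij by auto
  have x: "?x = y \<longleftrightarrow> t = d [^]\<^bsub>W\<^esub> n \<otimes>\<^bsub>W\<^esub> y \<otimes>\<^bsub>W\<^esub> ?e [^]\<^bsub>W\<^esub> n" if y: "y \<in> carrier W" for y
  proof
    assume "?x = y"
    then have "d [^]\<^bsub>W\<^esub> n \<otimes>\<^bsub>W\<^esub> y \<otimes>\<^bsub>W\<^esub> ?e [^]\<^bsub>W\<^esub> n = (d [^]\<^bsub>W\<^esub> n \<otimes>\<^bsub>W\<^esub> ?e [^]\<^bsub>W\<^esub> n) \<otimes>\<^bsub>W\<^esub> t \<otimes>\<^bsub>W\<^esub> (d [^]\<^bsub>W\<^esub> n \<otimes>\<^bsub>W\<^esub> ?e [^]\<^bsub>W\<^esub> n)"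
      using t d e by (auto simp: W.m_assoc)
    then show "t = d [^]\<^bsub>W\<^esub> n \<otimes>\<^bsub>W\<^esub> y \<otimes>\<^bsub>W\<^esub> ?e [^]\<^bsub>W\<^esub> n" using t de by simp
  next
    assume "t = d [^]\<^bsub>W\<^esub> n \<otimes>\<^bsub>W\<^esub> y \<otimes>\<^bsub>W\<^esub> ?e [^]\<^bsub>W\<^esub> n"
    then have "?x = (?e [^]\<^bsub>W\<^esub> n \<otimes>\<^bsub>W\<^esub> d [^]\<^bsub>W\<^esub> n) \<otimes>\<^bsub>W\<^esub> y \<otimes>\<^bsub>W\<^esub> (?e [^]\<^bsub>W\<^esub> n \<otimes>\<^bsub>W\<^esub> d [^]\<^bsub>W\<^esub> n)"
      using y d e by (simp add: W.m_assoc)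
    then show "?x = y" using y ed by simp
  qed
  have swap: "\<sigma> j \<otimes>\<^bsub>W\<^esub> ?e [^]\<^bsub>W\<^esub> n = d [^]\<^bsub>W\<^esub> n \<otimes>\<^bsub>W\<^esub> \<sigma> j" unfolding d_def by (rule \<sigma>_pow_swap[OF ij])
  \<comment> \<open>Passing from \<open>n\<close> to \<open>Suc n\<close> applies letter number
    \<open>2 * n\<close>, which is \<open>\<sigma> j\<close>, and then number
    \<open>Suc (2 * n)\<close>, which is \<open>\<sigma> i\<close>.\<close>
  have f1: "?x = \<sigma> j \<longleftrightarrow> t = d [^]\<^bsub>W\<^esub> (2 * n) \<otimes>\<^bsub>W\<^esub> \<sigma> j"
    unfolding x[OF \<sigma>_closed[OF ij(2)]] using d e ij
    by (simp add: W.m_assoc swap) (simp flip: W.m_assoc add: W.nat_pow_mult mult_2)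
  have "?x = d \<otimes>\<^bsub>W\<^esub> \<sigma> j \<longleftrightarrow> t = d [^]\<^bsub>W\<^esub> n \<otimes>\<^bsub>W\<^esub> d \<otimes>\<^bsub>W\<^esub> (d [^]\<^bsub>W\<^esub> n \<otimes>\<^bsub>W\<^esub> \<sigma> j)"
    using x[of "d \<otimes>\<^bsub>W\<^esub> \<sigma> j"] d e ij by (simp add: W.m_assoc swap)
  also have "d [^]\<^bsub>W\<^esub> n \<otimes>\<^bsub>W\<^esub> d \<otimes>\<^bsub>W\<^esub> (d [^]\<^bsub>W\<^esub> n \<otimes>\<^bsub>W\<^esub> \<sigma> j) = d [^]\<^bsub>W\<^esub> (Suc (2 * n)) \<otimes>\<^bsub>W\<^esub> \<sigma> j"
    using W.nat_pow_mult[OF d, of "Suc n" n] d e ij by (simp flip: W.m_assoc add: mult_2)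
  finally have f2: "\<sigma> j \<otimes>\<^bsub>W\<^esub> ?x \<otimes>\<^bsub>W\<^esub> \<sigma> j = \<sigma> i \<longleftrightarrow> t = d [^]\<^bsub>W\<^esub> (Suc (2 * n)) \<otimes>\<^bsub>W\<^esub> \<sigma> j"
    using t d e ij by (subst \<sigma>_conj_eq_iff) (simp_all add: d_def)
  have "?e [^]\<^bsub>W\<^esub> Suc n = ?e \<otimes>\<^bsub>W\<^esub> ?e [^]\<^bsub>W\<^esub> n" using W.nat_pow_Suc2[OF e] .
  then have "\<sigma> i \<otimes>\<^bsub>W\<^esub> (\<sigma> j \<otimes>\<^bsub>W\<^esub> ?x \<otimes>\<^bsub>W\<^esub> \<sigma> j) \<otimes>\<^bsub>W\<^esub> \<sigma> i = ?e [^]\<^bsub>W\<^esub> Suc n \<otimes>\<^bsub>W\<^esub> t \<otimes>\<^bsub>W\<^esub> d [^]\<^bsub>W\<^esub> Suc n"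
    using t d e ij by (simp add: W.m_assoc) (simp add: d_def)
  moreover have "2 * Suc n = Suc (Suc (2 * n))" by simp
  ultimately show ?case unfolding funpow.simps o_apply Suc
    by (auto simp: ract_def f1 f2 simp del: W.nat_pow_Suc)
qed (use t in simp)

text \<open>The sequence of tested reflections has period \<open>m i j\<close>, because
  \<open>?d\<close> to that power is 1, and the relator runs through two periods. So the number of
  sign changes is even.\<close>

lemma ract_relator:
  assumes ij: "i \<in> I" "j \<in> I" and t: "t \<in> carrier W"
  shows "foldr ract (relator i j) (t, b) = (t, b)"
proof -
  let ?d = "\<sigma> j \<otimes>\<^bsub>W\<^esub> \<sigma> i"
  define f where "f q = (of_bool (t = ?d [^]\<^bsub>W\<^esub> q \<otimes>\<^bsub>W\<^esub> \<sigma> j) :: nat)" for q :: nat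
  have dm: "?d [^]\<^bsub>W\<^esub> m i j = \<one>\<^bsub>W\<^esub>" using \<sigma>_pow_m[of j i] ij by (simp add: m_sym)
  have "f (q + m i j) = f q" for q
    using W.nat_pow_mult[of ?d q "m i j", symmetric] ij dm by (simp add: f_def)
  moreover have "(\<Sum>q<n + k. f q) = (\<Sum>q<k. f q) + (\<Sum>q<n. f (q + k))" for n k
    by (induction n) simp_all
  from this[of "m i j" "m i j"] have "(\<Sum>q<2 * m i j. f q) = (\<Sum>q<m i j. f q) + (\<Sum>q<m i j. f (q + m i j))"
    by (simp add: mult_2)
  ultimately have "even (\<Sum>q<2 * m i j. f q)" by simp
  then show ?thesis
    using ract_pow[OF ij t, of "m i j" b] dm \<sigma>_pow_m[OF ij] t by (simp add: foldr_relator f_def)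
qed

lemma ract_coxeter_eq:
  assumes "coxeter_eq I m u v" "t \<in> carrier W"
  shows "foldr ract u (t, b) = foldr ract v (t, b)"
  by (rule coxeter_eq_foldr[OF assms(1), where P = "carrier W \<times> UNIV"])
    (use assms(2) ract_relator in \<open>auto simp: ract_def\<close>)

text \<open>Whether \<open>w\<close> makes the positive root of \<open>t\<close> negative, that is,
  whether \<open>t\<close> is a right inversion of \<open>w\<close>. The word is chosen arbitrarily;
  by \<open>foldr_ract\<close> every word for \<open>w\<close> gives the same sign.\<close>

definition neg :: "'i list set \<Rightarrow> 'i list set \<Rightarrow> bool" where
  "neg w t = snd (foldr ract (SOME u. u \<in> lists I \<and> w = cls u) (t, False))"

lemma foldr_ract:
  assumes u: "u \<in> lists I" and t: "t \<in> carrier W"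
  shows "foldr ract u (t, b) = (cls u \<otimes>\<^bsub>W\<^esub> t \<otimes>\<^bsub>W\<^esub> inv\<^bsub>W\<^esub> cls u, b \<noteq> neg (cls u) t)"
proof -
  let ?v = "SOME v. v \<in> lists I \<and> cls u = cls v"
  have "?v \<in> lists I \<and> cls u = cls ?v" by (rule someI_ex) (use u in auto)
  then have "foldr ract u (t, False) = foldr ract ?v (t, False)"
    using u t by (intro ract_coxeter_eq) (simp_all flip: cls_eq_iff)
  then have *: "neg (cls u) t = snd (foldr ract u (t, False))" by (simp add: neg_def)
  have "fst (foldr ract u (t, b)) = cls u \<otimes>\<^bsub>W\<^esub> t \<otimes>\<^bsub>W\<^esub> inv\<^bsub>W\<^esub> cls u \<and>
    snd (foldr ract u (t, b)) = (b \<noteq> snd (foldr ract u (t, False)))" for b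
    using u
  proof (induction u arbitrary: b)
    case Nil
    then show ?case using t by (simp flip: one_cls)
  next
    case (Cons i u)
    then have "inv\<^bsub>W\<^esub> cls (i # u) = inv\<^bsub>W\<^esub> cls u \<otimes>\<^bsub>W\<^esub> \<sigma> i" by (simp add: cls_Cons W.inv_mult_group)
    moreover have "foldr ract (i # u) (t, b) = (\<sigma> i \<otimes>\<^bsub>W\<^esub> fst (foldr ract u (t, b)) \<otimes>\<^bsub>W\<^esub> \<sigma> i,
        snd (foldr ract u (t, b)) \<noteq> (fst (foldr ract u (t, b)) = \<sigma> i))" for b
      by (simp add: ract_def split_beta)
    ultimately show ?case using Cons.IH[of b] Cons.IH[of False] Cons.hyps t
      by - (cases b; cases "snd (foldr ract u (t, False))"; simp add: cls_Cons W.m_assoc)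
  qed
  from this[of b] show ?thesis by (simp add: prod_eq_iff *)
qed

text \<open>The cocycle rule for signs: \<open>v\<close> acts first, and \<open>w\<close> then acts
  on the root of the conjugated reflection.\<close>

lemma neg_mult:
  assumes "w \<in> carrier W" "v \<in> carrier W" "t \<in> carrier W"
  shows "neg (w \<otimes>\<^bsub>W\<^esub> v) t \<longleftrightarrow> neg v t \<noteq> neg w (v \<otimes>\<^bsub>W\<^esub> t \<otimes>\<^bsub>W\<^esub> inv\<^bsub>W\<^esub> v)"
proof -
  obtain a where a: "a \<in> lists I" "w = cls a" using assms(1) by (rule carrierE)
  obtain c where c: "c \<in> lists I" "v = cls c" using assms(2) by (rule carrierE)
  have "snd (foldr ract (a @ c) (t, False)) = neg (cls (a @ c)) t"
    using a c assms by (subst foldr_ract) auto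
  moreover have "snd (foldr ract (a @ c) (t, False)) = (neg v t \<noteq> neg w (v \<otimes>\<^bsub>W\<^esub> t \<otimes>\<^bsub>W\<^esub> inv\<^bsub>W\<^esub> v))"
    using a c assms by (simp add: foldr_ract)
  ultimately show ?thesis using a c by (simp add: cls_append)
qed

lemma neg_\<sigma>: "i \<in> I \<Longrightarrow> t \<in> carrier W \<Longrightarrow> neg (\<sigma> i) t \<longleftrightarrow> t = \<sigma> i"
  using foldr_ract[of "[i]" t False] by (simp add: ract_def simple_refl_def)

lemma neg_one [simp]: "t \<in> carrier W \<Longrightarrow> \<not> neg \<one>\<^bsub>W\<^esub> t"
  using foldr_ract[of "[]" t False] by (simp add: one_cls)

lemma \<sigma>_neq_one: "i \<in> I \<Longrightarrow> \<sigma> i \<noteq> \<one>\<^bsub>W\<^esub>"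
  using neg_\<sigma>[of i "\<sigma> i"] neg_one[of "\<sigma> i"] by auto

text \<open>Equal reflections would have product 1, so that \<open>m i j\<close> would divide 1;
  this rests on the exact order of the product.\<close>

lemma \<sigma>_inj: "i \<in> I \<Longrightarrow> j \<in> I \<Longrightarrow> \<sigma> i = \<sigma> j \<Longrightarrow> i = j"
  using \<sigma>_pow_eq_one_iff[of i j 1] m_eq_1_iff[of i j] by fastforce

text \<open>The strong exchange condition, for words over a subset \<open>J\<close> of the
  generators. Reading the word from the right, the root of \<open>t\<close> becomes negative at some
  letter; just before, it is the simple root of that letter, so deleting the letter has the effect
  of multiplying by \<open>t\<close>.\<close>

lemma exchange:
  assumes "J \<subseteq> I" "u \<in> lists J" "t \<in> carrier W" "neg (cls u) t"
  obtains u' where "u' \<in> lists J" "length u = Suc (length u')" "cls u \<otimes>\<^bsub>W\<^esub> t = cls u'"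
  using assms(2,4)
proof (induction u arbitrary: thesis)
  case Nil
  then show ?case using assms(3) by (simp flip: one_cls)
next
  case (Cons i u)
  have iu: "i \<in> I" "u \<in> lists I" using Cons.hyps assms(1) by auto
  note mult = neg_mult[OF \<sigma>_closed[OF iu(1)] cls_closed[OF iu(2)] assms(3)]
  show ?case
  proof (cases "neg (cls u) t")
    case True
    then obtain u' where "u' \<in> lists J" "length u = Suc (length u')" "cls u \<otimes>\<^bsub>W\<^esub> t = cls u'"
      using Cons.IH by blast
    moreover from this have "u' \<in> lists I" using assms(1) by auto
    ultimately show ?thesis
      using Cons.prems(1)[of "i # u'"] Cons.hyps iu assms(3) by (simp add: cls_Cons W.m_assoc)
  next
    case False
    then have *: "cls u \<otimes>\<^bsub>W\<^esub> t \<otimes>\<^bsub>W\<^esub> inv\<^bsub>W\<^esub> cls u = \<sigma> i"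
      using Cons.prems mult iu assms(3) by (simp add: cls_Cons neg_\<sigma>)
    then have "cls u \<otimes>\<^bsub>W\<^esub> t = \<sigma> i \<otimes>\<^bsub>W\<^esub> cls u"
      using W.inv_solve_right'[of "cls u \<otimes>\<^bsub>W\<^esub> t" "\<sigma> i" "cls u"] iu assms(3) by (metis W.inv_solve_right W.m_closed \<sigma>_closed cls_closed)
    then show ?thesis using Cons.prems(1)[of u] Cons.hyps iu assms(3) by (simp add: cls_Cons W.m_assoc)
  qed
qed

end

text \<open>The alternating word of length \<open>n\<close> whose last letter is \<open>k\<close>.
  It grows at the front, so one more letter means one more factor on the left; \<open>alt\<close>
  fixes the first letter instead, and \<open>zigzag_alt\<close> converts.\<close>

primrec zigzag :: "'i \<Rightarrow> 'i \<Rightarrow> nat \<Rightarrow> 'i list" where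
  "zigzag i k 0 = []"
| "zigzag i k (Suc n) = (if even n then k else i) # zigzag i k n"

lemma zigzag_in_lists: "i \<in> J \<Longrightarrow> k \<in> J \<Longrightarrow> zigzag i k n \<in> lists J"
  by (induction n) auto

lemma length_zigzag [simp]: "length (zigzag i k n) = n"
  by (induction n) auto

lemma zigzag_add: "\<exists>y. y \<in> lists {i, k} \<and> length y = a \<and> zigzag i k (a + b) = y @ zigzag i k b"
proof (induction a)
  case (Suc a)
  then obtain y where "y \<in> lists {i, k}" "length y = a" "zigzag i k (a + b) = y @ zigzag i k b" by blast
  then show ?case by (intro exI[of _ "(if even (a + b) then k else i) # y"]) simp
qed simp

lemma zigzag_even: "zigzag i k (2 * n) = concat (replicate n [i, k])"
  by (induction n) auto

lemma zigzag_unique: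
  assumes "distinct_adj x" "x \<noteq> []" "set x \<subseteq> {i, k}" "last x = k" "i \<noteq> k"
  shows "x = zigzag i k (length x)"
  using assms
proof (induction x)
  case (Cons y x)
  show ?case
  proof (cases "x = []")
    case False
    then obtain n where n: "length x = Suc n" by (cases x) auto
    have "x = zigzag i k (length x)"
      using Cons False by (intro Cons.IH) (auto simp: distinct_adj_Cons)
    then have x: "x = zigzag i k (Suc n)" by (simp only: n)
    have "y \<noteq> hd x" using Cons.prems(1) False by (auto simp: distinct_adj_Cons)
    then show ?thesis using Cons.prems x by (auto simp: n split: if_splits)
  qed (use Cons in auto)
qed simp

lemma alt_Suc: "alt a b (Suc n) = a # alt b a n"
proof -
  have "[0..<Suc n] = 0 # map Suc [0..<n]" by (simp add: map_Suc_upt upt_conv_Cons del: upt_Suc)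
  then show ?thesis by (simp add: alt_def del: upt_Suc)
qed

lemma zigzag_alt: "zigzag i k n = (if even n then alt i k n else alt k i n)"
  by (induction n) (simp_all add: alt_Suc, simp add: alt_def)

lemma not_distinct_adjE:
  assumes "\<not> distinct_adj x"
  obtains a y b where "x = a @ [y, y] @ b"
  using assms
proof (induction x arbitrary: thesis)
  case (Cons z x)
  show ?case
  proof (cases "distinct_adj x")
    case True
    then have "x \<noteq> [] \<and> z = hd x" using Cons.prems(2) by (auto simp: distinct_adj_Cons)
    then show ?thesis using Cons.prems(1)[of "[]" z "tl x"] by simp
  next
    case False
    then obtain a y b where "x = a @ [y, y] @ b" using Cons.IH by blast
    then show ?thesis using Cons.prems(1)[of "z # a" y b] by simp
  qed
qed simp

section \<open>Dihedral subgroups generated by two simple reflections\<close>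

context coxeter_system
begin

lemma cls_lists_closed: "J \<subseteq> I \<Longrightarrow> w \<in> cls ` lists J \<Longrightarrow> w \<in> carrier W"
  using subsetD[OF lists_mono[of J I]] by (elim imageE) simp

lemma inv_cls_Cons:
  "i \<in> I \<Longrightarrow> u \<in> lists I \<Longrightarrow> inv\<^bsub>W\<^esub> cls (i # u) = inv\<^bsub>W\<^esub> cls u \<otimes>\<^bsub>W\<^esub> \<sigma> i"
  by (simp add: cls_Cons W.inv_mult_group)

text \<open>Writing the conjugate as a power of a rotation times \<open>\<sigma> k\<close> turns its
  comparison with a simple reflection into a question about the order of the rotation.\<close>

lemma zigzag_conj:
  assumes ik: "i \<in> I" "k \<in> I"
  shows "cls (zigzag i k n) \<otimes>\<^bsub>W\<^esub> \<sigma> i \<otimes>\<^bsub>W\<^esub> inv\<^bsub>W\<^esub> cls (zigzag i k n) =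
    (if even n then (\<sigma> i \<otimes>\<^bsub>W\<^esub> \<sigma> k) [^]\<^bsub>W\<^esub> (Suc n) \<otimes>\<^bsub>W\<^esub> \<sigma> k else (\<sigma> k \<otimes>\<^bsub>W\<^esub> \<sigma> i) [^]\<^bsub>W\<^esub> n \<otimes>\<^bsub>W\<^esub> \<sigma> k)"
proof (induction n)
  case 0
  then show ?case using ik by (simp add: W.m_assoc flip: one_cls)
next
  case (Suc n)
  let ?e = "\<sigma> i \<otimes>\<^bsub>W\<^esub> \<sigma> k" and ?d = "\<sigma> k \<otimes>\<^bsub>W\<^esub> \<sigma> i"
  let ?r = "cls (zigzag i k n) \<otimes>\<^bsub>W\<^esub> \<sigma> i \<otimes>\<^bsub>W\<^esub> inv\<^bsub>W\<^esub> cls (zigzag i k n)"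
  define l where "l = (if even n then k else i)"
  have l: "l \<in> I" using ik by (simp add: l_def)
  have z: "zigzag i k n \<in> lists I" using ik by (rule zigzag_in_lists)
  have e: "?e \<in> carrier W" and d: "?d \<in> carrier W" using ik by auto
  have "cls (zigzag i k (Suc n)) \<otimes>\<^bsub>W\<^esub> \<sigma> i \<otimes>\<^bsub>W\<^esub> inv\<^bsub>W\<^esub> cls (zigzag i k (Suc n)) = \<sigma> l \<otimes>\<^bsub>W\<^esub> ?r \<otimes>\<^bsub>W\<^esub> \<sigma> l"
    unfolding zigzag.simps l_def[symmetric] cls_Cons[OF l z] inv_cls_Cons[OF l z]
    using z ik l by (simp add: W.m_assoc W.inv_mult_group)
  also have "\<dots> = (if even (Suc n) then ?e [^]\<^bsub>W\<^esub> (Suc (Suc n)) \<otimes>\<^bsub>W\<^esub> \<sigma> k else ?d [^]\<^bsub>W\<^esub> (Suc n) \<otimes>\<^bsub>W\<^esub> \<sigma> k)"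
  proof (cases "even n")
    case True
    then have "\<sigma> l \<otimes>\<^bsub>W\<^esub> ?r \<otimes>\<^bsub>W\<^esub> \<sigma> l = \<sigma> k \<otimes>\<^bsub>W\<^esub> ?e [^]\<^bsub>W\<^esub> Suc n"
      unfolding Suc using ik e by (simp add: l_def W.m_assoc del: W.nat_pow_Suc)
    then show ?thesis using True \<sigma>_pow_swap[OF ik, of "Suc n"] by (simp del: W.nat_pow_Suc)
  next
    case False
    then have "\<sigma> l \<otimes>\<^bsub>W\<^esub> ?r \<otimes>\<^bsub>W\<^esub> \<sigma> l = \<sigma> i \<otimes>\<^bsub>W\<^esub> ?d [^]\<^bsub>W\<^esub> Suc n"
      unfolding Suc using ik d by (simp add: l_def W.m_assoc)
    also have "\<dots> = ?e [^]\<^bsub>W\<^esub> Suc n \<otimes>\<^bsub>W\<^esub> \<sigma> i" using \<sigma>_pow_swap[OF ik(2,1), of "Suc n"] .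
    also have "\<dots> = ?e [^]\<^bsub>W\<^esub> (Suc (Suc n)) \<otimes>\<^bsub>W\<^esub> \<sigma> k"
      using ik W.nat_pow_Suc[of ?e "Suc n"] e by (simp add: W.m_assoc del: W.nat_pow_Suc)
    finally show ?thesis using False by simp
  qed
  finally show ?case .
qed

text \<open>The first equation concerns the letter that prolongs the word to length
  \<open>Suc n\<close>, the second the other letter. Cancelling the simple reflection leaves a power
  of the rotation equal to 1, which \<open>\<sigma>_pow_eq_one_iff\<close> turns into
  divisibility.\<close>

lemma zigzag_conj_simple:
  assumes ik: "i \<in> I" "k \<in> I" "i \<noteq> k"
  defines "r n \<equiv> cls (zigzag i k n) \<otimes>\<^bsub>W\<^esub> \<sigma> i \<otimes>\<^bsub>W\<^esub> inv\<^bsub>W\<^esub> cls (zigzag i k n)"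
  shows "r n = \<sigma> (if even n then k else i) \<longleftrightarrow> m i k dvd Suc n"
    and "r n = \<sigma> (if even n then i else k) \<longleftrightarrow> m i k dvd n"
proof -
  let ?e = "\<sigma> i \<otimes>\<^bsub>W\<^esub> \<sigma> k" and ?d = "\<sigma> k \<otimes>\<^bsub>W\<^esub> \<sigma> i"
  have e: "?e \<in> carrier W" and d: "?d \<in> carrier W" using ik by auto
  note e1 = \<sigma>_pow_eq_one_iff[OF ik] and d1 = \<sigma>_pow_eq_one_iff[OF ik(2,1) ik(3)[symmetric]]
  have cancel: "x \<otimes>\<^bsub>W\<^esub> \<sigma> l = \<sigma> l \<longleftrightarrow> x = \<one>\<^bsub>W\<^esub>" if "x \<in> carrier W" "l \<in> I" for x l
    using that W.r_cancel_one[of "\<sigma> l" x] by simp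
  have ei: "?e [^]\<^bsub>W\<^esub> Suc n \<otimes>\<^bsub>W\<^esub> \<sigma> k = ?e [^]\<^bsub>W\<^esub> n \<otimes>\<^bsub>W\<^esub> \<sigma> i"
    using ik by (simp add: W.m_assoc)
  have di: "?d [^]\<^bsub>W\<^esub> n \<otimes>\<^bsub>W\<^esub> \<sigma> k = ?d [^]\<^bsub>W\<^esub> Suc n \<otimes>\<^bsub>W\<^esub> \<sigma> i"
    using ik by (simp add: W.m_assoc)
  show "r n = \<sigma> (if even n then k else i) \<longleftrightarrow> m i k dvd Suc n"
    unfolding r_def zigzag_conj[OF ik(1,2)]
    using cancel[of "?e [^]\<^bsub>W\<^esub> Suc n" k] cancel[of "?d [^]\<^bsub>W\<^esub> Suc n" i] e1[of "Suc n"] d1[of "Suc n"] e d ik di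
    by (simp add: m_sym[of k i] del: W.nat_pow_Suc)
  show "r n = \<sigma> (if even n then i else k) \<longleftrightarrow> m i k dvd n"
    unfolding r_def zigzag_conj[OF ik(1,2)]
    using cancel[of "?e [^]\<^bsub>W\<^esub> n" i] cancel[of "?d [^]\<^bsub>W\<^esub> n" k] e1[of n] d1[of n] e d ik ei
    by (simp add: m_sym[of k i] del: W.nat_pow_Suc)
qed

text \<open>Prepending the next letter flips the sign exactly when the current conjugate of
  \<open>\<sigma> i\<close> is that letter, that is, when \<open>m i k\<close> divides the new
  length. So the sign is the parity of the number of multiples of \<open>m i k\<close> reached; for
  \<open>m i k = 0\<close> the quotient is 0 and no flip occurs.\<close>

lemma neg_zigzag:
  assumes ik: "i \<in> I" "k \<in> I" "i \<noteq> k"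
  shows "neg (cls (zigzag i k n)) (\<sigma> i) \<longleftrightarrow> odd (n div m i k)"
proof (induction n)
  case 0
  then show ?case using ik by (simp flip: one_cls)
next
  case (Suc n)
  define l where "l = (if even n then k else i)"
  have l: "l \<in> I" using ik by (simp add: l_def)
  have z: "zigzag i k n \<in> lists I" using ik by (intro zigzag_in_lists)
  have "neg (cls (zigzag i k (Suc n))) (\<sigma> i) \<longleftrightarrow> odd (n div m i k) \<noteq> (m i k dvd Suc n)"
    unfolding zigzag.simps l_def[symmetric] cls_Cons[OF l z]
    using neg_mult[of "\<sigma> l" "cls (zigzag i k n)" "\<sigma> i"] zigzag_conj_simple(1)[OF ik, of n] l z ik
    by (simp add: neg_\<sigma> Suc flip: l_def)
  then show ?case by (simp add: div_Suc mod_eq_0_iff_dvd)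
qed

text \<open>Minimality is among words over \<open>J\<close>, so this is the length of the parabolic
  subgroup generated by \<open>J\<close>.\<close>

definition shortest :: "'i set \<Rightarrow> 'i list \<Rightarrow> bool" where
  "shortest J x \<longleftrightarrow> x \<in> lists J \<and> (\<forall>y\<in>lists J. cls y = cls x \<longrightarrow> length x \<le> length y)"

lemma ex_shortest: "y \<in> lists J \<Longrightarrow> \<exists>x. shortest J x \<and> cls x = cls y \<and> length x \<le> length y"
  using ex_has_least_nat[of "\<lambda>x. x \<in> lists J \<and> cls x = cls y" y length]
  unfolding shortest_def by (metis (no_types, lifting))

text \<open>Otherwise the cocycle rule makes \<open>k\<close> a descent of \<open>x\<close>, and the
  exchange condition yields a word for \<open>cls (x @ [k])\<close> that is two letters
  shorter.\<close>

lemma shortest_neg: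
  assumes J: "J \<subseteq> I" and s: "shortest J (x @ [k])"
  shows "neg (cls (x @ [k])) (\<sigma> k)"
proof (rule ccontr)
  assume n: "\<not> ?thesis"
  have x: "x \<in> lists J" "k \<in> J" using s by (auto simp: shortest_def)
  then have xI: "x \<in> lists I" "k \<in> I" using J by auto
  then have "cls x = cls (x @ [k]) \<otimes>\<^bsub>W\<^esub> \<sigma> k" by (simp add: cls_snoc W.m_assoc)
  then have "neg (cls x) (\<sigma> k)"
    using neg_mult[of "cls (x @ [k])" "\<sigma> k" "\<sigma> k"] xI n by (simp add: neg_\<sigma>)
  from exchange[OF J x(1) \<sigma>_closed[OF xI(2)] this] obtain u
    where u: "u \<in> lists J" "length x = Suc (length u)" "cls x \<otimes>\<^bsub>W\<^esub> \<sigma> k = cls u" .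
  then show False using s xI by (auto simp: shortest_def cls_snoc)
qed

lemma shortest_distinct_adj:
  assumes J: "J \<subseteq> I" and s: "shortest J x"
  shows "distinct_adj x"
proof (rule ccontr)
  assume "\<not> distinct_adj x"
  then obtain a y b where x: "x = a @ [y, y] @ b" by (metis not_distinct_adjE)
  then have l: "a \<in> lists J" "y \<in> J" "b \<in> lists J" using s by (auto simp: shortest_def)
  then have "cls (a @ [y, y] @ b) = cls (a @ b)"
    using J cls_append[of a "[y, y] @ b"] cls_append[of "[y, y]" b] cls_append[of a b] cls_square[of y]
    by (simp add: subset_iff in_lists_conv_set)
  moreover have "a @ b \<in> lists J" using l by simp
  ultimately have "length x \<le> length (a @ b)" using s unfolding shortest_def x by metis
  then show False by (simp add: x)
qed

text \<open>A nonempty shortest word for \<open>cls x\<close> cannot end in \<open>i\<close>, as the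
  root of \<open>i\<close> stays positive; so it is an alternating word ending in \<open>k\<close>,
  of some length \<open>N\<close>. Minimality gives \<open>N < 2 * m i k\<close>, positivity then
  \<open>N < m i k\<close>, and the conjugate is a simple reflection only if \<open>m i k\<close>
  divides \<open>Suc N\<close>. What remains is the word occurring in the last family of defining
  relations.\<close>

lemma dihedral_conj:
  assumes ik: "i \<in> I" "k \<in> I" "i \<noteq> k" and x: "x \<in> lists {i, k}"
    and n: "\<not> neg (cls x) (\<sigma> i)" and z: "z \<in> {i, k}" and c: "cls x \<otimes>\<^bsub>W\<^esub> \<sigma> i \<otimes>\<^bsub>W\<^esub> inv\<^bsub>W\<^esub> cls x = \<sigma> z"
  shows "cls x = \<one>\<^bsub>W\<^esub> \<and> z = i \<or>
    m i k \<noteq> 0 \<and> cls x = cls (zigzag i k (m i k - 1)) \<and> z = (if even (m i k) then i else k)"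
proof -
  have J: "{i, k} \<subseteq> I" using ik by simp
  obtain y where y: "shortest {i, k} y" "cls y = cls x" using ex_shortest[OF x] by blast
  then have yl: "y \<in> lists {i, k}" by (simp add: shortest_def)
  show ?thesis
  proof (cases "y = []")
    case True
    then have "cls x = \<one>\<^bsub>W\<^esub>" using y by (simp add: one_cls)
    then show ?thesis using c \<sigma>_inj[of i z] ik z by auto
  next
    case False
    then obtain y' l where y': "y = y' @ [l]" by (cases y rule: rev_cases) auto
    have "l = k" using shortest_neg[OF J, of y' l] y n yl unfolding y' by auto
    then have "last y = k" using y' by simp
    then obtain N where N: "y = zigzag i k N"
      using zigzag_unique[OF shortest_distinct_adj[OF J y(1)] False] yl ik by (auto simp: in_lists_conv_set subset_iff)
    have N0: "N > 0" using False N by (cases N) auto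
    have even: "even (N div m i k)" using n neg_zigzag[OF ik, of N] y(2) N by simp
    have "m i k dvd N \<or> m i k dvd Suc N"
      using zigzag_conj_simple[OF ik, of N] c z y(2) N by (auto split: if_splits)
    then have m0: "m i k \<noteq> 0" using N0 by (cases "m i k = 0") auto
    have m2: "m i k \<noteq> 1" using m_eq_1_iff ik by simp
    have "N < 2 * m i k"
    proof (rule ccontr)
      assume "\<not> ?thesis"
      \<comment> \<open>An alternating word this long ends in a full copy of the relator, and
        dropping it contradicts minimality.\<close>
      then obtain a where a: "N = a + 2 * m i k" by (metis add.commute le_Suc_ex not_less)
      obtain w where w: "w \<in> lists {i, k}" "length w = a" "zigzag i k N = w @ zigzag i k (2 * m i k)"
        using zigzag_add[of i k a "2 * m i k"] a by blast
      then have "w \<in> lists I" using J by auto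
      then have "cls y = cls w"
        using w ik by (simp add: N zigzag_even cls_append relator_lists cls_replicate \<sigma>_pow_m)
      then have "length y \<le> length w" using y(1) w by (auto simp: shortest_def)
      then show False using a w m0 N by simp
    qed
    then have "N div m i k < 2" by (simp add: less_mult_imp_div_less)
    with even have "N div m i k = 0" by (cases "N div m i k") auto
    then have "N < m i k" using m0 by (simp add: div_eq_0_iff)
    then have nd: "\<not> m i k dvd N" using N0 by (auto dest: dvd_imp_le)
    with \<open>m i k dvd N \<or> m i k dvd Suc N\<close> have "m i k \<le> Suc N" by (auto dest: dvd_imp_le)
    then have Nm: "m i k = Suc N" using \<open>N < m i k\<close> by simp
    have "\<sigma> z = \<sigma> (if even N then k else i)"
      using zigzag_conj_simple(1)[OF ik, of N] Nm c y(2) N by simp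
    then have "z = (if even N then k else i)" using \<sigma>_inj[of z] z ik by auto
    then show ?thesis using Nm m0 y(2) N by simp
  qed
qed

lemma subword_mult:
  assumes "J \<subseteq> I" "a \<in> cls ` lists J" "b \<in> cls ` lists J"
  shows "a \<otimes>\<^bsub>W\<^esub> b \<in> cls ` lists J"
proof -
  obtain x y where xy: "x \<in> lists J" "a = cls x" "y \<in> lists J" "b = cls y" using assms by blast
  then have I: "x \<in> lists I" "y \<in> lists I" using assms(1) by auto
  show ?thesis using xy I cls_append[OF I] by (auto intro!: image_eqI[of _ _ "x @ y"])
qed

lemma subword_inv:
  assumes "J \<subseteq> I" "a \<in> cls ` lists J"
  shows "inv\<^bsub>W\<^esub> a \<in> cls ` lists J"
proof -
  obtain x where x: "x \<in> lists J" "a = cls x" using assms by blast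
  then have I: "x \<in> lists I" using assms(1) by auto
  show ?thesis using x inv_cls[OF I] by (auto intro!: image_eqI[of _ _ "rev x"])
qed

text \<open>If \<open>w\<close> carries the simple root \<open>\<alpha>\<^sub>i\<close> to the simple root \<open>\<alpha>\<^sub>j\<close>, then \<open>w\<close> is a product of
  elements doing this inside rank two parabolic subgroups. The induction is over the length of \<open>w\<close>:
  for a right descent \<open>k\<close> of \<open>w\<close>, write \<open>w = a b\<close> with \<open>a\<close> of minimal length in its coset of
  \<open>\<langle>s\<^sub>i, s\<^sub>k\<rangle>\<close>. As \<open>a\<close> keeps the positive roots of this subgroup positive, the reflection
  \<open>r = b s\<^sub>i b\<^sup>-\<^sup>1 = a\<^sup>-\<^sup>1 s\<^sub>j a\<close> inverts only its own root, so it is \<open>s\<^sub>i\<close> or \<open>s\<^sub>k\<close>.\<close>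

lemma simple_root_transport_induct [consumes 5, case_names one mult dihedral]:
  assumes "w \<in> carrier W" "i \<in> I" "j \<in> I" "\<not> neg w (\<sigma> i)" "w \<otimes>\<^bsub>W\<^esub> \<sigma> i \<otimes>\<^bsub>W\<^esub> inv\<^bsub>W\<^esub> w = \<sigma> j"
    and one: "\<And>i. i \<in> I \<Longrightarrow> P \<one>\<^bsub>W\<^esub> i i"
    and mult: "\<And>a b i j k. a \<in> carrier W \<Longrightarrow> b \<in> carrier W \<Longrightarrow> i \<in> I \<Longrightarrow> j \<in> I \<Longrightarrow> k \<in> I \<Longrightarrow>
      P b i k \<Longrightarrow> P a k j \<Longrightarrow> P (a \<otimes>\<^bsub>W\<^esub> b) i j"
    and dihedral: "\<And>i j. i \<in> I \<Longrightarrow> j \<in> I \<Longrightarrow> i \<noteq> j \<Longrightarrow> m i j \<noteq> 0 \<Longrightarrow>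
      P (cls (alt j i (m i j - 1))) (if even (m i j) then i else j) i"
  shows "P w i j"
proof -
  obtain x where "x \<in> lists I" "w = cls x" using assms(1) by (rule carrierE)
  then show ?thesis using assms(2-5)
  proof (induction "length x" arbitrary: x w i rule: less_induct)
    case less
    note w = \<open>w = cls x\<close> and iI = \<open>i \<in> I\<close> and jI = \<open>j \<in> I\<close>
    obtain y where y: "shortest I y" "cls y = w" "length y \<le> length x"
      using ex_shortest[of x I] less.prems by blast
    then have yI: "y \<in> lists I" by (simp add: shortest_def)
    show ?case
    proof (cases "y = []")
      case True
      then have "w = \<one>\<^bsub>W\<^esub>" using y by (simp add: one_cls)
      then have "i = j" using \<sigma>_inj[of i j] less.prems by simp
      then show ?thesis using one[OF iI] \<open>w = \<one>\<^bsub>W\<^esub>\<close> by simp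
    next
      case False
      then obtain y' k where y': "y = y' @ [k]" by (cases y rule: rev_cases) auto
      have kI: "k \<in> I" "y' \<in> lists I" using yI y' by auto
      have ik: "i \<noteq> k" using shortest_neg[of I y' k] y less.prems y' by auto
      let ?J = "{i, k}"
      have J: "?J \<subseteq> I" using iI kI by simp
      let ?Q = "\<lambda>a. a \<in> lists I \<and> (\<exists>b\<in>lists ?J. w = cls a \<otimes>\<^bsub>W\<^esub> cls b)"
      have "?Q y'" using kI y(2) y' by (auto simp: cls_snoc simple_refl_def intro!: bexI[of _ "[k]"])
      from ex_has_least_nat[of ?Q y' length, OF this] obtain a
        where a: "?Q a" and amin: "\<And>c. ?Q c \<Longrightarrow> length a \<le> length c" by blast
      then obtain b where b: "b \<in> lists ?J" "w = cls a \<otimes>\<^bsub>W\<^esub> cls b" and aI: "a \<in> lists I" by blast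
      have bI: "b \<in> lists I" using b J by auto
      have "length a \<le> length y'" by (rule amin) fact
      then have al: "length a < length x" using y y' by simp
      \<comment> \<open>If \<open>a\<close> made a root of the subgroup negative, the exchange
        condition would shorten \<open>a\<close> at the price of moving \<open>t\<close> into
        \<open>b\<close>, against the choice of \<open>a\<close>.\<close>
      have a_pos: "\<not> neg (cls a) t" if t: "t \<in> cls ` lists ?J" for t
      proof
        assume "neg (cls a) t"
        have tW: "t \<in> carrier W" using cls_lists_closed[OF J t] .
        from exchange[OF subset_refl aI tW \<open>neg (cls a) t\<close>] obtain u
          where u: "u \<in> lists I" "length a = Suc (length u)" "cls a \<otimes>\<^bsub>W\<^esub> t = cls u" .
        have "inv\<^bsub>W\<^esub> t \<otimes>\<^bsub>W\<^esub> cls b \<in> cls ` lists ?J"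
          using subword_mult[OF J subword_inv[OF J t]] b by blast
        then obtain c where c: "c \<in> lists ?J" "inv\<^bsub>W\<^esub> t \<otimes>\<^bsub>W\<^esub> cls b = cls c" by blast
        have "w = cls u \<otimes>\<^bsub>W\<^esub> cls c"
          using u(3)[symmetric] c(2)[symmetric] b aI bI tW by (simp add: W.m_assoc W.inv_solve_left' flip: W.m_assoc[of t])
        then have "length a \<le> length u" using u c by (intro amin) blast
        then show False using u by simp
      qed
      define r where "r = cls b \<otimes>\<^bsub>W\<^esub> \<sigma> i \<otimes>\<^bsub>W\<^esub> inv\<^bsub>W\<^esub> cls b"
      have sJ: "\<sigma> z \<in> cls ` lists ?J" if "z \<in> ?J" for z
        using that by (auto simp: simple_refl_def intro!: image_eqI[of _ _ "[z]"])
      have rJ: "r \<in> cls ` lists ?J"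
        unfolding r_def using sJ[of i] b
        by (intro subword_mult[OF J] subword_inv[OF J]) auto
      then have rW: "r \<in> carrier W" by (rule cls_lists_closed[OF J])
      have ar: "cls a \<otimes>\<^bsub>W\<^esub> r \<otimes>\<^bsub>W\<^esub> inv\<^bsub>W\<^esub> cls a = \<sigma> j"
        using less.prems(6) b aI bI iI by (simp add: r_def W.m_assoc W.inv_mult_group)
      have nb: "\<not> neg (cls b) (\<sigma> i)"
        using less.prems(5) neg_mult[of "cls a" "cls b" "\<sigma> i"] a_pos[OF rJ] b(2) aI bI iI by (simp add: r_def)
      have ar': "cls a \<otimes>\<^bsub>W\<^esub> r = \<sigma> j \<otimes>\<^bsub>W\<^esub> cls a"
        using ar aI rW jI by (metis W.inv_solve_right' W.m_closed \<sigma>_closed cls_closed)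
      \<comment> \<open>The sign of the root of \<open>z\<close> under
        \<open>a r = \<sigma> j a\<close> is computed in both ways: \<open>a\<close> never
        contributes, and \<open>\<sigma> j\<close> would contribute only if \<open>a\<close>
        conjugated \<open>\<sigma> z\<close> to \<open>\<sigma> j\<close>, which means
        \<open>\<sigma> z = r\<close>.\<close>
      have r_pos: "\<not> neg r (\<sigma> z)" if z: "z \<in> ?J" "\<sigma> z \<noteq> r" for z
      proof -
        have zW: "\<sigma> z \<in> carrier W" using z J by auto
        have "r \<otimes>\<^bsub>W\<^esub> \<sigma> z \<otimes>\<^bsub>W\<^esub> inv\<^bsub>W\<^esub> r \<in> cls ` lists ?J" 
          using rJ sJ[OF z(1)] by (intro subword_mult[OF J] subword_inv[OF J])
        then have "neg (cls a \<otimes>\<^bsub>W\<^esub> r) (\<sigma> z) = neg r (\<sigma> z)"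
          using neg_mult[of "cls a" r "\<sigma> z"] a_pos aI rW zW by simp
        moreover have "cls a \<otimes>\<^bsub>W\<^esub> \<sigma> z \<otimes>\<^bsub>W\<^esub> inv\<^bsub>W\<^esub> cls a \<noteq> \<sigma> j"
        proof
          assume "cls a \<otimes>\<^bsub>W\<^esub> \<sigma> z \<otimes>\<^bsub>W\<^esub> inv\<^bsub>W\<^esub> cls a = \<sigma> j"
          then have "cls a \<otimes>\<^bsub>W\<^esub> (\<sigma> z \<otimes>\<^bsub>W\<^esub> inv\<^bsub>W\<^esub> cls a) = cls a \<otimes>\<^bsub>W\<^esub> (r \<otimes>\<^bsub>W\<^esub> inv\<^bsub>W\<^esub> cls a)"
            using ar aI zW rW by (simp add: W.m_assoc)
          then show False using z aI zW rW by simp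
        qed
        then have "\<not> neg (\<sigma> j \<otimes>\<^bsub>W\<^esub> cls a) (\<sigma> z)"
          using neg_mult[of "\<sigma> j" "cls a" "\<sigma> z"] a_pos[OF sJ[OF z(1)]] aI zW jI by (simp add: neg_\<sigma>)
        ultimately show ?thesis by (simp add: ar')
      qed
      \<comment> \<open>The last letter \<open>z\<close> of a shortest word for \<open>r\<close> is
        a descent of \<open>r\<close>, so \<open>r_pos\<close> forces \<open>r = \<sigma> z\<close>.
        The word is nonempty, since \<open>r\<close> is conjugate to \<open>\<sigma> i\<close> and
        hence not 1.\<close>
      have "\<exists>z\<in>?J. r = \<sigma> z"
      proof (rule ccontr)
        assume no: "\<not> ?thesis"
        obtain v where v: "shortest ?J v" "cls v = r" using rJ ex_shortest[of _ ?J] by (metis imageE)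
        show False
        proof (cases v rule: rev_cases)
          case Nil
          then have "cls b \<otimes>\<^bsub>W\<^esub> \<sigma> i \<otimes>\<^bsub>W\<^esub> inv\<^bsub>W\<^esub> cls b = \<one>\<^bsub>W\<^esub>" using v by (simp add: r_def one_cls)
          then have "cls b \<otimes>\<^bsub>W\<^esub> \<sigma> i = cls b" using bI iI by (metis W.inv_solve_right' W.l_one W.m_closed W.one_closed \<sigma>_closed cls_closed)
          then show False using \<sigma>_neq_one[OF iI] bI iI by simp
        next
          case (snoc v' z)
          then have "z \<in> ?J" using v by (auto simp: shortest_def)
          then show False using shortest_neg[OF J, of v' z] v snoc r_pos[of z] no by metis
        qed
      qed
      then obtain z where z: "z \<in> ?J" "r = \<sigma> z" by blast
      then have zI: "z \<in> I" using J by blast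
      have "P (cls a) z j"
        by (rule less.hyps[OF al aI HOL.refl zI jI]) (use a_pos sJ z ar in auto)
      moreover have "P (cls b) i z"
        using dihedral_conj[OF iI kI(1) ik b(1) nb z(1) z(2)[unfolded r_def]]
      proof (elim disjE conjE)
        assume "cls b = \<one>\<^bsub>W\<^esub>" "z = i"
        then show ?thesis using one[OF iI] by simp
      next
        assume m0: "m i k \<noteq> 0" and cb: "cls b = cls (zigzag i k (m i k - 1))" and ze: "z = (if even (m i k) then i else k)"
        show ?thesis
        proof (cases "even (m i k)")
          case True
          then show ?thesis using dihedral[OF iI kI(1) ik m0] m0 cb ze by (simp add: zigzag_alt)
        next
          case False
          then show ?thesis using dihedral[OF kI(1) iI ik[symmetric]] m0 cb ze m_sym[OF iI kI(1)] by (simp add: zigzag_alt)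
        qed
      qed
      ultimately show ?thesis using mult[of "cls a" "cls b" i j z] aI bI iI jI zI b(2) by simp
    qed
  qed
qed

section \<open>Reflections and their representatives\<close>

lemma reflections_closed: "t \<in> reflections I m \<Longrightarrow> t \<in> carrier W"
  by (auto simp: reflections_def)

lemma \<sigma>_reflection: "i \<in> I \<Longrightarrow> \<sigma> i \<in> reflections I m"
  unfolding reflections_def by (intro CollectI exI[of _ "\<one>\<^bsub>W\<^esub>"] exI[of _ i]) simp

lemma conj_reflection:
  assumes "i \<in> I" "t \<in> reflections I m"
  shows "\<sigma> i \<otimes>\<^bsub>W\<^esub> t \<otimes>\<^bsub>W\<^esub> \<sigma> i \<in> reflections I m"
proof -
  obtain w j where w: "w \<in> carrier W" "j \<in> I" "t = w \<otimes>\<^bsub>W\<^esub> \<sigma> j \<otimes>\<^bsub>W\<^esub> inv\<^bsub>W\<^esub> w"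
    using assms by (auto simp: reflections_def)
  then show ?thesis unfolding reflections_def
    by (intro CollectI exI[of _ "\<sigma> i \<otimes>\<^bsub>W\<^esub> w"] exI[of _ j]) (use assms in \<open>simp add: W.m_assoc W.inv_mult_group\<close>)
qed

text \<open>This follows the recursion that determines the \<open>D_s\<close>: conjugating
  \<open>\<sigma> i\<close> by itself gives nothing new, so the step may assume that
  \<open>t\<close> differs from \<open>\<sigma> i\<close>.\<close>

lemma reflection_induct [consumes 1, case_names simple conj]:
  assumes "t \<in> reflections I m"
    and simple: "\<And>i. i \<in> I \<Longrightarrow> P (\<sigma> i)"
    and conj: "\<And>i t. i \<in> I \<Longrightarrow> t \<in> reflections I m \<Longrightarrow> t \<noteq> \<sigma> i \<Longrightarrow> P t \<Longrightarrow> P (\<sigma> i \<otimes>\<^bsub>W\<^esub> t \<otimes>\<^bsub>W\<^esub> \<sigma> i)"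
  shows "P t"
proof -
  obtain w j where w: "w \<in> carrier W" and j: "j \<in> I" and t: "t = w \<otimes>\<^bsub>W\<^esub> \<sigma> j \<otimes>\<^bsub>W\<^esub> inv\<^bsub>W\<^esub> w"
    using assms by (auto simp: reflections_def)
  obtain x where x: "x \<in> lists I" "w = cls x" using w by (rule carrierE)
  have "P (cls x \<otimes>\<^bsub>W\<^esub> \<sigma> j \<otimes>\<^bsub>W\<^esub> inv\<^bsub>W\<^esub> cls x) \<and> cls x \<otimes>\<^bsub>W\<^esub> \<sigma> j \<otimes>\<^bsub>W\<^esub> inv\<^bsub>W\<^esub> cls x \<in> reflections I m" using x(1)
  proof (induction x)
    case Nil
    then show ?case using simple[OF j] \<sigma>_reflection[OF j] j by (simp flip: one_cls)
  next
    case (Cons i x)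
    let ?r = "cls x \<otimes>\<^bsub>W\<^esub> \<sigma> j \<otimes>\<^bsub>W\<^esub> inv\<^bsub>W\<^esub> cls x"
    have eq: "cls (i # x) \<otimes>\<^bsub>W\<^esub> \<sigma> j \<otimes>\<^bsub>W\<^esub> inv\<^bsub>W\<^esub> cls (i # x) = \<sigma> i \<otimes>\<^bsub>W\<^esub> ?r \<otimes>\<^bsub>W\<^esub> \<sigma> i"
      unfolding inv_cls_Cons[OF Cons.hyps] cls_Cons[OF Cons.hyps] using Cons.hyps j by (simp add: W.m_assoc W.inv_mult_group)
    show ?case
    proof (cases "?r = \<sigma> i")
      case True
      then show ?thesis using Cons eq by simp
    next
      case False
      then show ?thesis unfolding eq using Cons conj conj_reflection by blast
    qed
  qed
  then show ?thesis using t x by simp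
qed

text \<open>Replacing \<open>w\<close> by \<open>w\<close> times \<open>\<sigma> i\<close> keeps the
  reflection and reverses the sign, so one of the two is positive.\<close>

lemma positive_representative:
  assumes "t \<in> reflections I m"
  obtains w i where "w \<in> carrier W" "i \<in> I" "t = w \<otimes>\<^bsub>W\<^esub> \<sigma> i \<otimes>\<^bsub>W\<^esub> inv\<^bsub>W\<^esub> w" "\<not> neg w (\<sigma> i)"
proof -
  obtain w i where w: "w \<in> carrier W" "i \<in> I" "t = w \<otimes>\<^bsub>W\<^esub> \<sigma> i \<otimes>\<^bsub>W\<^esub> inv\<^bsub>W\<^esub> w"
    using assms by (auto simp: reflections_def)
  show thesis
  proof (cases "neg w (\<sigma> i)")
    case True
    then have "\<not> neg (w \<otimes>\<^bsub>W\<^esub> \<sigma> i) (\<sigma> i)" using neg_mult[of w "\<sigma> i" "\<sigma> i"] w by (simp add: neg_\<sigma>)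
    then show ?thesis using that[of "w \<otimes>\<^bsub>W\<^esub> \<sigma> i" i] w by (simp add: W.m_assoc W.inv_mult_group)
  qed (use that w in blast)
qed

end

section \<open>The Hopf algebra \<open>hecke_hat\<close>\<close>

context monoid
begin

lemma word_eval_Nil [simp]: "word_eval G v [] = \<one>"
  and word_eval_Cons [simp]: "word_eval G v (x # w) = v x \<otimes> word_eval G v w"
  by (simp_all add: word_eval_def)

lemma word_eval_closed: "(\<And>x. x \<in> A \<Longrightarrow> v x \<in> carrier G) \<Longrightarrow> w \<in> lists A \<Longrightarrow> word_eval G v w \<in> carrier G"
  by (induction w) auto

lemma word_eval_append:
  assumes v: "\<And>x. x \<in> A \<Longrightarrow> v x \<in> carrier G" and "w \<in> lists A" "w' \<in> lists A"
  shows "word_eval G v (w @ w') = word_eval G v w \<otimes> word_eval G v w'"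
  using assms(2) by (induction w) (auto simp: word_eval_closed[OF v] assms m_assoc)

end

lemma word_eval_map: "word_eval M v (map f w) = word_eval M (\<lambda>x. v (f x)) w"
  by (simp add: word_eval_def foldr_map comp_def)

lemma monoid_word_monoid: "monoid (word_monoid A)"
  by (rule monoidI) (auto simp: word_monoid_def)

lemma word_eval_hom:
  assumes "monoid M" "\<And>x. x \<in> A \<Longrightarrow> v x \<in> carrier M"
  shows "word_eval M v \<in> hom (word_monoid A) M"
  by (rule homI)
    (simp_all add: word_monoid_def monoid.word_eval_closed[OF assms(1), of A v, OF assms(2)]
      monoid.word_eval_append[OF assms(1), of A v, OF assms(2)])

context coxeter_system
begin

abbreviation "F \<equiv> free_ring (gens I)"
abbreviation "H \<equiv> hecke_hat I m"
abbreviation "ss \<equiv> s_el I m"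
abbreviation "dd \<equiv> D_el I m"

lemma gens_iff [simp]: "GS i \<in> gens I \<longleftrightarrow> i \<in> I" "GD i \<in> gens I \<longleftrightarrow> i \<in> I"
  by (auto simp: gens_def)

lemma gensE: "g \<in> gens I \<Longrightarrow> (\<And>i. i \<in> I \<Longrightarrow> g = GS i \<Longrightarrow> P) \<Longrightarrow> (\<And>i. i \<in> I \<Longrightarrow> g = GD i \<Longrightarrow> P) \<Longrightarrow> P"
  by (auto simp: gens_def)

lemma ring_F: "ring F"
  unfolding free_ring_def by (rule ring_monoid_ring) (rule monoid_word_monoid)

lemma carrier_F: "carrier F = {p. Poly_Mapping.keys p \<subseteq> lists (gens I)}"
  and add_F: "p \<oplus>\<^bsub>F\<^esub> q = p + q" and one_F: "\<one>\<^bsub>F\<^esub> = frag_of []"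
  and mult_F: "frag_of v \<otimes>\<^bsub>F\<^esub> frag_of w = frag_of (v @ w)"
  by (simp_all add: free_ring_def word_monoid_def)

lemma diff_F: "p \<in> carrier F \<Longrightarrow> q \<in> carrier F \<Longrightarrow> p \<ominus>\<^bsub>F\<^esub> q = p - q"
  using minus_monoid_ring[OF monoid_word_monoid] by (simp add: free_ring_def)

sublocale F: ring F by (rule ring_F)

lemma alt_in_lists: "i \<in> J \<Longrightarrow> j \<in> J \<Longrightarrow> alt i j n \<in> lists J"
  by (auto simp: alt_def)

lemma map_GS_in_lists: "w \<in> lists I \<Longrightarrow> map GS w \<in> lists (gens I)"
  by auto

lemma map_relator: "concat (replicate n [GS i, GS j]) = map GS (concat (replicate n [i, j]))"
  by (induction n) auto

lemma hecke_relations_subset: "hecke_relations I m \<subseteq> carrier F"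
proof
  fix p assume "p \<in> hecke_relations I m"
  then show "p \<in> carrier F"
    unfolding hecke_relations_def carrier_F map_relator
    by (elim UnE CollectE exE conjE)
      (simp_all add: keys_diff_subset keys_add_subset keys_frag_of map_GS_in_lists alt_in_lists relator_lists)
qed

sublocale hecke_ideal: ideal "hecke_ideal I m" F
  unfolding hecke_ideal_def by (rule F.genideal_ideal[OF hecke_relations_subset])

lemma ring_H: "ring H"
  unfolding hecke_hat_def by (rule hecke_ideal.quotient_is_ring)

sublocale H: ring H by (rule ring_H)

definition proj :: "('i gen list \<Rightarrow>\<^sub>0 int) \<Rightarrow> ('i gen list \<Rightarrow>\<^sub>0 int) set" where
  "proj p = hecke_ideal I m +>\<^bsub>F\<^esub> p"

lemma proj_hom: "proj \<in> ring_hom F H"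
  unfolding proj_def hecke_hat_def by (rule hecke_ideal.rcos_ring_hom)

lemma proj_closed [simp]: "p \<in> carrier F \<Longrightarrow> proj p \<in> carrier H"
  by (rule ring_hom_closed[OF proj_hom])

lemma proj_one: "proj (frag_of []) = \<one>\<^bsub>H\<^esub>"
  using ring_hom_one[OF proj_hom] by (simp add: one_F)

lemma gen_el_proj: "gen_el I m g = proj (frag_of [g])"
  by (simp add: gen_el_def proj_def)

lemma gen_el_closed [simp]: "g \<in> gens I \<Longrightarrow> gen_el I m g \<in> carrier H"
  unfolding gen_el_proj by (rule proj_closed) (simp add: carrier_F)

lemma proj_word: "w \<in> lists (gens I) \<Longrightarrow> proj (frag_of w) = word_eval H (gen_el I m) w"
proof (induction w)
  case (Cons g w)
  have "frag_of (g # w) = frag_of [g] \<otimes>\<^bsub>F\<^esub> frag_of w" by (simp add: mult_F)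
  then show ?case
    using Cons by (simp add: ring_hom_mult[OF proj_hom] carrier_F gen_el_proj)
qed (simp add: proj_one)

lemma proj_diff: "p \<in> carrier F \<Longrightarrow> q \<in> carrier F \<Longrightarrow> proj (p - q) = proj p \<ominus>\<^bsub>H\<^esub> proj q"
  using add_hom_diff[OF F.is_abelian_group H.is_abelian_group ring_hom_add_hom[OF proj_hom], of p q]
  by (simp add: diff_F)

lemma proj_relation: "p \<in> hecke_relations I m \<Longrightarrow> proj p = \<zero>\<^bsub>H\<^esub>"
  using hecke_ideal.a_rcos_const[of p] F.genideal_self[OF hecke_relations_subset]
  by (auto simp: proj_def hecke_hat_def FactRing_def hecke_ideal_def)

lemma proj_relationD:
  assumes "p - q \<in> hecke_relations I m" "p \<in> carrier F" "q \<in> carrier F"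
  shows "proj p = proj q"
proof -
  have "proj p \<ominus>\<^bsub>H\<^esub> proj q = \<zero>\<^bsub>H\<^esub>" using proj_relation[OF assms(1)] assms by (simp add: proj_diff)
  then show ?thesis using assms by simp
qed

text \<open>Words are built from the left by generators, and closure under differences reaches all
  their integral combinations.\<close>

lemma hecke_induct [consumes 1, case_names one gen diff]:
  assumes x: "x \<in> carrier H"
    and one: "P \<one>\<^bsub>H\<^esub>"
    and gen: "\<And>g x. g \<in> gens I \<Longrightarrow> x \<in> carrier H \<Longrightarrow> P x \<Longrightarrow> P (gen_el I m g \<otimes>\<^bsub>H\<^esub> x)"
    and diff: "\<And>x y. x \<in> carrier H \<Longrightarrow> y \<in> carrier H \<Longrightarrow> P x \<Longrightarrow> P y \<Longrightarrow> P (x \<ominus>\<^bsub>H\<^esub> y)"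
  shows "P x"
proof -
  obtain p where p: "Poly_Mapping.keys p \<subseteq> lists (gens I)" "x = proj p"
    using x by (auto simp: hecke_hat_def carrier_quot carrier_F proj_def)
  have "P (proj p) \<and> Poly_Mapping.keys p \<subseteq> lists (gens I)" using p(1)
  proof (induction p rule: frag_induction)
    case zero
    have "P (\<one>\<^bsub>H\<^esub> \<ominus>\<^bsub>H\<^esub> \<one>\<^bsub>H\<^esub>)" by (rule diff) (simp_all add: one)
    moreover have "0 = frag_of [] - frag_of ([] :: 'i gen list)" by simp
    then have "proj 0 = \<one>\<^bsub>H\<^esub> \<ominus>\<^bsub>H\<^esub> \<one>\<^bsub>H\<^esub>" using proj_diff[of "frag_of []" "frag_of []"]
      by (simp add: carrier_F proj_one)
    ultimately show ?case by simp
  next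
    case (one w)
    have "P (word_eval H (gen_el I m) w)" using one
      by (induction w) (auto simp: \<open>P \<one>\<^bsub>H\<^esub>\<close> intro!: gen H.word_eval_closed[of "gens I"])
    then show ?case using one by (simp add: proj_word keys_frag_of)
  next
    case (diff p q)
    then show ?case using assms(4) by (simp add: proj_diff carrier_F keys_diff_subset)
  qed
  then show ?thesis using p by simp
qed

lemma hecke_hom_eqI:
  assumes R: "ring R" and f: "f \<in> ring_hom H R" and g: "g \<in> ring_hom H R"
    and eq: "\<And>x. x \<in> gens I \<Longrightarrow> f (gen_el I m x) = g (gen_el I m x)" and x: "x \<in> carrier H"
  shows "f x = g x"
  using x
  by (induction x rule: hecke_induct)
    (simp_all add: ring_hom_one[OF f] ring_hom_one[OF g] ring_hom_mult[OF f] ring_hom_mult[OF g] eq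
      add_hom_diff[OF H.is_abelian_group ring.is_abelian_group[OF R] ring_hom_add_hom[OF f]]
      add_hom_diff[OF H.is_abelian_group ring.is_abelian_group[OF R] ring_hom_add_hom[OF g]])

lemma ss_closed [simp]: "i \<in> I \<Longrightarrow> ss i \<in> carrier H"
  and dd_closed [simp]: "i \<in> I \<Longrightarrow> dd i \<in> carrier H"
  by simp_all

lemma proj_GS: "w \<in> lists I \<Longrightarrow> proj (frag_of (map GS w)) = word_eval H ss w"
  by (simp add: proj_word map_GS_in_lists word_eval_map)

lemma ss_square:
  assumes "i \<in> I"
  shows "ss i \<otimes>\<^bsub>H\<^esub> ss i = \<one>\<^bsub>H\<^esub>"
proof -
  have "frag_of [GS i, GS i] - frag_of [] \<in> hecke_relations I m"
    unfolding hecke_relations_def using assms by blast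
  from proj_relationD[OF this] show ?thesis using assms by (simp add: carrier_F proj_word)
qed

lemma dd_square:
  assumes "i \<in> I"
  shows "dd i \<otimes>\<^bsub>H\<^esub> dd i = dd i"
proof -
  have "frag_of [GD i, GD i] - frag_of [GD i] \<in> hecke_relations I m"
    unfolding hecke_relations_def using assms by blast
  from proj_relationD[OF this] show ?thesis using assms by (simp add: carrier_F proj_word)
qed

lemma ss_dd:
  assumes "i \<in> I"
  shows "ss i \<otimes>\<^bsub>H\<^esub> dd i \<oplus>\<^bsub>H\<^esub> dd i \<otimes>\<^bsub>H\<^esub> ss i = ss i \<ominus>\<^bsub>H\<^esub> \<one>\<^bsub>H\<^esub>"
proof -
  have "proj (frag_of [GS i, GD i] + frag_of [GD i, GS i]) = proj (frag_of [GS i] - frag_of [])"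
  proof (rule proj_relationD)
    show "frag_of [GS i, GD i] + frag_of [GD i, GS i] - (frag_of [GS i] - frag_of []) \<in> hecke_relations I m"
      unfolding hecke_relations_def using assms by blast
  qed (use assms in \<open>simp_all add: carrier_F keys_diff_subset keys_add_subset\<close>)
  then show ?thesis
    using ring_hom_add[OF proj_hom, of "frag_of [GS i, GD i]" "frag_of [GD i, GS i]"] assms
    by (simp add: proj_diff carrier_F add_F proj_word)
qed

lemma ss_relator:
  assumes "i \<in> I" "j \<in> I"
  shows "word_eval H ss (relator i j) = \<one>\<^bsub>H\<^esub>"
proof -
  have "frag_of (map GS (relator i j)) - frag_of [] \<in> hecke_relations I m"
    unfolding hecke_relations_def map_relator[symmetric] using assms by blast
  from proj_relationD[OF this] show ?thesis
    using assms by (simp add: carrier_F proj_GS relator_lists proj_one map_GS_in_lists)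
qed

lemma dd_braid:
  assumes "i \<in> I" "j \<in> I" "i \<noteq> j" "m i j \<noteq> 0"
  shows "dd i \<otimes>\<^bsub>H\<^esub> word_eval H ss (alt j i (m i j - 1)) =
    word_eval H ss (alt j i (m i j - 1)) \<otimes>\<^bsub>H\<^esub> dd (if even (m i j) then i else j)"
proof -
  let ?w = "map GS (alt j i (m i j - 1))" and ?k = "if even (m i j) then i else j"
  have w: "?w \<in> lists (gens I)" using assms by (intro map_GS_in_lists alt_in_lists)
  have "proj (frag_of (GD i # ?w)) = proj (frag_of (?w @ [GD ?k]))"
  proof (rule proj_relationD)
    show "frag_of (GD i # ?w) - frag_of (?w @ [GD ?k]) \<in> hecke_relations I m"
      unfolding hecke_relations_def using assms by (intro UnI2 CollectI exI[of _ i] exI[of _ j]) simp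
  qed (use assms w in \<open>simp_all add: carrier_F\<close>)
  then show ?thesis using assms w by (simp add: proj_word H.word_eval_append[of "gens I"] word_eval_map del: map_map)
qed

end

text \<open>The relations of \<open>hecke_hat\<close> in an arbitrary ring \<open>R\<close>, so that
  \<open>v\<close> extends to a ring homomorphism. The instances are the tensor square, the
  integers, the opposite ring of \<open>hecke_hat\<close> and an endomorphism ring.\<close>

locale hecke_rep = coxeter_system I m + R: ring R
  for I :: "'i set" and m and R :: "('r, 'q) ring_scheme" +
  fixes v :: "'i gen \<Rightarrow> 'r"
  assumes v_closed: "g \<in> gens I \<Longrightarrow> v g \<in> carrier R"
    and s_square: "i \<in> I \<Longrightarrow> v (GS i) \<otimes>\<^bsub>R\<^esub> v (GS i) = \<one>\<^bsub>R\<^esub>"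
    and d_square: "i \<in> I \<Longrightarrow> v (GD i) \<otimes>\<^bsub>R\<^esub> v (GD i) = v (GD i)"
    and s_d: "i \<in> I \<Longrightarrow> v (GS i) \<otimes>\<^bsub>R\<^esub> v (GD i) \<oplus>\<^bsub>R\<^esub> v (GD i) \<otimes>\<^bsub>R\<^esub> v (GS i) = v (GS i) \<ominus>\<^bsub>R\<^esub> \<one>\<^bsub>R\<^esub>"
    and s_relator: "i \<in> I \<Longrightarrow> j \<in> I \<Longrightarrow> word_eval R (\<lambda>i. v (GS i)) (relator i j) = \<one>\<^bsub>R\<^esub>"
    and d_braid: "i \<in> I \<Longrightarrow> j \<in> I \<Longrightarrow> i \<noteq> j \<Longrightarrow> m i j \<noteq> 0 \<Longrightarrow>
      v (GD i) \<otimes>\<^bsub>R\<^esub> word_eval R (\<lambda>i. v (GS i)) (alt j i (m i j - 1)) =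
      word_eval R (\<lambda>i. v (GS i)) (alt j i (m i j - 1)) \<otimes>\<^bsub>R\<^esub> v (GD (if even (m i j) then i else j))"
begin

abbreviation "ev \<equiv> linear_extension R (word_eval R v)"

lemma ev_hom: "ev \<in> ring_hom F R"
  unfolding free_ring_def
  by (rule linear_extension_ring_hom[OF R.ring_axioms monoid_word_monoid word_eval_hom[OF R.monoid_axioms v_closed]])
    (simp_all add: word_monoid_def)

lemma ev_word: "w \<in> lists (gens I) \<Longrightarrow> ev (frag_of w) = word_eval R v w"
  by (rule R.linear_extension_of[where K = "lists (gens I)"]) (auto intro: R.word_eval_closed[of "gens I"] v_closed)

lemma ev_diff: "p \<in> carrier F \<Longrightarrow> q \<in> carrier F \<Longrightarrow> ev (p - q) = ev p \<ominus>\<^bsub>R\<^esub> ev q"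
  using add_hom_diff[OF F.is_abelian_group R.is_abelian_group ring_hom_add_hom[OF ev_hom], of p q]
  by (simp add: diff_F)

lemma ev_add: "p \<in> carrier F \<Longrightarrow> q \<in> carrier F \<Longrightarrow> ev (p + q) = ev p \<oplus>\<^bsub>R\<^esub> ev q"
  using ring_hom_add[OF ev_hom, of p q] by (simp add: add_F)

lemma ev_relation: 
  assumes "p \<in> hecke_relations I m"
  shows "ev p = \<zero>\<^bsub>R\<^esub>"
proof -
  have F: "frag_of w \<in> carrier F" if "w \<in> lists (gens I)" for w
    using that by (simp add: carrier_F keys_frag_of)
  have GS: "word_eval R v (map GS w) = word_eval R (\<lambda>i. v (GS i)) w" for w
    by (rule word_eval_map)
  have closed: "word_eval R (\<lambda>i. v (GS i)) w \<in> carrier R" if "w \<in> lists I" for w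
    by (rule R.word_eval_closed[of I]) (use that v_closed in auto)
  note simps = ev_diff ev_add F ev_word map_relator map_GS_in_lists alt_in_lists relator_lists closed v_closed GS
    R.word_eval_append[of "gens I" v, OF v_closed]
  have "p \<in> {frag_of [GS i, GS i] - frag_of [] | i. i \<in> I} \<Longrightarrow> ?thesis"
    by (elim CollectE exE conjE) (simp add: simps s_square)
  moreover have "p \<in> {frag_of [GD i, GD i] - frag_of [GD i] | i. i \<in> I} \<Longrightarrow> ?thesis"
    by (elim CollectE exE conjE) (simp add: simps d_square)
  moreover have "p \<in> {frag_of [GS i, GD i] + frag_of [GD i, GS i] - (frag_of [GS i] - frag_of []) | i. i \<in> I} \<Longrightarrow> ?thesis"
  proof (elim CollectE exE conjE)
    fix i assume p: "p = frag_of [GS i, GD i] + frag_of [GD i, GS i] - (frag_of [GS i] - frag_of [])" and i: "i \<in> I"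
    have "frag_of [GS i, GD i] + frag_of [GD i, GS i] \<in> carrier F" "frag_of [GS i] - frag_of [] \<in> carrier F"
      using i by (simp_all add: carrier_F keys_diff_subset keys_add_subset keys_frag_of)
    then show ?thesis using i s_d[OF i] by (simp add: p simps)
  qed
  moreover have "p \<in> {frag_of (concat (replicate (m i j) [GS i, GS j])) - frag_of [] | i j. i \<in> I \<and> j \<in> I} \<Longrightarrow> ?thesis"
    by (elim CollectE exE conjE) (simp add: simps s_relator)
  moreover have "p \<in> {frag_of (GD i # map GS (alt j i (m i j - 1))) -
     frag_of (map GS (alt j i (m i j - 1)) @ [GD (if even (m i j) then i else j)])
       | i j. i \<in> I \<and> j \<in> I \<and> i \<noteq> j \<and> m i j \<noteq> 0} \<Longrightarrow> ?thesis"
    by (elim CollectE exE conjE) (simp add: simps d_braid[unfolded One_nat_def])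
  ultimately show ?thesis using assms unfolding hecke_relations_def by blast
qed

lemma ev_ideal: "p \<in> hecke_ideal I m \<Longrightarrow> ev p = \<zero>\<^bsub>R\<^esub>"
  unfolding hecke_ideal_def
  by (rule vanish_genideal[OF F.ring_axioms R.ring_axioms ev_hom hecke_relations_subset ev_relation])

lemma induced_hom: "induced ev \<in> ring_hom H R"
  unfolding hecke_hat_def by (rule hecke_ideal.induced_ring_hom[OF R.ring_axioms ev_hom ev_ideal])

lemma induced_gen: "g \<in> gens I \<Longrightarrow> induced ev (gen_el I m g) = v g"
  using hecke_ideal.induced_coset[OF R.is_abelian_group ring_hom_add_hom[OF ev_hom] ev_ideal, of "frag_of [g]"]
  by (simp add: gen_el_def carrier_F ev_word v_closed)

end

section \<open>The image of \<open>W\<close> in \<open>hecke_hat\<close>\<close>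

context coxeter_system
begin

abbreviation "gp \<equiv> group_el I m"

lemma word_eval_ss_eq:
  assumes "coxeter_eq I m u v"
  shows "word_eval H ss u = word_eval H ss v"
proof -
  have r: "foldr (\<lambda>i y. ss i \<otimes>\<^bsub>H\<^esub> y) w y = word_eval H ss w \<otimes>\<^bsub>H\<^esub> y"
    if "w \<in> lists I" "y \<in> carrier H" for w y
    using that by (induction w) (simp_all add: H.m_assoc H.word_eval_closed[of I])
  show ?thesis unfolding word_eval_def
    by (rule coxeter_eq_foldr[OF assms, where P = "carrier H"]) (simp_all add: r relator_lists ss_relator)
qed

lemma gp_cls: 
  assumes "u \<in> lists I"
  shows "gp (cls u) = word_eval H ss u"
proof -
  have "word_eval H ss ` cls u = {word_eval H ss u}"
  proof (intro equalityI subsetI)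
    fix y assume "y \<in> word_eval H ss ` cls u"
    then show "y \<in> {word_eval H ss u}" using word_eval_ss_eq by (force simp: coxeter_class_def)
  next
    fix y assume "y \<in> {word_eval H ss u}"
    then show "y \<in> word_eval H ss ` cls u"
      using coxeter_eq.refl[OF assms] by (auto simp: coxeter_class_def)
  qed
  then show ?thesis by (simp add: group_el_def induced_def)
qed

lemma gp_closed [simp]: "w \<in> carrier W \<Longrightarrow> gp w \<in> carrier H"
  by (elim carrierE) (simp add: gp_cls H.word_eval_closed[of I])

lemma gp_mult: "v \<in> carrier W \<Longrightarrow> w \<in> carrier W \<Longrightarrow> gp (v \<otimes>\<^bsub>W\<^esub> w) = gp v \<otimes>\<^bsub>H\<^esub> gp w"
  by (elim carrierE) (simp add: gp_cls H.word_eval_append[of I] flip: cls_append)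

lemma gp_one: "gp \<one>\<^bsub>W\<^esub> = \<one>\<^bsub>H\<^esub>"
  by (simp add: one_cls gp_cls)

lemma gp_\<sigma>: "i \<in> I \<Longrightarrow> gp (\<sigma> i) = ss i"
  by (simp add: simple_refl_def gp_cls)

lemma gp_inv: "w \<in> carrier W \<Longrightarrow> gp w \<otimes>\<^bsub>H\<^esub> gp (inv\<^bsub>W\<^esub> w) = \<one>\<^bsub>H\<^esub>" "w \<in> carrier W \<Longrightarrow> gp (inv\<^bsub>W\<^esub> w) \<otimes>\<^bsub>H\<^esub> gp w = \<one>\<^bsub>H\<^esub>"
  using gp_mult[of w "inv\<^bsub>W\<^esub> w"] gp_mult[of "inv\<^bsub>W\<^esub> w" w] by (simp_all add: gp_one)

text \<open>The word in the last family of relations carries the simple root of \<open>k\<close> to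
  that of \<open>i\<close>: at length \<open>m i j - 1\<close> the divisibility in
  \<open>zigzag_conj_simple\<close> holds and the quotient in \<open>neg_zigzag\<close> is 0. The
  parity of \<open>m i j\<close> decides whether the word, which starts with \<open>j\<close>, ends
  in \<open>j\<close> or in \<open>i\<close>, hence in which order the two letters enter
  \<open>zigzag\<close>.\<close>

lemma alt_conj:
  assumes "i \<in> I" "j \<in> I" "i \<noteq> j" "m i j \<noteq> 0"
  defines "k \<equiv> if even (m i j) then i else j" and "w \<equiv> cls (alt j i (m i j - 1))"
  shows "w \<otimes>\<^bsub>W\<^esub> \<sigma> k \<otimes>\<^bsub>W\<^esub> inv\<^bsub>W\<^esub> w = \<sigma> i" "\<not> neg w (\<sigma> k)"
proof -
  have S: "Suc (m i j - 1) = m i j" using assms by simp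
  have z: "(m i j - 1) div m i j = 0" using assms by simp
  have "w \<otimes>\<^bsub>W\<^esub> \<sigma> k \<otimes>\<^bsub>W\<^esub> inv\<^bsub>W\<^esub> w = \<sigma> i \<and> \<not> neg w (\<sigma> k)"
  proof (cases "even (m i j)")
    case True
    then show ?thesis
      using zigzag_conj_simple(1)[OF assms(1-3), of "m i j - 1"] neg_zigzag[OF assms(1-3), of "m i j - 1"] S z assms(4)
      by (simp add: k_def w_def zigzag_alt)
  next
    case False
    then show ?thesis
      using zigzag_conj_simple(1)[OF assms(2,1) assms(3)[symmetric], of "m i j - 1"]
        neg_zigzag[OF assms(2,1) assms(3)[symmetric], of "m i j - 1"] S z m_sym[OF assms(1,2)] assms(4)
      by (simp add: k_def w_def zigzag_alt)
  qed
  then show "w \<otimes>\<^bsub>W\<^esub> \<sigma> k \<otimes>\<^bsub>W\<^esub> inv\<^bsub>W\<^esub> w = \<sigma> i" "\<not> neg w (\<sigma> k)" by auto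
qed

text \<open>The analogue of \<open>dd_braid\<close> for \<open>s\<close> follows from the Coxeter
  relations alone. It is needed because D_i brings factors s_i into its comultiplication and its
  antipode.\<close>

lemma ss_braid:
  assumes "i \<in> I" "j \<in> I" "i \<noteq> j" "m i j \<noteq> 0"
  shows "ss i \<otimes>\<^bsub>H\<^esub> word_eval H ss (alt j i (m i j - 1)) =
    word_eval H ss (alt j i (m i j - 1)) \<otimes>\<^bsub>H\<^esub> ss (if even (m i j) then i else j)"
proof -
  let ?w = "cls (alt j i (m i j - 1))" and ?k = "if even (m i j) then i else j"
  have w: "alt j i (m i j - 1) \<in> lists I" using assms by (intro alt_in_lists)
  have k: "?k \<in> I" using assms by simp
  have "?w \<otimes>\<^bsub>W\<^esub> \<sigma> ?k = \<sigma> i \<otimes>\<^bsub>W\<^esub> ?w"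
    using arg_cong[OF alt_conj(1)[OF assms], of "\<lambda>x. x \<otimes>\<^bsub>W\<^esub> ?w"] w k assms(1)
    by (simp only: W.m_assoc W.m_closed W.inv_closed W.l_inv W.r_one \<sigma>_closed cls_closed)
  then have "gp (\<sigma> i \<otimes>\<^bsub>W\<^esub> ?w) = gp (?w \<otimes>\<^bsub>W\<^esub> \<sigma> ?k)" by simp
  then have "gp (\<sigma> i) \<otimes>\<^bsub>H\<^esub> gp ?w = gp ?w \<otimes>\<^bsub>H\<^esub> gp (\<sigma> ?k)"
    by (simp only: gp_mult \<sigma>_closed[OF assms(1)] \<sigma>_closed[OF k] cls_closed[OF w])
  then show ?thesis by (simp only: gp_\<sigma>[OF assms(1)] gp_\<sigma>[OF k] gp_cls[OF w])
qed

end

text \<open>An antihomomorphism is a homomorphism into this ring, which makes the antipode an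
  instance of \<open>hecke_rep\<close>.\<close>

definition opposite :: "('a, 'm) ring_scheme \<Rightarrow> ('a, 'm) ring_scheme" where
  "opposite R = R\<lparr>monoid.mult := \<lambda>x y. y \<otimes>\<^bsub>R\<^esub> x\<rparr>"

lemma opposite_simps [simp]:
  "carrier (opposite R) = carrier R" "x \<otimes>\<^bsub>opposite R\<^esub> y = y \<otimes>\<^bsub>R\<^esub> x" "\<one>\<^bsub>opposite R\<^esub> = \<one>\<^bsub>R\<^esub>"
  "\<zero>\<^bsub>opposite R\<^esub> = \<zero>\<^bsub>R\<^esub>" "x \<oplus>\<^bsub>opposite R\<^esub> y = x \<oplus>\<^bsub>R\<^esub> y" "\<ominus>\<^bsub>opposite R\<^esub> x = \<ominus>\<^bsub>R\<^esub> x"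
  "x \<ominus>\<^bsub>opposite R\<^esub> y = x \<ominus>\<^bsub>R\<^esub> y"
  by (simp_all add: opposite_def a_inv_def a_minus_def)

lemma linear_extension_opposite: "linear_extension (opposite R) = linear_extension R"
  by (intro ext) (simp add: linear_extension_def finsum_def add_pow_def opposite_def)

lemma (in ring) ring_opposite: "ring (opposite R)"
proof (rule ringI)
  show "abelian_group (opposite R)"
    by (rule abelian_groupI) (auto simp: a_ac l_neg intro: bexI[of _ "\<ominus> _"])
qed (auto simp: l_distr r_distr m_assoc intro!: monoidI)

lemma (in ring) word_eval_opposite:
  assumes "\<And>x. x \<in> A \<Longrightarrow> v x \<in> carrier R" "w \<in> lists A"
  shows "word_eval (opposite R) v w = word_eval R v (rev w)"
proof -
  interpret op: ring "opposite R" by (rule ring_opposite)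
  show ?thesis using assms(2)
  proof (induction w)
    case (Cons x w)
    then have "rev w \<in> lists A" by (simp add: in_lists_conv_set)
    then show ?case using Cons by (simp add: word_eval_append[OF assms(1)] assms(1))
  qed simp
qed

section \<open>Comultiplication, counit and antipode of \<open>hecke_hat\<close>\<close>

context coxeter_system
begin

sublocale HH: ring_pair H H
  by (rule ring_pairI) (rule ring_H)+

abbreviation "comult \<equiv> hecke_comult I m"
abbreviation "counit \<equiv> hecke_counit I m"
abbreviation "antipode \<equiv> hecke_antipode I m"

definition comult_gen where
  "comult_gen g = (case g of
     GS i \<Rightarrow> tensor H H (ss i) (ss i)
   | GD i \<Rightarrow> tensor H H (dd i) \<one>\<^bsub>H\<^esub> \<oplus>\<^bsub>HH.T\<^esub> tensor H H (ss i) (dd i))"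

lemma word_eval_diagonal:
  assumes "w \<in> lists I"
  shows "word_eval HH.T (\<lambda>i. tensor H H (ss i) (ss i)) w = tensor H H (word_eval H ss w) (word_eval H ss w)"
  using assms by (induction w) (simp_all add: HH.tensor_one H.word_eval_closed[of I])

lemma comult_rep: "hecke_rep I m HH.T comult_gen"
proof (rule hecke_rep.intro[OF coxeter_system_axioms HH.tensor_ring_ring], unfold_locales)
  note [simp] = HH.T.l_distr HH.T.r_distr
  fix i assume i: "i \<in> I"
  let ?s = "ss i" and ?d = "dd i" and ?t = "tensor H H"
  have c [simp]: "?s \<in> carrier H" "?d \<in> carrier H" using i by auto
  show "comult_gen (GS i) \<otimes>\<^bsub>HH.T\<^esub> comult_gen (GS i) = \<one>\<^bsub>HH.T\<^esub>"
    using i by (simp add: comult_gen_def ss_square HH.tensor_one)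
  \<comment> \<open>The mixed relation is used in the form s D + D s + 1 = s, which avoids
    subtraction in the tensor product.\<close>
  have sd1: "?t (?s \<otimes>\<^bsub>H\<^esub> ?d) x \<oplus>\<^bsub>HH.T\<^esub> ?t (?d \<otimes>\<^bsub>H\<^esub> ?s) x \<oplus>\<^bsub>HH.T\<^esub> ?t \<one>\<^bsub>H\<^esub> x = ?t ?s x" if "x \<in> carrier H" for x
  proof -
    have "?s \<otimes>\<^bsub>H\<^esub> ?d \<oplus>\<^bsub>H\<^esub> ?d \<otimes>\<^bsub>H\<^esub> ?s \<oplus>\<^bsub>H\<^esub> \<one>\<^bsub>H\<^esub> = ?s"
      using ss_dd[OF i] by (simp add: H.minus_eq H.a_assoc H.l_neg)
    then show ?thesis using that by (simp flip: HH.tensor_add_left)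
  qed
  have sd2: "?t x (?s \<otimes>\<^bsub>H\<^esub> ?d) \<oplus>\<^bsub>HH.T\<^esub> ?t x (?d \<otimes>\<^bsub>H\<^esub> ?s) \<oplus>\<^bsub>HH.T\<^esub> ?t x \<one>\<^bsub>H\<^esub> = ?t x ?s" if "x \<in> carrier H" for x
  proof -
    have "?s \<otimes>\<^bsub>H\<^esub> ?d \<oplus>\<^bsub>H\<^esub> ?d \<otimes>\<^bsub>H\<^esub> ?s \<oplus>\<^bsub>H\<^esub> \<one>\<^bsub>H\<^esub> = ?s"
      using ss_dd[OF i] by (simp add: H.minus_eq H.a_assoc H.l_neg)
    then show ?thesis using that by (simp flip: HH.tensor_add_right)
  qed
  show "comult_gen (GD i) \<otimes>\<^bsub>HH.T\<^esub> comult_gen (GD i) = comult_gen (GD i)"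
  proof -
    have "comult_gen (GD i) \<otimes>\<^bsub>HH.T\<^esub> comult_gen (GD i) =
      ?t ?d \<one>\<^bsub>H\<^esub> \<oplus>\<^bsub>HH.T\<^esub> (?t (?s \<otimes>\<^bsub>H\<^esub> ?d) ?d \<oplus>\<^bsub>HH.T\<^esub> ?t (?d \<otimes>\<^bsub>H\<^esub> ?s) ?d \<oplus>\<^bsub>HH.T\<^esub> ?t \<one>\<^bsub>H\<^esub> ?d)"
      using i by (simp add: comult_gen_def ss_square dd_square HH.T.a_ac)
    then show ?thesis using sd1[of ?d] by (simp add: comult_gen_def)
  qed
  show "comult_gen (GS i) \<otimes>\<^bsub>HH.T\<^esub> comult_gen (GD i) \<oplus>\<^bsub>HH.T\<^esub> comult_gen (GD i) \<otimes>\<^bsub>HH.T\<^esub> comult_gen (GS i) =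
      comult_gen (GS i) \<ominus>\<^bsub>HH.T\<^esub> \<one>\<^bsub>HH.T\<^esub>"
  proof -
    let ?l = "comult_gen (GS i) \<otimes>\<^bsub>HH.T\<^esub> comult_gen (GD i) \<oplus>\<^bsub>HH.T\<^esub> comult_gen (GD i) \<otimes>\<^bsub>HH.T\<^esub> comult_gen (GS i)"
    have "?l = (?t (?s \<otimes>\<^bsub>H\<^esub> ?d) ?s \<oplus>\<^bsub>HH.T\<^esub> ?t (?d \<otimes>\<^bsub>H\<^esub> ?s) ?s) \<oplus>\<^bsub>HH.T\<^esub>
        (?t \<one>\<^bsub>H\<^esub> (?s \<otimes>\<^bsub>H\<^esub> ?d) \<oplus>\<^bsub>HH.T\<^esub> ?t \<one>\<^bsub>H\<^esub> (?d \<otimes>\<^bsub>H\<^esub> ?s))"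
      using i by (simp add: comult_gen_def ss_square HH.T.a_ac)
    \<comment> \<open>Adding 1 (x) 1 and 1 (x) s completes the two halves to the left sides of
      \<open>sd1\<close> and \<open>sd2\<close>; afterwards 1 (x) s is cancelled.\<close>
    then have "?l \<oplus>\<^bsub>HH.T\<^esub> ?t \<one>\<^bsub>H\<^esub> \<one>\<^bsub>H\<^esub> \<oplus>\<^bsub>HH.T\<^esub> ?t \<one>\<^bsub>H\<^esub> ?s =
       (?t (?s \<otimes>\<^bsub>H\<^esub> ?d) ?s \<oplus>\<^bsub>HH.T\<^esub> ?t (?d \<otimes>\<^bsub>H\<^esub> ?s) ?s \<oplus>\<^bsub>HH.T\<^esub> ?t \<one>\<^bsub>H\<^esub> ?s) \<oplus>\<^bsub>HH.T\<^esub>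
       (?t \<one>\<^bsub>H\<^esub> (?s \<otimes>\<^bsub>H\<^esub> ?d) \<oplus>\<^bsub>HH.T\<^esub> ?t \<one>\<^bsub>H\<^esub> (?d \<otimes>\<^bsub>H\<^esub> ?s) \<oplus>\<^bsub>HH.T\<^esub> ?t \<one>\<^bsub>H\<^esub> \<one>\<^bsub>H\<^esub>)"
      by (simp add: HH.T.a_ac)
    also have "\<dots> = ?t ?s ?s \<oplus>\<^bsub>HH.T\<^esub> ?t \<one>\<^bsub>H\<^esub> ?s"
      by (simp only: sd1[OF c(1)] sd2[OF H.one_closed])
    finally have "?l \<oplus>\<^bsub>HH.T\<^esub> \<one>\<^bsub>HH.T\<^esub> \<oplus>\<^bsub>HH.T\<^esub> ?t \<one>\<^bsub>H\<^esub> ?s = comult_gen (GS i) \<oplus>\<^bsub>HH.T\<^esub> ?t \<one>\<^bsub>H\<^esub> ?s"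
      by (simp add: comult_gen_def HH.tensor_one)
    moreover have lc: "?l \<in> carrier HH.T" "comult_gen (GS i) \<in> carrier HH.T"
      by (simp_all add: comult_gen_def)
    ultimately have "?l \<oplus>\<^bsub>HH.T\<^esub> \<one>\<^bsub>HH.T\<^esub> = comult_gen (GS i)"
      by (simp del: HH.T.l_distr HH.T.r_distr)
    then show ?thesis using lc by (metis HH.T.add.inv_solve_right' HH.T.minus_eq HH.T.one_closed)
  qed
next
  fix g assume "g \<in> gens I"
  then show "comult_gen g \<in> carrier HH.T" by (elim gensE) (simp_all add: comult_gen_def)
next
  fix i j assume ij: "i \<in> I" "j \<in> I"
  have *: "word_eval HH.T (\<lambda>i. comult_gen (GS i)) w = tensor H H (word_eval H ss w) (word_eval H ss w)" if "w \<in> lists I" for w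
    using word_eval_diagonal[OF that] by (simp add: comult_gen_def)
  show "word_eval HH.T (\<lambda>i. comult_gen (GS i)) (relator i j) = \<one>\<^bsub>HH.T\<^esub>"
    using ij by (simp add: * relator_lists ss_relator HH.tensor_one)
  assume ne: "i \<noteq> j" "m i j \<noteq> 0"
  let ?w = "word_eval H ss (alt j i (m i j - 1))" and ?k = "if even (m i j) then i else j"
  have w: "?w \<in> carrier H" by (rule H.word_eval_closed[of I]) (use ij in \<open>simp_all add: alt_in_lists\<close>)
  have k: "?k \<in> I" using ij by simp
  \<comment> \<open>The summand D_i (x) 1 needs the relation for D only, the summand s_i (x) D_i the
    one for s in the left factor and the one for D in the right factor.\<close>
  show "comult_gen (GD i) \<otimes>\<^bsub>HH.T\<^esub> word_eval HH.T (\<lambda>i. comult_gen (GS i)) (alt j i (m i j - 1)) =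
      word_eval HH.T (\<lambda>i. comult_gen (GS i)) (alt j i (m i j - 1)) \<otimes>\<^bsub>HH.T\<^esub> comult_gen (GD ?k)"
    unfolding comult_gen_def gen.case word_eval_diagonal[OF alt_in_lists[OF ij(2,1)]]
    using w k ij dd_braid[OF ij ne] ss_braid[OF ij ne]
    by (simp only: HH.T.l_distr HH.T.r_distr HH.tensor_closed HH.tensor_mult dd_closed ss_closed H.one_closed H.m_closed H.l_one H.r_one)
qed

lemma comult_eq: "comult = induced (linear_extension HH.T (word_eval HH.T comult_gen))"
  by (simp add: hecke_comult_def Let_def comult_gen_def[abs_def])

lemma comult_hom: "comult \<in> ring_hom H HH.T"
  unfolding comult_eq by (rule hecke_rep.induced_hom[OF comult_rep])

lemma comult_ss: "i \<in> I \<Longrightarrow> comult (ss i) = tensor H H (ss i) (ss i)"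
  and comult_dd: "i \<in> I \<Longrightarrow> comult (dd i) = tensor H H (dd i) \<one>\<^bsub>H\<^esub> \<oplus>\<^bsub>HH.T\<^esub> tensor H H (ss i) (dd i)"
  unfolding comult_eq by (simp_all add: hecke_rep.induced_gen[OF comult_rep]) (simp_all add: comult_gen_def)

definition counit_gen :: "'i gen \<Rightarrow> int" where
  "counit_gen g = (case g of GS i \<Rightarrow> 1 | GD i \<Rightarrow> 0)"

lemma counit_rep: "hecke_rep I m \<Z> counit_gen"
proof -
  have "word_eval \<Z> (\<lambda>i. 1 :: int) w = 1" for w :: "'i list"
    by (induction w) (simp_all add: word_eval_def)
  then show ?thesis
    by (intro hecke_rep.intro[OF coxeter_system_axioms int.ring_axioms], unfold_locales)
      (auto simp: counit_gen_def a_minus_def int_a_inv_eq)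
qed

lemma counit_eq: "counit = induced (linear_extension \<Z> (word_eval \<Z> counit_gen))"
  by (simp add: hecke_counit_def counit_gen_def[abs_def])

lemma counit_hom: "counit \<in> ring_hom H \<Z>"
  unfolding counit_eq by (rule hecke_rep.induced_hom[OF counit_rep])

lemma counit_ss: "i \<in> I \<Longrightarrow> counit (ss i) = 1"
  and counit_dd: "i \<in> I \<Longrightarrow> counit (dd i) = 0"
  unfolding counit_eq by (simp_all add: hecke_rep.induced_gen[OF counit_rep]) (simp_all add: counit_gen_def)

definition antipode_gen where
  "antipode_gen g = (case g of GS i \<Rightarrow> ss i | GD i \<Rightarrow> \<ominus>\<^bsub>H\<^esub> (ss i \<otimes>\<^bsub>H\<^esub> dd i))"

lemma antipode_gen_closed: "g \<in> gens I \<Longrightarrow> antipode_gen g \<in> carrier H"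
  by (elim gensE) (simp_all add: antipode_gen_def)

lemma ss_cancel: "i \<in> I \<Longrightarrow> x \<in> carrier H \<Longrightarrow> ss i \<otimes>\<^bsub>H\<^esub> (ss i \<otimes>\<^bsub>H\<^esub> x) = x"
  by (simp add: ss_square flip: H.m_assoc)

lemma word_eval_rev_inverse:
  assumes "w \<in> lists I"
  shows "word_eval H ss (rev w) \<otimes>\<^bsub>H\<^esub> word_eval H ss w = \<one>\<^bsub>H\<^esub>"
  using gp_inv(2)[of "cls w"] assms by (simp add: inv_cls gp_cls)

lemma H_solve:
  assumes "a \<in> carrier H" "b \<in> carrier H" "c \<in> carrier H" "a \<oplus>\<^bsub>H\<^esub> b = c"
  shows "b = c \<ominus>\<^bsub>H\<^esub> a"
  unfolding assms(4)[symmetric] using assms(1,2)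
  by (simp add: H.minus_eq H.a_comm[of a b] H.a_assoc H.r_neg)

lemma antipode_rep: "hecke_rep I m (opposite H) antipode_gen"
proof (rule hecke_rep.intro[OF coxeter_system_axioms H.ring_opposite], unfold_locales)
  interpret op: ring "opposite H" by (rule H.ring_opposite)
  fix i assume i: "i \<in> I"
  let ?s = "ss i" and ?d = "dd i"
  have c [simp]: "?s \<in> carrier H" "?d \<in> carrier H" using i by auto
  show "antipode_gen (GS i) \<otimes>\<^bsub>opposite H\<^esub> antipode_gen (GS i) = \<one>\<^bsub>opposite H\<^esub>"
    using i by (simp add: antipode_gen_def ss_square)
  have ds: "?d \<otimes>\<^bsub>H\<^esub> ?s = ?s \<ominus>\<^bsub>H\<^esub> \<one>\<^bsub>H\<^esub> \<ominus>\<^bsub>H\<^esub> ?s \<otimes>\<^bsub>H\<^esub> ?d"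
    by (rule H_solve) (use ss_dd[OF i] in simp_all)
  \<comment> \<open>Both the idempotency and the mixed relation for the antipode reduce to s D s = 1
    - s - D.\<close>
  have sds: "?s \<otimes>\<^bsub>H\<^esub> (?d \<otimes>\<^bsub>H\<^esub> ?s) = \<one>\<^bsub>H\<^esub> \<ominus>\<^bsub>H\<^esub> ?s \<ominus>\<^bsub>H\<^esub> ?d"
    unfolding ds using i by (simp add: H.minus_eq H.r_distr H.r_minus ss_square ss_cancel)
  show "antipode_gen (GD i) \<otimes>\<^bsub>opposite H\<^esub> antipode_gen (GD i) = antipode_gen (GD i)"
  proof -
    have "(?s \<otimes>\<^bsub>H\<^esub> ?d) \<otimes>\<^bsub>H\<^esub> (?s \<otimes>\<^bsub>H\<^esub> ?d) = (?s \<otimes>\<^bsub>H\<^esub> (?d \<otimes>\<^bsub>H\<^esub> ?s)) \<otimes>\<^bsub>H\<^esub> ?d" by (simp add: H.m_assoc)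
    also have "\<dots> = ?d \<oplus>\<^bsub>H\<^esub> (\<ominus>\<^bsub>H\<^esub> (?s \<otimes>\<^bsub>H\<^esub> ?d) \<oplus>\<^bsub>H\<^esub> \<ominus>\<^bsub>H\<^esub> ?d)"
      unfolding sds using i by (simp add: H.minus_eq H.l_distr H.l_minus dd_square H.a_assoc)
    also have "\<dots> = \<ominus>\<^bsub>H\<^esub> (?s \<otimes>\<^bsub>H\<^esub> ?d)" by (simp add: H.a_ac H.r_neg2 H.r_neg)
    finally show ?thesis by (simp add: antipode_gen_def H.l_minus H.r_minus)
  qed
  show "antipode_gen (GS i) \<otimes>\<^bsub>opposite H\<^esub> antipode_gen (GD i) \<oplus>\<^bsub>opposite H\<^esub>
      antipode_gen (GD i) \<otimes>\<^bsub>opposite H\<^esub> antipode_gen (GS i) = antipode_gen (GS i) \<ominus>\<^bsub>opposite H\<^esub> \<one>\<^bsub>opposite H\<^esub>"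
  proof -
    have "\<ominus>\<^bsub>H\<^esub> (?s \<otimes>\<^bsub>H\<^esub> (?d \<otimes>\<^bsub>H\<^esub> ?s)) \<oplus>\<^bsub>H\<^esub> \<ominus>\<^bsub>H\<^esub> ?d = (?s \<oplus>\<^bsub>H\<^esub> \<ominus>\<^bsub>H\<^esub> \<one>\<^bsub>H\<^esub>) \<oplus>\<^bsub>H\<^esub> (?d \<oplus>\<^bsub>H\<^esub> \<ominus>\<^bsub>H\<^esub> ?d)"
      unfolding sds by (simp add: H.minus_eq H.minus_add H.a_ac del: H.r_neg)
    also have "\<dots> = ?s \<ominus>\<^bsub>H\<^esub> \<one>\<^bsub>H\<^esub>" by (simp add: H.minus_eq H.r_neg)
    finally show ?thesis
      using i by (simp add: antipode_gen_def H.l_minus H.r_minus ss_cancel H.m_assoc)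
  qed
next
  fix g assume "g \<in> gens I"
  then show "antipode_gen g \<in> carrier (opposite H)" by (simp add: antipode_gen_closed)
next
  fix i j assume ij: "i \<in> I" "j \<in> I"
  have *: "word_eval (opposite H) (\<lambda>i. antipode_gen (GS i)) w = word_eval H ss (rev w)" if "w \<in> lists I" for w
    using that by (subst H.word_eval_opposite[of I]) (simp_all add: antipode_gen_def)
  have "word_eval H ss (rev (relator i j)) = \<one>\<^bsub>H\<^esub>"
    using word_eval_rev_inverse[of "relator i j"] ij relator_lists[OF ij, of "m i j"]
    by (simp add: ss_relator H.word_eval_closed[of I])
  then show "word_eval (opposite H) (\<lambda>i. antipode_gen (GS i)) (relator i j) = \<one>\<^bsub>opposite H\<^esub>"
    using ij by (simp add: * relator_lists)
  assume ne: "i \<noteq> j" "m i j \<noteq> 0"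
  let ?a = "alt j i (m i j - 1)" and ?k = "if even (m i j) then i else j"
  let ?w = "word_eval H ss ?a" and ?w' = "word_eval H ss (rev ?a)"
  have a: "?a \<in> lists I" using ij by (intro alt_in_lists)
  have w: "?w \<in> carrier H" "?w' \<in> carrier H" using a by (auto intro!: H.word_eval_closed[of I] simp del: in_lists_conv_set)
  have k: "?k \<in> I" using ij by simp
  have inv: "?w' \<otimes>\<^bsub>H\<^esub> ?w = \<one>\<^bsub>H\<^esub>" "?w \<otimes>\<^bsub>H\<^esub> ?w' = \<one>\<^bsub>H\<^esub>"
    using word_eval_rev_inverse[of ?a] word_eval_rev_inverse[of "rev ?a"] a by simp_all
  \<comment> \<open>In the opposite ring the word is evaluated in reverse, which gives the inverse
    of the original element; so commutation rules with the word have to be rewritten for its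
    inverse.\<close>
  have flip: "?w' \<otimes>\<^bsub>H\<^esub> x = y \<otimes>\<^bsub>H\<^esub> ?w'" if "x \<otimes>\<^bsub>H\<^esub> ?w = ?w \<otimes>\<^bsub>H\<^esub> y" "x \<in> carrier H" "y \<in> carrier H" for x y
  proof -
    have "?w' \<otimes>\<^bsub>H\<^esub> x = ?w' \<otimes>\<^bsub>H\<^esub> (x \<otimes>\<^bsub>H\<^esub> (?w \<otimes>\<^bsub>H\<^esub> ?w'))" using w that(2) inv by simp
    also have "\<dots> = ?w' \<otimes>\<^bsub>H\<^esub> (x \<otimes>\<^bsub>H\<^esub> ?w) \<otimes>\<^bsub>H\<^esub> ?w'" using w that(2) by (simp only: H.m_assoc H.m_closed)
    also have "\<dots> = (?w' \<otimes>\<^bsub>H\<^esub> ?w) \<otimes>\<^bsub>H\<^esub> y \<otimes>\<^bsub>H\<^esub> ?w'" unfolding that(1) using w that by (simp only: H.m_assoc H.m_closed)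
    finally show ?thesis using inv w that by simp
  qed
  note cl = w ss_closed[OF ij(1)] dd_closed[OF ij(1)] ss_closed[OF k] dd_closed[OF k]
  have "?w' \<otimes>\<^bsub>H\<^esub> (ss i \<otimes>\<^bsub>H\<^esub> dd i) = (?w' \<otimes>\<^bsub>H\<^esub> ss i) \<otimes>\<^bsub>H\<^esub> dd i"
    by (simp only: H.m_assoc cl)
  also have "\<dots> = ss ?k \<otimes>\<^bsub>H\<^esub> (?w' \<otimes>\<^bsub>H\<^esub> dd i)"
    by (simp only: flip[OF ss_braid[OF ij ne] cl(3,5)] H.m_assoc cl)
  also have "\<dots> = ss ?k \<otimes>\<^bsub>H\<^esub> dd ?k \<otimes>\<^bsub>H\<^esub> ?w'"
    by (simp only: flip[OF dd_braid[OF ij ne] cl(4,6)] H.m_assoc cl)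
  finally have "?w' \<otimes>\<^bsub>H\<^esub> (ss i \<otimes>\<^bsub>H\<^esub> dd i) = ss ?k \<otimes>\<^bsub>H\<^esub> dd ?k \<otimes>\<^bsub>H\<^esub> ?w'" .
  then show "antipode_gen (GD i) \<otimes>\<^bsub>opposite H\<^esub> word_eval (opposite H) (\<lambda>i. antipode_gen (GS i)) ?a =
      word_eval (opposite H) (\<lambda>i. antipode_gen (GS i)) ?a \<otimes>\<^bsub>opposite H\<^esub> antipode_gen (GD ?k)"
    unfolding *[OF a] opposite_simps unfolding antipode_gen_def gen.case
    using w k ij by (simp only: H.l_minus H.r_minus H.m_closed dd_closed ss_closed)
qed

text \<open>\<open>hecke_antipode\<close> is defined by reversing words, which on words in the
  generators is evaluation in the opposite ring. Both induced maps inspect the elements of the coset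
  \<open>x\<close>, and all of these lie in the free ring.\<close>

lemma antipode_eq: 
  assumes "x \<in> carrier H"
  shows "antipode x = induced (linear_extension (opposite H) (word_eval (opposite H) antipode_gen)) x"
proof -
  have "linear_extension H (\<lambda>w. word_eval H antipode_gen (rev w)) p = linear_extension H (word_eval (opposite H) antipode_gen) p"
    if "p \<in> carrier F" for p
    unfolding linear_extension_def
  proof (rule H.finsum_cong'[OF HOL.refl])
    have k: "k \<in> lists (gens I)" "rev k \<in> lists (gens I)" if "k \<in> Poly_Mapping.keys p" for k
      using that \<open>p \<in> carrier F\<close> by (auto simp: carrier_F simp del: in_lists_conv_set)
    show "(\<lambda>k. [Poly_Mapping.lookup p k] \<cdot>\<^bsub>H\<^esub> word_eval (opposite H) antipode_gen k) \<in> Poly_Mapping.keys p \<rightarrow> carrier H"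
      by (intro Pi_I H.add.int_pow_closed)
        (simp add: k H.word_eval_opposite[OF antipode_gen_closed] H.word_eval_closed[OF antipode_gen_closed])
    show "[Poly_Mapping.lookup p i] \<cdot>\<^bsub>H\<^esub> word_eval H antipode_gen (rev i) =
        [Poly_Mapping.lookup p i] \<cdot>\<^bsub>H\<^esub> word_eval (opposite H) antipode_gen i"
      if "i \<in> Poly_Mapping.keys p" for i
      using that by (simp add: k H.word_eval_opposite[OF antipode_gen_closed])
  qed
  moreover have "x \<subseteq> carrier F"
    using assms hecke_ideal.a_rcosets_carrier by (auto simp: hecke_hat_def FactRing_def)
  ultimately show ?thesis
    unfolding hecke_antipode_def Let_def induced_def linear_extension_opposite antipode_gen_def[symmetric, abs_def]
    by (intro arg_cong[of _ _ the_elem] image_cong) auto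
qed

lemma antipode_hom_opposite: "antipode \<in> ring_hom H (opposite H)"
  using hecke_rep.induced_hom[OF antipode_rep] by (simp add: ring_hom_def Pi_iff antipode_eq)

lemma antipode_ss: "i \<in> I \<Longrightarrow> antipode (ss i) = ss i"
  and antipode_dd: "i \<in> I \<Longrightarrow> antipode (dd i) = \<ominus>\<^bsub>H\<^esub> (ss i \<otimes>\<^bsub>H\<^esub> dd i)"
  by (simp_all add: antipode_eq hecke_rep.induced_gen[OF antipode_rep]) (simp_all add: antipode_gen_def)

lemma antipode_closed [simp]: "x \<in> carrier H \<Longrightarrow> antipode x \<in> carrier H"
  and antipode_mult: "x \<in> carrier H \<Longrightarrow> y \<in> carrier H \<Longrightarrow> antipode (x \<otimes>\<^bsub>H\<^esub> y) = antipode y \<otimes>\<^bsub>H\<^esub> antipode x"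
  and antipode_one: "antipode \<one>\<^bsub>H\<^esub> = \<one>\<^bsub>H\<^esub>"
  using ring_hom_closed[OF antipode_hom_opposite] ring_hom_mult[OF antipode_hom_opposite] ring_hom_one[OF antipode_hom_opposite]
  by simp_all

lemma antipode_add_hom: "antipode \<in> add_hom H H"
  by (rule add_homI) (use ring_hom_add[OF antipode_hom_opposite] in simp_all)

section \<open>The Hopf algebra axioms for \<open>hecke_hat\<close>\<close>

sublocale HHH: ring_pair HH.T H
  by (rule ring_pairI) (rule HH.tensor_ring_ring ring_H)+

sublocale HHH': ring_pair H HH.T
  by (rule ring_pairI) (rule HH.tensor_ring_ring ring_H)+

lemmas comult_add_hom = ring_hom_add_hom[OF comult_hom]
lemmas counit_add_hom = ring_hom_add_hom[OF counit_hom]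

lemma id_ring_hom: "id \<in> ring_hom R R"
  by (simp add: ring_hom_def)

text \<open>Both sides are ring homomorphisms in \<open>x\<close>, so the generators
  suffice.\<close>

lemma coassociative:
  assumes "x \<in> carrier H"
  shows "tensor_assoc H H H (tensor_map HH.T H comult id (comult x)) = tensor_map H HH.T id comult (comult x)"
proof (rule hecke_hom_eqI[OF HHH'.tensor_ring_ring _ _ _ assms])
  note l = HH.tensor_map_ring_hom[OF HHH.ring_pair_axioms comult_hom id_ring_hom]
  note r = HH.tensor_map_ring_hom[OF HHH'.ring_pair_axioms id_ring_hom comult_hom]
  note a = tensor_assoc_ring_hom[OF ring_H ring_H ring_H]
  show "(\<lambda>x. tensor_assoc H H H (tensor_map HH.T H comult id (comult x))) \<in> ring_hom H HHH'.T"
    by (rule ring_hom_comp[OF ring_hom_comp[OF comult_hom l] a])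
  show "(\<lambda>x. tensor_map H HH.T id comult (comult x)) \<in> ring_hom H HHH'.T"
    by (rule ring_hom_comp[OF comult_hom r])
  note lt = HH.tensor_map_tensor[OF HHH.ring_pair_axioms comult_add_hom add_hom_id]
  note rt = HH.tensor_map_tensor[OF HHH'.ring_pair_axioms add_hom_id comult_add_hom]
  note at = tensor_assoc_tensor[OF ring_H ring_H ring_H]
  note adds = ring_hom_add[OF l] ring_hom_add[OF r] ring_hom_add[OF a]
  have one: "comult \<one>\<^bsub>H\<^esub> = tensor H H \<one>\<^bsub>H\<^esub> \<one>\<^bsub>H\<^esub>"
    using ring_hom_one[OF comult_hom] by (simp add: HH.tensor_one)
  fix g assume "g \<in> gens I"
  then show "tensor_assoc H H H (tensor_map HH.T H comult id (comult (gen_el I m g))) =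
    tensor_map H HH.T id comult (comult (gen_el I m g))"
    by (elim gensE)
      (simp_all add: comult_ss comult_dd lt rt at adds one HHH.tensor_add_left HHH'.tensor_add_right HHH'.T.a_assoc)
qed

lemma int_mult_ring_hom:
  assumes \<epsilon>: "f \<in> ring_hom H \<Z>"
  shows "tensor_lift H (\<lambda>a b. [f a] \<cdot>\<^bsub>H\<^esub> b) \<in> ring_hom HH.T H" "tensor_lift H (\<lambda>a b. [f b] \<cdot>\<^bsub>H\<^esub> a) \<in> ring_hom HH.T H"
proof -
  have scale: "[(k * l)] \<cdot>\<^bsub>H\<^esub> (a \<otimes>\<^bsub>H\<^esub> b) = [k] \<cdot>\<^bsub>H\<^esub> a \<otimes>\<^bsub>H\<^esub> [l] \<cdot>\<^bsub>H\<^esub> b"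
    if "a \<in> carrier H" "b \<in> carrier H" for a b and k l :: int
    using that by (simp add: H.add_pow_ldistr_int H.add_pow_rdistr_int H.add.int_pow_pow H.add.int_pow_closed mult.commute)
  have "f \<one>\<^bsub>H\<^esub> = 1" "f (a \<otimes>\<^bsub>H\<^esub> b) = f a * f b" if "a \<in> carrier H" "b \<in> carrier H" for a b
    using ring_hom_one[OF \<epsilon>] ring_hom_mult[OF \<epsilon> that] by simp_all
  note f = this(1)[OF H.one_closed H.one_closed] this(2)
  show "tensor_lift H (\<lambda>a b. [f a] \<cdot>\<^bsub>H\<^esub> b) \<in> ring_hom HH.T H"
    by (rule HH.tensor_lift_ring_hom[OF ring_H biadditive_scale(1)[OF ring_H ring_hom_add_hom[OF \<epsilon>]]])
      (simp_all add: f scale)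
  show "tensor_lift H (\<lambda>a b. [f b] \<cdot>\<^bsub>H\<^esub> a) \<in> ring_hom HH.T H"
    by (rule HH.tensor_lift_ring_hom[OF ring_H biadditive_scale(2)[OF ring_H ring_hom_add_hom[OF \<epsilon>]]])
      (simp_all add: f scale)
qed

lemma zero_scale: "z = (0 :: int) \<Longrightarrow> [z] \<cdot>\<^bsub>H\<^esub> x = \<zero>\<^bsub>H\<^esub>"
  by (simp add: add_pow_def)

lemma counital:
  assumes "x \<in> carrier H"
  shows "tensor_lift H (\<lambda>a b. [counit a] \<cdot>\<^bsub>H\<^esub> b) (comult x) = x" "tensor_lift H (\<lambda>a b. [counit b] \<cdot>\<^bsub>H\<^esub> a) (comult x) = x"
proof -
  note h = int_mult_ring_hom[OF counit_hom]
  note v = HH.tensor_lift_tensor[OF ring_H biadditive_scale(1)[OF ring_H counit_add_hom]]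
    HH.tensor_lift_tensor[OF ring_H biadditive_scale(2)[OF ring_H counit_add_hom]]
  have one: "counit \<one>\<^bsub>H\<^esub> = 1" using ring_hom_one[OF counit_hom] by simp
  have id: "(\<lambda>x. x) \<in> ring_hom H H" by (simp add: ring_hom_def)
  show "tensor_lift H (\<lambda>a b. [counit a] \<cdot>\<^bsub>H\<^esub> b) (comult x) = x"
  proof (rule hecke_hom_eqI[OF ring_H ring_hom_comp[OF comult_hom h(1)] id _ assms])
    fix g assume "g \<in> gens I"
    then show "tensor_lift H (\<lambda>a b. [counit a] \<cdot>\<^bsub>H\<^esub> b) (comult (gen_el I m g)) = gen_el I m g"
      by (elim gensE) (simp_all add: comult_ss comult_dd ring_hom_add[OF h(1)] v counit_ss counit_dd one zero_scale)
  qed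
  show "tensor_lift H (\<lambda>a b. [counit b] \<cdot>\<^bsub>H\<^esub> a) (comult x) = x"
  proof (rule hecke_hom_eqI[OF ring_H ring_hom_comp[OF comult_hom h(2)] id _ assms])
    fix g assume "g \<in> gens I"
    then show "tensor_lift H (\<lambda>a b. [counit b] \<cdot>\<^bsub>H\<^esub> a) (comult (gen_el I m g)) = gen_el I m g"
      by (elim gensE) (simp_all add: comult_ss comult_dd ring_hom_add[OF h(2)] v counit_ss counit_dd one zero_scale)
  qed
qed

lemma biadditive_antipode:
  "biadditive H H H (\<lambda>a b. antipode a \<otimes>\<^bsub>H\<^esub> b)" "biadditive H H H (\<lambda>a b. a \<otimes>\<^bsub>H\<^esub> antipode b)"
  by (rule biadditiveI; simp add: add_hom_add[OF antipode_add_hom] H.l_distr H.r_distr)+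

lemma mult_add_hom:
  assumes "ring R" "a \<in> carrier R"
  shows "(\<lambda>x. a \<otimes>\<^bsub>R\<^esub> x) \<in> add_hom R R" "(\<lambda>x. x \<otimes>\<^bsub>R\<^esub> a) \<in> add_hom R R"
  using assms by (auto intro!: add_homI simp: ring.ring_simprules)

text \<open>The two convolutions are not multiplicative, so the proof is an induction on left
  multiplication by a generator. For an arbitrary tensor in place of \<open>comult x\<close>, the
  value after multiplication by the comultiplication of the generator is expressed through the value
  before; such formulas are additive and hence checked on pure tensors.\<close>

lemma antipode_convolution:
  assumes x: "x \<in> carrier H"
  shows "tensor_lift H (\<lambda>a b. antipode a \<otimes>\<^bsub>H\<^esub> b) (comult x) = [counit x] \<cdot>\<^bsub>H\<^esub> \<one>\<^bsub>H\<^esub> \<and>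
    tensor_lift H (\<lambda>a b. a \<otimes>\<^bsub>H\<^esub> antipode b) (comult x) = [counit x] \<cdot>\<^bsub>H\<^esub> \<one>\<^bsub>H\<^esub>"
proof -
  let ?l = "tensor_lift H (\<lambda>a b. antipode a \<otimes>\<^bsub>H\<^esub> b)" and ?r = "tensor_lift H (\<lambda>a b. a \<otimes>\<^bsub>H\<^esub> antipode b)"
  note la = HH.tensor_lift_add_hom[OF ring_H biadditive_antipode(1)]
  note ra = HH.tensor_lift_add_hom[OF ring_H biadditive_antipode(2)]
  note lv = HH.tensor_lift_tensor[OF ring_H biadditive_antipode(1)]
  note rv = HH.tensor_lift_tensor[OF ring_H biadditive_antipode(2)]
  note ag = H.is_abelian_group
  note cc = ring_hom_closed[OF comult_hom]
  note mh = mult_add_hom[OF HH.tensor_ring_ring] and mH = mult_add_hom[OF ring_H]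
  have one: "comult \<one>\<^bsub>H\<^esub> = tensor H H \<one>\<^bsub>H\<^esub> \<one>\<^bsub>H\<^esub>"
    using ring_hom_one[OF comult_hom] by (simp add: HH.tensor_one)
  have scale: "a \<otimes>\<^bsub>H\<^esub> [k] \<cdot>\<^bsub>H\<^esub> b = [k] \<cdot>\<^bsub>H\<^esub> (a \<otimes>\<^bsub>H\<^esub> b)" if "a \<in> carrier H" "b \<in> carrier H" for a b and k :: int
    using that by (rule H.add_pow_rdistr_int)
  have scale': "[k] \<cdot>\<^bsub>H\<^esub> b \<otimes>\<^bsub>H\<^esub> a = [k] \<cdot>\<^bsub>H\<^esub> (b \<otimes>\<^bsub>H\<^esub> a)" if "a \<in> carrier H" "b \<in> carrier H" for a b and k :: int
    by (rule H.add_pow_ldistr_int[OF that(2,1)])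
  show ?thesis using x
  proof (induction x rule: hecke_induct)
    case one
    then show ?case
      using ring_hom_one[OF counit_hom] by (simp add: \<open>comult \<one>\<^bsub>H\<^esub> = _\<close> lv rv antipode_one)
  next
    case (diff x y)
    have eps: "counit (x \<ominus>\<^bsub>H\<^esub> y) = counit x - counit y"
      using add_hom_diff[OF ag int.is_abelian_group counit_add_hom diff(1,2)] by (simp add: a_minus_def int_a_inv_eq)
    have "[(k - l)] \<cdot>\<^bsub>H\<^esub> \<one>\<^bsub>H\<^esub> = [k] \<cdot>\<^bsub>H\<^esub> \<one>\<^bsub>H\<^esub> \<ominus>\<^bsub>H\<^esub> [l] \<cdot>\<^bsub>H\<^esub> \<one>\<^bsub>H\<^esub>" for k l :: int
      using H.add.int_pow_diff[of "\<one>\<^bsub>H\<^esub>" k l] by (simp add: a_minus_def a_inv_def)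
    then show ?case
      using diff by (simp add: eps add_hom_diff[OF ag HH.T.is_abelian_group comult_add_hom] cc
        add_hom_diff[OF HH.T.is_abelian_group ag la] add_hom_diff[OF HH.T.is_abelian_group ag ra])
  next
    case (gen g x)
    have mult: "comult (gen_el I m g \<otimes>\<^bsub>H\<^esub> x) = comult (gen_el I m g) \<otimes>\<^bsub>HH.T\<^esub> comult x"
      "counit (gen_el I m g \<otimes>\<^bsub>H\<^esub> x) = counit (gen_el I m g) * counit x"
      using gen ring_hom_mult[OF comult_hom] ring_hom_mult[OF counit_hom] by simp_all
    from gen(1) show ?case
    proof (elim gensE)
      fix i assume i: "i \<in> I" and g: "g = GS i"
      let ?t = "tensor H H (ss i) (ss i)"
      have t: "?t \<in> carrier HH.T" using i by simp
      have "?l (?t \<otimes>\<^bsub>HH.T\<^esub> comult x) = ?l (comult x)"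
        by (rule HH.add_hom_eqI[OF ag add_hom_comp[OF mh(1)[OF t] la] la _ cc[OF gen(2)]])
          (use i in \<open>simp add: lv antipode_mult antipode_ss H.m_assoc ss_cancel\<close>)
      moreover have "?r (?t \<otimes>\<^bsub>HH.T\<^esub> comult x) = ss i \<otimes>\<^bsub>H\<^esub> (?r (comult x) \<otimes>\<^bsub>H\<^esub> ss i)"
        by (rule HH.add_hom_eqI[OF ag add_hom_comp[OF mh(1)[OF t] ra]
              add_hom_comp[OF ra add_hom_comp[OF mH(2)[of "ss i"] mH(1)[of "ss i"]]] _ cc[OF gen(2)]])
          (use i in \<open>simp_all add: rv antipode_mult antipode_ss H.m_assoc\<close>)
      ultimately show ?thesis unfolding mult unfolding g using i gen
        by (simp add: comult_ss counit_ss scale scale' ss_square)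
    next
      fix i assume i: "i \<in> I" and g: "g = GD i"
      let ?t = "tensor H H (dd i) \<one>\<^bsub>H\<^esub> \<oplus>\<^bsub>HH.T\<^esub> tensor H H (ss i) (dd i)"
      have t: "?t \<in> carrier HH.T" using i by simp
      have z: "(\<lambda>_. \<zero>\<^bsub>H\<^esub>) \<in> add_hom HH.T H" by (rule add_homI) simp_all
      \<comment> \<open>At a (x) b the terms are S(a) S(D_i) b and S(a) s_i D_i b, which cancel as
        S(D_i) = - s_i D_i.\<close>
      have "?l (?t \<otimes>\<^bsub>HH.T\<^esub> comult x) = \<zero>\<^bsub>H\<^esub>"
        by (rule HH.add_hom_eqI[OF ag add_hom_comp[OF mh(1)[OF t] la] z _ cc[OF gen(2)]])
          (use i in \<open>simp add: HH.T.l_distr lv add_hom_add[OF la] antipode_mult antipode_ss antipode_dd H.m_assoc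
            H.l_minus H.r_minus H.l_neg\<close>)
      \<comment> \<open>For the scalar supplied by the induction hypothesis the right side is a
        multiple of D_i - s_i s_i D_i, which is 0.\<close>
      moreover have "?r (?t \<otimes>\<^bsub>HH.T\<^esub> comult x) =
          (\<lambda>y. dd i \<otimes>\<^bsub>H\<^esub> y \<oplus>\<^bsub>H\<^esub> ss i \<otimes>\<^bsub>H\<^esub> (y \<otimes>\<^bsub>H\<^esub> antipode (dd i))) (?r (comult x))"
        by (rule HH.add_hom_eqI[OF ag add_hom_comp[OF mh(1)[OF t] ra] add_hom_comp[OF ra add_homI] _ cc[OF gen(2)]])
          (use i in \<open>simp_all add: HH.T.l_distr rv add_hom_add[OF ra] antipode_mult H.m_assoc H.l_distr H.r_distr H.a_ac\<close>)
      ultimately show ?thesis unfolding mult unfolding g using i gen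
        by (simp add: comult_dd counit_dd scale scale' antipode_dd H.r_minus ss_cancel H.r_neg zero_scale flip: H.add.int_pow_distrib)
    qed
  qed
qed

lemma hopf_algebra_hecke: "hopf_algebra H comult counit antipode"
  by unfold_locales
    (use comult_hom counit_hom antipode_add_hom coassociative counital antipode_convolution in auto)

end

section \<open>The elements \<open>D_s\<close>\<close>

context coxeter_system
begin

abbreviation "refls \<equiv> reflections I m"
abbreviation "DR \<equiv> D_refl I m"

lemma gp_transport_dd:
  assumes "w \<in> carrier W" "i \<in> I" "j \<in> I" "\<not> neg w (\<sigma> i)" "w \<otimes>\<^bsub>W\<^esub> \<sigma> i \<otimes>\<^bsub>W\<^esub> inv\<^bsub>W\<^esub> w = \<sigma> j"
  shows "gp w \<otimes>\<^bsub>H\<^esub> dd i = dd j \<otimes>\<^bsub>H\<^esub> gp w"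
  using assms
proof (induction rule: simple_root_transport_induct)
  case (one i)
  then show ?case by (simp add: gp_one)
next
  case (mult a b i j k)
  have "gp (a \<otimes>\<^bsub>W\<^esub> b) \<otimes>\<^bsub>H\<^esub> dd i = gp a \<otimes>\<^bsub>H\<^esub> (dd k \<otimes>\<^bsub>H\<^esub> gp b)"
    using mult by (simp add: gp_mult H.m_assoc)
  also have "\<dots> = (gp a \<otimes>\<^bsub>H\<^esub> dd k) \<otimes>\<^bsub>H\<^esub> gp b" using mult(1-5) by (simp add: H.m_assoc)
  also have "\<dots> = (dd j \<otimes>\<^bsub>H\<^esub> gp a) \<otimes>\<^bsub>H\<^esub> gp b" using mult by simp
  also have "\<dots> = dd j \<otimes>\<^bsub>H\<^esub> gp (a \<otimes>\<^bsub>W\<^esub> b)"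
    using mult(1-5) by (simp add: gp_mult H.m_assoc)
  finally show ?case .
next
  case (dihedral i j)
  then show ?case using dd_braid[OF dihedral] by (simp add: gp_cls alt_in_lists)
qed

text \<open>The element \<open>?u\<close> carries the simple root of \<open>i\<close> to that of
  \<open>j\<close>, so \<open>gp_transport_dd\<close> applies to it. Its positivity comes from the
  cocycle rule, applied also to the product of \<open>inv v\<close> and \<open>v\<close>, which is
  1.\<close>

lemma gp_conj_dd_unique:
  assumes w: "w \<in> carrier W" "i \<in> I" "\<not> neg w (\<sigma> i)" and v: "v \<in> carrier W" "j \<in> I" "\<not> neg v (\<sigma> j)"
    and eq: "w \<otimes>\<^bsub>W\<^esub> \<sigma> i \<otimes>\<^bsub>W\<^esub> inv\<^bsub>W\<^esub> w = v \<otimes>\<^bsub>W\<^esub> \<sigma> j \<otimes>\<^bsub>W\<^esub> inv\<^bsub>W\<^esub> v"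
  shows "gp w \<otimes>\<^bsub>H\<^esub> dd i \<otimes>\<^bsub>H\<^esub> gp (inv\<^bsub>W\<^esub> w) = gp v \<otimes>\<^bsub>H\<^esub> dd j \<otimes>\<^bsub>H\<^esub> gp (inv\<^bsub>W\<^esub> v)"
proof -
  let ?u = "inv\<^bsub>W\<^esub> v \<otimes>\<^bsub>W\<^esub> w"
  have u: "?u \<in> carrier W" using w v by simp
  have "?u \<otimes>\<^bsub>W\<^esub> \<sigma> i \<otimes>\<^bsub>W\<^esub> inv\<^bsub>W\<^esub> ?u = inv\<^bsub>W\<^esub> v \<otimes>\<^bsub>W\<^esub> (w \<otimes>\<^bsub>W\<^esub> \<sigma> i \<otimes>\<^bsub>W\<^esub> inv\<^bsub>W\<^esub> w) \<otimes>\<^bsub>W\<^esub> v"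
    using w v by (simp add: W.inv_mult_group W.m_assoc)
  also have "\<dots> = \<sigma> j" unfolding eq using v by (simp add: W.m_assoc W.inv_solve_left')
  finally have c: "?u \<otimes>\<^bsub>W\<^esub> \<sigma> i \<otimes>\<^bsub>W\<^esub> inv\<^bsub>W\<^esub> ?u = \<sigma> j" .
  have "\<not> neg (inv\<^bsub>W\<^esub> v) (v \<otimes>\<^bsub>W\<^esub> \<sigma> j \<otimes>\<^bsub>W\<^esub> inv\<^bsub>W\<^esub> v)"
    using neg_mult[of "inv\<^bsub>W\<^esub> v" v "\<sigma> j"] v by simp
  then have "\<not> neg ?u (\<sigma> i)"
    using neg_mult[of "inv\<^bsub>W\<^esub> v" w "\<sigma> i"] w v eq by simp
  from gp_transport_dd[OF u w(2) v(2) this c]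
  have t: "gp ?u \<otimes>\<^bsub>H\<^esub> dd i = dd j \<otimes>\<^bsub>H\<^esub> gp ?u" .
  have wv: "w = v \<otimes>\<^bsub>W\<^esub> ?u" using w v by (simp flip: W.m_assoc)
  have gw: "gp w = gp v \<otimes>\<^bsub>H\<^esub> gp ?u" using gp_mult[OF v(1) u] wv by simp
  have gi: "gp ?u \<otimes>\<^bsub>H\<^esub> gp (inv\<^bsub>W\<^esub> w) = gp (inv\<^bsub>W\<^esub> v)"
    using gp_mult[OF u, of "inv\<^bsub>W\<^esub> w"] w v by (simp add: W.m_assoc)
  have "gp w \<otimes>\<^bsub>H\<^esub> dd i \<otimes>\<^bsub>H\<^esub> gp (inv\<^bsub>W\<^esub> w) = gp v \<otimes>\<^bsub>H\<^esub> (gp ?u \<otimes>\<^bsub>H\<^esub> dd i) \<otimes>\<^bsub>H\<^esub> gp (inv\<^bsub>W\<^esub> w)"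
    unfolding gw using u w v by (simp only: H.m_assoc H.m_closed gp_closed dd_closed W.inv_closed)
  also have "\<dots> = gp v \<otimes>\<^bsub>H\<^esub> dd j \<otimes>\<^bsub>H\<^esub> (gp ?u \<otimes>\<^bsub>H\<^esub> gp (inv\<^bsub>W\<^esub> w))"
    unfolding t using u w v by (simp only: H.m_assoc H.m_closed gp_closed dd_closed W.inv_closed)
  finally show ?thesis unfolding gi .
qed

definition is_D_family where
  "is_D_family D \<longleftrightarrow> D \<in> refls \<rightarrow>\<^sub>E carrier H \<and> (\<forall>i\<in>I. D (\<sigma> i) = dd i) \<and>
    (\<forall>i\<in>I. \<forall>s\<in>refls - {\<sigma> i}. D (\<sigma> i \<otimes>\<^bsub>W\<^esub> s \<otimes>\<^bsub>W\<^esub> \<sigma> i) = ss i \<otimes>\<^bsub>H\<^esub> D s \<otimes>\<^bsub>H\<^esub> ss i)"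

text \<open>D_t is taken to be w D_i w^-1 for a representation of the positive root of t as w
  applied to a simple root. The sign condition in \<open>?Q\<close> matters: representatives of the
  other sign give 1 - t - D_t instead.\<close>

lemma ex_D_family: "\<exists>D. is_D_family D"
proof -
  let ?Q = "\<lambda>t (w, i). w \<in> carrier W \<and> i \<in> I \<and> \<not> neg w (\<sigma> i) \<and> w \<otimes>\<^bsub>W\<^esub> \<sigma> i \<otimes>\<^bsub>W\<^esub> inv\<^bsub>W\<^esub> w = t"
  let ?v = "\<lambda>(w, i). gp w \<otimes>\<^bsub>H\<^esub> dd i \<otimes>\<^bsub>H\<^esub> gp (inv\<^bsub>W\<^esub> w)"
  define D where "D = restrict (\<lambda>t. ?v (SOME p. ?Q t p)) refls"
  have D: "D t = ?v (w, i)" if "?Q t (w, i)" for t w i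
  proof -
    obtain v j where p: "(SOME p. ?Q t p) = (v, j)" by force
    have "?Q t (SOME p. ?Q t p)" using someI[of "?Q t", OF that] .
    then have "?Q t (v, j)" unfolding p .
    moreover have "t \<in> refls" using that by (auto simp: reflections_def)
    ultimately show ?thesis using gp_conj_dd_unique[of v j w i] that by (simp add: D_def p)
  qed
  have ex: "\<exists>w i. ?Q t (w, i)" if "t \<in> refls" for t
  proof -
    from that obtain w i where "w \<in> carrier W" "i \<in> I" "t = w \<otimes>\<^bsub>W\<^esub> \<sigma> i \<otimes>\<^bsub>W\<^esub> inv\<^bsub>W\<^esub> w" "\<not> neg w (\<sigma> i)"
      by (rule positive_representative)
    then show ?thesis by (intro exI[of _ w] exI[of _ i]) simp
  qed
  have 1: "D \<in> refls \<rightarrow>\<^sub>E carrier H"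
  proof (rule PiE_I)
    fix t assume "t \<in> refls"
    then obtain w i where "?Q t (w, i)" using ex by blast
    then show "D t \<in> carrier H" using D[of t w i] by simp
  qed (simp add: D_def)
  have 2: "D (\<sigma> i) = dd i" if "i \<in> I" for i
    using D[of "\<sigma> i" "\<one>\<^bsub>W\<^esub>" i] that by (simp add: gp_one)
  have 3: "D (\<sigma> i \<otimes>\<^bsub>W\<^esub> t \<otimes>\<^bsub>W\<^esub> \<sigma> i) = ss i \<otimes>\<^bsub>H\<^esub> D t \<otimes>\<^bsub>H\<^esub> ss i" if i: "i \<in> I" and t: "t \<in> refls" "t \<noteq> \<sigma> i" for i t
  proof -
    obtain w j where Q: "?Q t (w, j)" using ex t by blast
    then have wj: "w \<in> carrier W" "j \<in> I" by auto
    have "?Q (\<sigma> i \<otimes>\<^bsub>W\<^esub> t \<otimes>\<^bsub>W\<^esub> \<sigma> i) (\<sigma> i \<otimes>\<^bsub>W\<^esub> w, j)"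
    proof (intro case_prodI conjI)
      \<comment> \<open>\<open>\<sigma> i\<close> changes the sign of no root but its own, and
        \<open>t\<close> differs from \<open>\<sigma> i\<close>.\<close>
      show "\<not> neg (\<sigma> i \<otimes>\<^bsub>W\<^esub> w) (\<sigma> j)"
        using Q i t neg_mult[of "\<sigma> i" w "\<sigma> j"] reflections_closed[OF t(1)] by (simp add: neg_\<sigma>)
      show "\<sigma> i \<otimes>\<^bsub>W\<^esub> w \<otimes>\<^bsub>W\<^esub> \<sigma> j \<otimes>\<^bsub>W\<^esub> inv\<^bsub>W\<^esub> (\<sigma> i \<otimes>\<^bsub>W\<^esub> w) = \<sigma> i \<otimes>\<^bsub>W\<^esub> t \<otimes>\<^bsub>W\<^esub> \<sigma> i"
        using Q i by (auto simp: W.inv_mult_group W.m_assoc)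
    qed (use i wj in simp_all)
    from D[OF this] D[OF Q] show ?thesis
      using wj i by (simp add: W.inv_mult_group gp_mult gp_\<sigma> H.m_assoc)
  qed
  show ?thesis unfolding is_D_family_def using 1 2 3 by blast
qed

lemma D_family_unique:
  assumes D: "is_D_family D" and D': "is_D_family D'"
  shows "D = D'"
proof (rule PiE_ext)
  show "D \<in> refls \<rightarrow>\<^sub>E carrier H" "D' \<in> refls \<rightarrow>\<^sub>E carrier H" using D D' by (auto simp: is_D_family_def)
  fix t assume "t \<in> refls"
  then show "D t = D' t"
    by (induction rule: reflection_induct) (use D D' in \<open>simp_all add: is_D_family_def\<close>)
qed

lemma DR_family: "is_D_family DR"
proof -
  obtain D where D: "is_D_family D" using ex_D_family by blast
  have "DR = (THE D. is_D_family D)" by (simp add: D_refl_def Let_def is_D_family_def)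
  also have "\<dots> = D" using D D_family_unique by blast
  finally show ?thesis using D by simp
qed

lemma DR_closed [simp]: "t \<in> refls \<Longrightarrow> DR t \<in> carrier H"
  and DR_\<sigma>: "i \<in> I \<Longrightarrow> DR (\<sigma> i) = dd i"
  and DR_conj: "i \<in> I \<Longrightarrow> t \<in> refls \<Longrightarrow> t \<noteq> \<sigma> i \<Longrightarrow> DR (\<sigma> i \<otimes>\<^bsub>W\<^esub> t \<otimes>\<^bsub>W\<^esub> \<sigma> i) = ss i \<otimes>\<^bsub>H\<^esub> DR t \<otimes>\<^bsub>H\<^esub> ss i"
  using DR_family by (auto simp: is_D_family_def simp del: split_paired_All)

lemma ss_DR:
  assumes "i \<in> I" "t \<in> refls" "t \<noteq> \<sigma> i"
  shows "ss i \<otimes>\<^bsub>H\<^esub> DR t = DR (\<sigma> i \<otimes>\<^bsub>W\<^esub> t \<otimes>\<^bsub>W\<^esub> \<sigma> i) \<otimes>\<^bsub>H\<^esub> ss i"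
  unfolding DR_conj[OF assms] using assms by (simp add: H.m_assoc ss_square)

lemma DR_square: "t \<in> refls \<Longrightarrow> DR t \<otimes>\<^bsub>H\<^esub> DR t = DR t"
proof (induction rule: reflection_induct)
  case (conj i t)
  have "(ss i \<otimes>\<^bsub>H\<^esub> DR t \<otimes>\<^bsub>H\<^esub> ss i) \<otimes>\<^bsub>H\<^esub> (ss i \<otimes>\<^bsub>H\<^esub> DR t \<otimes>\<^bsub>H\<^esub> ss i) = ss i \<otimes>\<^bsub>H\<^esub> (DR t \<otimes>\<^bsub>H\<^esub> DR t) \<otimes>\<^bsub>H\<^esub> ss i"
    using conj(1,2) by (simp add: H.m_assoc ss_cancel)
  then show ?case using conj by (simp add: DR_conj)
qed (simp add: DR_\<sigma> dd_square)

lemma comult_DR: "t \<in> refls \<Longrightarrow> comult (DR t) = tensor H H (DR t) \<one>\<^bsub>H\<^esub> \<oplus>\<^bsub>HH.T\<^esub> tensor H H (gp t) (DR t)"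
proof (induction rule: reflection_induct)
  case (conj i t)
  have t: "t \<in> carrier W" using conj by (simp add: reflections_closed)
  show ?case using conj t
    by (simp add: DR_conj ring_hom_mult[OF comult_hom] comult_ss HH.T.l_distr HH.T.r_distr gp_mult gp_\<sigma> ss_square)
qed (simp add: DR_\<sigma> comult_dd gp_\<sigma>)

end

section \<open>A free \<open>\<int>\<close>-module with an action of \<open>hecke_hat\<close>\<close>

text \<open>The basis element \<open>(l, w)\<close> stands for the product \<open>D\<^sub>t w\<close>, \<open>t\<close> running through \<open>l\<close>, in
  \<open>hecke_hat\<close>. The operators below are the left multiplications by \<open>D\<^sub>t\<close> and \<open>s\<^sub>i\<close>, as dictated by
  \<open>s\<^sub>i D\<^sub>t = D\<^bsub>s\<^sub>i t s\<^sub>i\<^esub> s\<^sub>i\<close> for \<open>t \<noteq> s\<^sub>i\<close> and \<open>s\<^sub>i D\<^sub>i = s\<^sub>i - 1 - D\<^sub>i s\<^sub>i\<close>.\<close>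

type_synonym 'i key = "'i list set list \<times> 'i list set"

definition D_op :: "'i list set \<Rightarrow> ('i key \<Rightarrow>\<^sub>0 int) \<Rightarrow> 'i key \<Rightarrow>\<^sub>0 int" where
  "D_op t = frag_extend (\<lambda>(l, w). frag_of (if l \<noteq> [] \<and> hd l = t then (l, w) else (t # l, w)))"

lemma frag_all_induct [case_names zero one diff]:
  fixes x :: "'a \<Rightarrow>\<^sub>0 int"
  assumes "P 0" "\<And>k. P (frag_of k)" "\<And>a b. P a \<Longrightarrow> P b \<Longrightarrow> P (a - b)"
  shows "P x"
  by (rule frag_induction[where S = UNIV]) (use assms in auto)

lemma D_op_diff: "D_op t (x - y) = D_op t x - D_op t y"
  and D_op_add: "D_op t (x + y) = D_op t x + D_op t y"
  and D_op_zero [simp]: "D_op t 0 = 0"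
  by (simp_all add: D_op_def frag_extend_diff frag_extend_add)

lemma D_op_of: "D_op t (frag_of (l, w)) = frag_of (if l \<noteq> [] \<and> hd l = t then (l, w) else (t # l, w))"
  by (simp add: D_op_def)

lemma D_op_idem: "D_op t (D_op t x) = D_op t x"
  by (induction x rule: frag_all_induct) (auto simp: D_op_diff D_op_of)

context coxeter_system
begin

primrec s_key :: "'i \<Rightarrow> 'i list set list \<Rightarrow> 'i list set \<Rightarrow> 'i key \<Rightarrow>\<^sub>0 int" where
  "s_key i [] w = frag_of ([], \<sigma> i \<otimes>\<^bsub>W\<^esub> w)"
| "s_key i (t # l) w = (if t = \<sigma> i then s_key i l w - frag_of (l, w) - D_op t (s_key i l w)
     else D_op (\<sigma> i \<otimes>\<^bsub>W\<^esub> t \<otimes>\<^bsub>W\<^esub> \<sigma> i) (s_key i l w))"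

definition s_op :: "'i \<Rightarrow> ('i key \<Rightarrow>\<^sub>0 int) \<Rightarrow> 'i key \<Rightarrow>\<^sub>0 int" where
  "s_op i = frag_extend (\<lambda>(l, w). s_key i l w)"

lemma s_op_diff: "s_op i (x - y) = s_op i x - s_op i y"
  and s_op_add: "s_op i (x + y) = s_op i x + s_op i y"
  and s_op_zero [simp]: "s_op i 0 = 0"
  by (simp_all add: s_op_def frag_extend_diff frag_extend_add)

lemma s_op_of: "s_op i (frag_of (l, w)) = s_key i l w"
  by (simp add: s_op_def)

text \<open>Equal neighbours in \<open>l\<close> are excluded because D_t D_t = D_t; accordingly
  \<open>D_op\<close> merges a repeated leading factor.\<close>

definition basis :: "'i key set" where
  "basis = {(l, w). l \<in> lists refls \<and> distinct_adj l \<and> w \<in> carrier W}"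

definition fmod :: "('i key \<Rightarrow>\<^sub>0 int) set" where
  "fmod = {x. Poly_Mapping.keys x \<subseteq> basis}"

text \<open>The filtration by the number of factors D_t, along which the Coxeter relations for
  \<open>s_op\<close> are proved; \<open>s_op\<close> preserves it and \<open>D_op\<close> raises it
  by at most one.\<close>

definition modf :: "nat \<Rightarrow> ('i key \<Rightarrow>\<^sub>0 int) set" where
  "modf k = {x. Poly_Mapping.keys x \<subseteq> {b \<in> basis. length (fst b) \<le> k}}"

lemma modf_diff: "x \<in> modf k \<Longrightarrow> y \<in> modf k \<Longrightarrow> x - y \<in> modf k"
  by (simp add: modf_def keys_diff_subset)

lemma modf_of: "frag_of (l, w) \<in> modf k \<longleftrightarrow> (l, w) \<in> basis \<and> length l \<le> k"
  by (simp add: modf_def)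

lemma modf_mono: "k \<le> k' \<Longrightarrow> modf k \<subseteq> modf k'"
  by (auto simp: modf_def)

lemma modf_induct [consumes 1, case_names zero one diff]:
  assumes "x \<in> modf k" "P 0" "\<And>l w. (l, w) \<in> basis \<Longrightarrow> length l \<le> k \<Longrightarrow> P (frag_of (l, w))"
    "\<And>a b. P a \<Longrightarrow> P b \<Longrightarrow> P (a - b)"
  shows "P x"
  by (rule frag_induction[where S = "{b \<in> basis. length (fst b) \<le> k}"]) (use assms in \<open>auto simp: modf_def\<close>)

lemma mod_modf:
  assumes "x \<in> fmod"
  obtains k where "x \<in> modf k"
proof -
  have "finite ((\<lambda>b. length (fst b)) ` Poly_Mapping.keys x)" by simp
  then obtain k where "\<forall>n\<in>(\<lambda>b. length (fst b)) ` Poly_Mapping.keys x. n \<le> k"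
    by (meson finite_nat_set_iff_bounded_le)
  then have "x \<in> modf k" using assms by (auto simp: fmod_def modf_def)
  then show thesis by (rule that)
qed

lemma modf_mod: "x \<in> modf k \<Longrightarrow> x \<in> fmod"
  by (auto simp: fmod_def modf_def)

lemma D_op_modf:
  assumes "t \<in> refls" "x \<in> modf k"
  shows "D_op t x \<in> modf (Suc k)"
  using assms(2)
proof (induction x rule: modf_induct)
  case (one l w)
  then show ?case using assms(1) by (cases l) (auto simp: D_op_of modf_of basis_def)
qed (simp_all add: D_op_diff modf_diff, simp add: modf_def)

lemma s_key_modf: "i \<in> I \<Longrightarrow> (l, w) \<in> basis \<Longrightarrow> s_key i l w \<in> modf (length l)"
proof (induction l)
  case Nil
  then show ?case by (simp add: modf_of basis_def)
next
  case (Cons t l)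
  then have l: "(l, w) \<in> basis" "t \<in> refls" by (auto simp: basis_def distinct_adj_Cons)
  have s: "s_key i l w \<in> modf (length l)" using Cons l by simp
  then have s': "s_key i l w \<in> modf (Suc (length l))" using modf_mono[of "length l" "Suc (length l)"] by auto
  have f: "frag_of (l, w) \<in> modf (Suc (length l))" using l by (simp add: modf_of)
  show ?case
    using D_op_modf[OF l(2) s] D_op_modf[OF conj_reflection[OF Cons.prems(1) l(2)] s] s' f
    by (cases "t = \<sigma> i") (simp_all add: modf_diff)
qed

lemma s_op_modf:
  assumes "i \<in> I" "x \<in> modf k"
  shows "s_op i x \<in> modf k"
  using assms(2)
proof (induction x rule: modf_induct)
  case (one l w)
  then show ?case using assms(1) s_key_modf[of i l w] modf_mono[of "length l" k] by (auto simp: s_op_of)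
qed (simp_all add: s_op_diff modf_diff, simp add: modf_def)

lemma s_op_fmod: "i \<in> I \<Longrightarrow> x \<in> fmod \<Longrightarrow> s_op i x \<in> fmod"
  by (metis mod_modf modf_mod s_op_modf)

lemma D_op_fmod: "t \<in> refls \<Longrightarrow> x \<in> fmod \<Longrightarrow> D_op t x \<in> fmod"
  by (metis mod_modf modf_mod D_op_modf)

text \<open>A repeated leading factor does no harm: both sides then merge, the right one because
  \<open>D_op\<close> is idempotent.\<close>

lemma s_op_D_op:
  assumes "t \<noteq> \<sigma> i"
  shows "s_op i (D_op t x) = D_op (\<sigma> i \<otimes>\<^bsub>W\<^esub> t \<otimes>\<^bsub>W\<^esub> \<sigma> i) (s_op i x)"
proof (induction x rule: frag_all_induct)
  case (one k)
  obtain l w where [simp]: "k = (l, w)" by force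
  show ?case using assms by (cases l) (auto simp: D_op_of s_op_of D_op_idem)
qed (simp_all add: D_op_diff s_op_diff)

text \<open>If a basis element \<open>x\<close> already begins with \<open>\<sigma> i\<close>, the
  last two terms must cancel. They do because the rest of the word does not begin with
  \<open>\<sigma> i\<close> again, so that \<open>D_op\<close> turns it back into
  \<open>x\<close>.\<close>

lemma s_op_D_op_simple:
  assumes "x \<in> fmod"
  shows "s_op i (D_op (\<sigma> i) x) = s_op i x - x - D_op (\<sigma> i) (s_op i x)"
proof -
  obtain k where "x \<in> modf k" using assms by (rule mod_modf)
  then show ?thesis
  proof (induction x rule: modf_induct)
    case (one l w)
    show ?case
    proof (cases "l \<noteq> [] \<and> hd l = \<sigma> i")
      case True
      then obtain l' where l: "l = \<sigma> i # l'" by (cases l) auto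
      then have "l' \<noteq> [] \<Longrightarrow> hd l' \<noteq> \<sigma> i" using one by (auto simp: basis_def distinct_adj_Cons)
      then have "D_op (\<sigma> i) (frag_of (l', w)) = frag_of (\<sigma> i # l', w)" by (auto simp: D_op_of)
      moreover have "D_op (\<sigma> i) (frag_of (l, w)) = frag_of (l, w)" by (simp add: l D_op_of)
      ultimately show ?thesis by (simp add: l s_op_of D_op_diff D_op_idem)
    next
      case False
      then have "D_op (\<sigma> i) (frag_of (l, w)) = frag_of (\<sigma> i # l, w)" by (auto simp: D_op_of)
      then show ?thesis by (simp add: s_op_of)
    qed
  next
    case (diff a b)
    show ?case unfolding D_op_diff s_op_diff diff by simp
  qed simp
qed

section \<open>Coxeter relations for the operators \<open>s_op\<close>\<close>

lemma foldr_s_op_diff: "foldr s_op u (x - y) = foldr s_op u x - foldr s_op u y"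
  and foldr_s_op_zero [simp]: "foldr s_op u 0 = 0"
  by (induction u) (simp_all add: s_op_diff)

lemma foldr_s_op_modf: "u \<in> lists I \<Longrightarrow> x \<in> modf k \<Longrightarrow> foldr s_op u x \<in> modf k"
  by (induction u) (simp_all add: s_op_modf)

definition word_of :: "'i list set \<Rightarrow> 'i list" where
  "word_of w = (SOME u. u \<in> lists I \<and> cls u = w)"

lemma word_of: "w \<in> carrier W \<Longrightarrow> word_of w \<in> lists I \<and> cls (word_of w) = w"
  unfolding word_of_def by (rule someI_ex) (auto elim: carrierE simp del: in_lists_conv_set)

text \<open>Left multiplication by the element of a root: for the negative root of \<open>t\<close> this is
  \<open>t D\<^sub>t t = 1 - t - D\<^sub>t\<close>. It makes the operators \<open>s_op\<close> permute the operators \<open>root_op\<close>.\<close>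

definition root_op :: "'i list set \<times> bool \<Rightarrow> ('i key \<Rightarrow>\<^sub>0 int) \<Rightarrow> 'i key \<Rightarrow>\<^sub>0 int" where
  "root_op = (\<lambda>(t, b) x. if b then x - foldr s_op (word_of t) x - D_op t x else D_op t x)"

context
  fixes k
  assumes relators: "\<And>i j x. i \<in> I \<Longrightarrow> j \<in> I \<Longrightarrow> x \<in> modf k \<Longrightarrow> foldr s_op (relator i j) x = x"
begin

lemma s_op_coxeter_eq:
  assumes "u \<in> lists I" "cls u = cls v" "x \<in> modf k"
  shows "foldr s_op u x = foldr s_op v x"
  by (rule coxeter_eq_foldr[where P = "modf k"])
    (use assms relators in \<open>simp_all add: s_op_modf flip: cls_eq_iff\<close>)

lemma s_op_square: "i \<in> I \<Longrightarrow> x \<in> modf k \<Longrightarrow> s_op i (s_op i x) = x"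
  using s_op_coxeter_eq[of "[i, i]" "[]" x] by (simp add: cls_square flip: one_cls)

text \<open>For \<open>t = \<sigma> i\<close> this is the rule for s_i D_i, rearranged. Otherwise,
  for the negative root, words for \<open>\<sigma> i\<close> times \<open>t\<close> and for the
  conjugate of \<open>t\<close> times \<open>\<sigma> i\<close> must act equally; this needs the
  relators on \<open>modf k\<close>, which will be the induction hypothesis in
  \<open>s_op_relator\<close>.\<close>

lemma s_op_root_op:
  assumes i: "i \<in> I" and t: "t \<in> refls" and x: "x \<in> modf k"
  shows "s_op i (root_op (t, b) x) = root_op (ract i (t, b)) (s_op i x)"
proof -
  have tW: "t \<in> carrier W" "\<sigma> i \<otimes>\<^bsub>W\<^esub> t \<otimes>\<^bsub>W\<^esub> \<sigma> i \<in> carrier W" using t i by (simp_all add: reflections_closed)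
  have ws: "foldr s_op (word_of (\<sigma> i)) y = s_op i y" if "y \<in> modf k" for y
    using s_op_coxeter_eq[of "word_of (\<sigma> i)" "[i]" y] word_of[of "\<sigma> i"] i that by (simp add: simple_refl_def)
  have sx: "s_op i x \<in> modf k" using i x by (rule s_op_modf)
  show ?thesis
  proof (cases "t = \<sigma> i")
    case True
    then show ?thesis
      using i x sx ws s_op_D_op_simple[OF modf_mod[OF x], of i]
      by (cases b) (simp_all add: root_op_def ract_def s_op_diff s_op_square)
  next
    case False
    let ?t = "\<sigma> i \<otimes>\<^bsub>W\<^esub> t \<otimes>\<^bsub>W\<^esub> \<sigma> i"
    have "cls (i # word_of t) = cls (word_of ?t @ [i])"
      using i word_of[OF tW(1)] word_of[OF tW(2)] tW by (simp add: cls_Cons cls_snoc W.m_assoc)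
    then have "s_op i (foldr s_op (word_of t) x) = foldr s_op (word_of ?t) (s_op i x)"
      using s_op_coxeter_eq[of "i # word_of t" "word_of ?t @ [i]" x] i word_of[OF tW(1)] x by simp
    then show ?thesis using False
      by (cases b) (simp_all add: root_op_def ract_def s_op_diff s_op_D_op)
  qed
qed

lemma foldr_s_op_root_op:
  assumes u: "u \<in> lists I" and t: "t \<in> refls" and x: "x \<in> modf k"
  shows "foldr s_op u (root_op (t, b) x) = root_op (foldr ract u (t, b)) (foldr s_op u x) \<and>
    fst (foldr ract u (t, b)) \<in> refls"
  using u
proof (induction u)
  case (Cons i u)
  obtain t' b' where f: "foldr ract u (t, b) = (t', b')" by force
  have "foldr s_op u x \<in> modf k" using Cons x by (intro foldr_s_op_modf)
  moreover have "foldr ract (i # u) (t, b) = ract i (t', b')" by (simp add: f)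
  moreover have "fst (ract i (t', b')) = \<sigma> i \<otimes>\<^bsub>W\<^esub> t' \<otimes>\<^bsub>W\<^esub> \<sigma> i" by (simp add: ract_def)
  ultimately show ?case using Cons f s_op_root_op[of i t' "foldr s_op u x" b']
    by (simp add: conj_reflection)
qed (use t in simp)

end

text \<open>Induction on the number of factors D_t. With none left, \<open>W\<close> acts on itself
  by left multiplication. Otherwise the leading factor is \<open>root_op (t, False)\<close>; the
  relator moves past it without changing it, by \<open>ract_relator\<close>, and fixes the remainder
  by the induction hypothesis.\<close>

lemma s_op_relator:
  assumes "i \<in> I" "j \<in> I"
  shows "x \<in> modf k \<Longrightarrow> foldr s_op (relator i j) x = x"
  using assms
proof (induction k arbitrary: x i j)
  case 0
  have Nil: "foldr s_op u (frag_of ([], w)) = frag_of ([], cls u \<otimes>\<^bsub>W\<^esub> w)" if "w \<in> carrier W" "u \<in> lists I" for u w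
    using that(2)
  proof (induction u)
    case Nil
    then show ?case using that(1) by (simp flip: one_cls)
  next
    case (Cons i u)
    then show ?case using that(1) by (simp add: s_op_of cls_Cons W.m_assoc)
  qed
  have c: "cls (relator i j) = \<one>\<^bsub>W\<^esub>" using 0 by (simp add: cls_replicate \<sigma>_pow_m)
  from 0(1) show ?case
  proof (induction x rule: modf_induct)
    case (one l w)
    then show ?case using Nil[of w "relator i j"] c relator_lists[OF 0(2,3)] by (simp add: basis_def)
  qed (simp_all add: foldr_s_op_diff)
next
  case (Suc k)
  from Suc.prems(1) show ?case
  proof (induction x rule: modf_induct)
    case (one l w)
    show ?case
    proof (cases l)
      case Nil
      then have "frag_of (l, w) \<in> modf k" using one by (simp add: modf_of)
      then show ?thesis using Suc by blast
    next
      case (Cons t l')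
      then have l': "frag_of (l', w) \<in> modf k" and t: "t \<in> refls" and hd: "l' = [] \<or> hd l' \<noteq> t"
        using one by (auto simp: modf_of basis_def distinct_adj_Cons)
      have r: "relator i j \<in> lists I" using Suc.prems by (intro relator_lists)
      have d: "frag_of (l, w) = root_op (t, False) (frag_of (l', w))"
        using hd by (auto simp: root_op_def D_op_of Cons)
      have IH: "\<And>i j x. i \<in> I \<Longrightarrow> j \<in> I \<Longrightarrow> x \<in> modf k \<Longrightarrow> foldr s_op (relator i j) x = x"
        using Suc.IH by blast
      show ?thesis
        unfolding d using foldr_s_op_root_op[OF IH r t l', where b = False] ract_relator[OF Suc.prems(2,3) reflections_closed[OF t]]
          IH[OF Suc.prems(2,3) l'] by simp
    qed
  qed (simp_all add: foldr_s_op_diff)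
qed

text \<open>By \<open>alt_conj\<close> the alternating word carries the signed reflection
  \<open>(\<sigma> k, False)\<close> to \<open>(\<sigma> i, False)\<close>, and
  \<open>foldr_s_op_root_op\<close> translates this into operators.\<close>

lemma D_op_braid:
  assumes "i \<in> I" "j \<in> I" "i \<noteq> j" "m i j \<noteq> 0" and x: "x \<in> fmod"
  defines "a \<equiv> alt j i (m i j - 1)" and "k \<equiv> if even (m i j) then i else j"
  shows "D_op (\<sigma> i) (foldr s_op a x) = foldr s_op a (D_op (\<sigma> k) x)"
proof -
  obtain n where n: "x \<in> modf n" using x by (rule mod_modf)
  have a: "a \<in> lists I" unfolding a_def using assms by (intro alt_in_lists)
  have k: "k \<in> I" using assms by (simp add: k_def)
  have "foldr ract a (\<sigma> k, False) = (\<sigma> i, False)"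
    using foldr_ract[OF a \<sigma>_closed[OF k], of False] alt_conj[OF assms(1-4)] by (simp add: a_def k_def)
  then show ?thesis
    using foldr_s_op_root_op[OF s_op_relator a \<sigma>_reflection[OF k] n, where b = False] by (simp add: root_op_def)
qed

end

text \<open>Endomorphisms of \<open>M\<close> are normalised to \<open>0\<close> outside \<open>M\<close>, so that equality on \<open>M\<close> is equality.\<close>

definition end_ring :: "'a::ab_group_add set \<Rightarrow> ('a \<Rightarrow> 'a) ring" where
  "end_ring M = \<lparr>carrier = {f. (\<forall>x\<in>M. f x \<in> M) \<and> (\<forall>x\<in>M. \<forall>y\<in>M. f (x + y) = f x + f y) \<and> (\<forall>x. x \<notin> M \<longrightarrow> f x = 0)},
    monoid.mult = (\<lambda>f g x. f (g x)), one = (\<lambda>x. if x \<in> M then x else 0),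
    ring.zero = (\<lambda>x. 0), ring.add = (\<lambda>f g x. f x + g x)\<rparr>"

lemma end_ring_add_zero:
  assumes "f \<in> carrier (end_ring M)" "0 \<in> M"
  shows "f 0 = 0"
proof -
  have "f (0 + 0) = f 0 + f 0" using assms unfolding end_ring_def by (auto simp del: add_0_right add_0_left)
  then show ?thesis by simp
qed

lemma ring_end_ring:
  fixes M :: "'a::ab_group_add set"
  assumes M0: "0 \<in> M" and Md: "\<And>x y. x \<in> M \<Longrightarrow> y \<in> M \<Longrightarrow> x - y \<in> M"
  shows "ring (end_ring M)"
proof -
  have Mn: "- x \<in> M" if "x \<in> M" for x using Md[OF M0 that] by simp
  have Ma: "x + y \<in> M" if "x \<in> M" "y \<in> M" for x y using Md[OF that(1) Mn[OF that(2)]] by simp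
  note z = end_ring_add_zero[OF _ M0]
  have add: "f (x + y) = f x + f y" if "f \<in> carrier (end_ring M)" "x \<in> M" "y \<in> M" for f x y
    using that by (simp add: end_ring_def)
  have cl: "f x \<in> M" if "f \<in> carrier (end_ring M)" for f x
    using that M0 by (cases "x \<in> M") (auto simp: end_ring_def)
  show ?thesis
  proof (rule ringI)
    show "abelian_group (end_ring M)"
    proof (rule abelian_groupI)
      fix f assume f: "f \<in> carrier (end_ring M)"
      have "(\<lambda>x. - f x) \<in> carrier (end_ring M)" using f by (auto simp: end_ring_def Mn)
      then show "\<exists>g\<in>carrier (end_ring M). g \<oplus>\<^bsub>end_ring M\<^esub> f = \<zero>\<^bsub>end_ring M\<^esub>"
        by (rule bexI[rotated]) (simp add: end_ring_def)
    qed (auto simp: end_ring_def Ma M0 algebra_simps)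
    show "monoid (end_ring M)"
    proof (rule monoidI)
      fix f g assume fg: "f \<in> carrier (end_ring M)" "g \<in> carrier (end_ring M)"
      then show "f \<otimes>\<^bsub>end_ring M\<^esub> g \<in> carrier (end_ring M)"
        using z[OF fg(1)] by (simp add: end_ring_def)
    next
      fix f assume f: "f \<in> carrier (end_ring M)"
      then show "\<one>\<^bsub>end_ring M\<^esub> \<otimes>\<^bsub>end_ring M\<^esub> f = f" "f \<otimes>\<^bsub>end_ring M\<^esub> \<one>\<^bsub>end_ring M\<^esub> = f"
        using z[OF f] cl[OF f] by (auto simp: end_ring_def fun_eq_iff)
    qed (auto simp: end_ring_def Ma M0)
    fix f g h assume fgh: "f \<in> carrier (end_ring M)" "g \<in> carrier (end_ring M)" "h \<in> carrier (end_ring M)"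
    show "(f \<oplus>\<^bsub>end_ring M\<^esub> g) \<otimes>\<^bsub>end_ring M\<^esub> h = f \<otimes>\<^bsub>end_ring M\<^esub> h \<oplus>\<^bsub>end_ring M\<^esub> g \<otimes>\<^bsub>end_ring M\<^esub> h"
      by (simp add: end_ring_def)
    show "h \<otimes>\<^bsub>end_ring M\<^esub> (f \<oplus>\<^bsub>end_ring M\<^esub> g) = h \<otimes>\<^bsub>end_ring M\<^esub> f \<oplus>\<^bsub>end_ring M\<^esub> h \<otimes>\<^bsub>end_ring M\<^esub> g"
      using add[OF fgh(3) cl[OF fgh(1)] cl[OF fgh(2)]] by (simp add: end_ring_def)
  qed
qed

section \<open>\<open>hecke_hat\<close> acting by endomorphisms of the free module\<close>

context coxeter_system
begin

lemma fmod_diff: "x \<in> fmod \<Longrightarrow> y \<in> fmod \<Longrightarrow> x - y \<in> fmod"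
  and fmod_add: "x \<in> fmod \<Longrightarrow> y \<in> fmod \<Longrightarrow> x + y \<in> fmod"
  and fmod_zero [simp]: "0 \<in> fmod"
  by (simp_all add: fmod_def keys_diff_subset keys_add_subset)

lemma fmod_induct [consumes 1, case_names zero one diff]:
  assumes "x \<in> fmod" "P 0" "\<And>l w. (l, w) \<in> basis \<Longrightarrow> P (frag_of (l, w))"
    "\<And>a b. a \<in> fmod \<Longrightarrow> b \<in> fmod \<Longrightarrow> P a \<Longrightarrow> P b \<Longrightarrow> P (a - b)"
  shows "P x"
proof -
  have "x \<in> fmod \<and> P x"
    by (rule frag_induction[where S = basis]) (use assms in \<open>auto simp: fmod_def keys_diff_subset\<close>)
  then show ?thesis ..
qed

abbreviation "E \<equiv> end_ring fmod"

lemma ring_E: "ring E"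
  by (rule ring_end_ring) (auto simp: fmod_diff)

sublocale E: ring E by (rule ring_E)

definition op_E :: "(('i key \<Rightarrow>\<^sub>0 int) \<Rightarrow> 'i key \<Rightarrow>\<^sub>0 int) \<Rightarrow> ('i key \<Rightarrow>\<^sub>0 int) \<Rightarrow> 'i key \<Rightarrow>\<^sub>0 int" where
  "op_E f = (\<lambda>x. if x \<in> fmod then f x else 0)"

definition gen_E where
  "gen_E g = (case g of GS i \<Rightarrow> op_E (s_op i) | GD i \<Rightarrow> op_E (D_op (\<sigma> i)))"

lemma op_E_closed:
  "(\<And>x. x \<in> fmod \<Longrightarrow> f x \<in> fmod) \<Longrightarrow> (\<And>x y. f (x + y) = f x + f y) \<Longrightarrow> op_E f \<in> carrier E"
  by (auto simp: end_ring_def op_E_def fmod_add)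

lemma gen_E_closed: "g \<in> gens I \<Longrightarrow> gen_E g \<in> carrier E"
  by (elim gensE)
    (auto simp: gen_E_def s_op_fmod D_op_fmod \<sigma>_reflection s_op_add D_op_add intro!: op_E_closed)

lemma foldr_s_op_fmod: "u \<in> lists I \<Longrightarrow> x \<in> fmod \<Longrightarrow> foldr s_op u x \<in> fmod"
  by (induction u) (simp_all add: s_op_fmod)

lemma word_eval_E: "u \<in> lists I \<Longrightarrow> word_eval E (\<lambda>i. gen_E (GS i)) u = op_E (foldr s_op u)"
proof (induction u)
  case Nil
  then show ?case by (simp add: word_eval_def end_ring_def op_E_def)
next
  case (Cons i u)
  then have "foldr s_op u x \<in> fmod" if "x \<in> fmod" for x using foldr_s_op_fmod[of u x] that by simp
  then show ?case
    using Cons by (auto simp: word_eval_def end_ring_def gen_E_def op_E_def fun_eq_iff)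
qed

lemma s_op_relator_fmod: "i \<in> I \<Longrightarrow> j \<in> I \<Longrightarrow> x \<in> fmod \<Longrightarrow> foldr s_op (relator i j) x = x"
  by (metis mod_modf s_op_relator)

lemma E_minus_one: "f \<in> carrier E \<Longrightarrow> f \<ominus>\<^bsub>E\<^esub> \<one>\<^bsub>E\<^esub> = (\<lambda>x. if x \<in> fmod then f x - x else 0)"
proof -
  assume f: "f \<in> carrier E"
  let ?g = "\<lambda>x. if x \<in> fmod then f x - x else 0"
  have g: "?g \<in> carrier E"
    using f by (auto simp: end_ring_def fmod_diff fmod_add)
  have "?g \<oplus>\<^bsub>E\<^esub> \<one>\<^bsub>E\<^esub> = f" using f by (auto simp: end_ring_def fun_eq_iff)
  then have "f \<ominus>\<^bsub>E\<^esub> \<one>\<^bsub>E\<^esub> = ?g \<oplus>\<^bsub>E\<^esub> \<one>\<^bsub>E\<^esub> \<ominus>\<^bsub>E\<^esub> \<one>\<^bsub>E\<^esub>" by simp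
  also have "\<dots> = ?g" using g by (simp add: E.minus_eq E.a_assoc E.r_neg)
  finally show ?thesis .
qed

lemma E_rep: "hecke_rep I m E gen_E"
proof (rule hecke_rep.intro[OF coxeter_system_axioms ring_E], unfold_locales)
  fix g assume "g \<in> gens I"
  then show "gen_E g \<in> carrier E" by (rule gen_E_closed)
next
  fix i assume i: "i \<in> I"
  have s: "s_op i x \<in> fmod" if "x \<in> fmod" for x using i that by (rule s_op_fmod)
  have d: "D_op (\<sigma> i) x \<in> fmod" if "x \<in> fmod" for x using \<sigma>_reflection[OF i] that by (rule D_op_fmod)
  have ss: "s_op i (s_op i x) = x" if "x \<in> fmod" for x
  proof -
    have "m i i = 1" using m_eq_1_iff i by simp
    then show ?thesis using s_op_relator_fmod[OF i i that] by simp
  qed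
  show "gen_E (GS i) \<otimes>\<^bsub>E\<^esub> gen_E (GS i) = \<one>\<^bsub>E\<^esub>"
    using s ss by (auto simp: gen_E_def op_E_def end_ring_def fun_eq_iff)
  show "gen_E (GD i) \<otimes>\<^bsub>E\<^esub> gen_E (GD i) = gen_E (GD i)"
    using d by (auto simp: gen_E_def op_E_def end_ring_def fun_eq_iff D_op_idem)
  have "gen_E (GS i) \<otimes>\<^bsub>E\<^esub> gen_E (GD i) \<oplus>\<^bsub>E\<^esub> gen_E (GD i) \<otimes>\<^bsub>E\<^esub> gen_E (GS i) =
      (\<lambda>x. if x \<in> fmod then s_op i x - x else 0)"
    using s d by (auto simp: gen_E_def op_E_def end_ring_def fun_eq_iff s_op_D_op_simple)
  then show "gen_E (GS i) \<otimes>\<^bsub>E\<^esub> gen_E (GD i) \<oplus>\<^bsub>E\<^esub> gen_E (GD i) \<otimes>\<^bsub>E\<^esub> gen_E (GS i) = gen_E (GS i) \<ominus>\<^bsub>E\<^esub> \<one>\<^bsub>E\<^esub>"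
    using i by (simp add: E_minus_one gen_E_closed) (auto simp: gen_E_def op_E_def fun_eq_iff)
next
  fix i j assume ij: "i \<in> I" "j \<in> I"
  show "word_eval E (\<lambda>i. gen_E (GS i)) (relator i j) = \<one>\<^bsub>E\<^esub>"
    unfolding word_eval_E[OF relator_lists[OF ij]]
    using ij by (auto simp: op_E_def end_ring_def fun_eq_iff s_op_relator_fmod)
  assume ne: "i \<noteq> j" "m i j \<noteq> 0"
  let ?a = "alt j i (m i j - 1)" and ?k = "if even (m i j) then i else j"
  have a: "?a \<in> lists I" using ij by (intro alt_in_lists)
  have k: "?k \<in> I" using ij by simp
  have "gen_E (GD i) \<otimes>\<^bsub>E\<^esub> op_E (foldr s_op ?a) = op_E (foldr s_op ?a) \<otimes>\<^bsub>E\<^esub> gen_E (GD ?k)"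
  proof
    fix x
    show "(gen_E (GD i) \<otimes>\<^bsub>E\<^esub> op_E (foldr s_op ?a)) x = (op_E (foldr s_op ?a) \<otimes>\<^bsub>E\<^esub> gen_E (GD ?k)) x"
      using D_op_braid[OF ij ne, of x] foldr_s_op_fmod[OF a, of x] D_op_fmod[OF \<sigma>_reflection[OF k], of x]
      unfolding gen_E_def gen.case end_ring_def op_E_def by (simp del: One_nat_def)
  qed
  then show "gen_E (GD i) \<otimes>\<^bsub>E\<^esub> word_eval E (\<lambda>i. gen_E (GS i)) ?a = word_eval E (\<lambda>i. gen_E (GS i)) ?a \<otimes>\<^bsub>E\<^esub> gen_E (GD ?k)"
    by (simp only: word_eval_E[OF a])
qed

definition act :: "('i gen list \<Rightarrow>\<^sub>0 int) set \<Rightarrow> ('i key \<Rightarrow>\<^sub>0 int) \<Rightarrow> 'i key \<Rightarrow>\<^sub>0 int" where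
  "act = induced (linear_extension E (word_eval E gen_E))"

lemma act_hom: "act \<in> ring_hom H E"
  unfolding act_def by (rule hecke_rep.induced_hom[OF E_rep])

lemma act_gen: "g \<in> gens I \<Longrightarrow> act (gen_el I m g) = gen_E g"
  unfolding act_def by (rule hecke_rep.induced_gen[OF E_rep])

section \<open>Evaluation of formal products, and coordinates\<close>

definition key_el :: "'i key \<Rightarrow> ('i gen list \<Rightarrow>\<^sub>0 int) set" where
  "key_el = (\<lambda>(l, w). foldr (\<lambda>t y. DR t \<otimes>\<^bsub>H\<^esub> y) l (gp w))"

lemma key_el_Nil: "key_el ([], w) = gp w"
  and key_el_Cons: "key_el (t # l, w) = DR t \<otimes>\<^bsub>H\<^esub> key_el (l, w)"
  by (simp_all add: key_el_def)

lemma key_el_closed: "b \<in> basis \<Longrightarrow> key_el b \<in> carrier H"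
proof -
  have "foldr (\<lambda>t y. DR t \<otimes>\<^bsub>H\<^esub> y) l (gp w) \<in> carrier H" if "l \<in> lists refls" "w \<in> carrier W" for l w
    using that by (induction l) auto
  then show "b \<in> basis \<Longrightarrow> key_el b \<in> carrier H" by (auto simp: basis_def key_el_def simp del: in_lists_conv_set)
qed

abbreviation "\<Psi> \<equiv> linear_extension H key_el"

lemma \<Psi>_diff: "x \<in> fmod \<Longrightarrow> y \<in> fmod \<Longrightarrow> \<Psi> (x - y) = \<Psi> x \<ominus>\<^bsub>H\<^esub> \<Psi> y"
  using H.linear_extension_diff[where K = basis and \<phi> = key_el] key_el_closed by (simp add: fmod_def)

lemma \<Psi>_closed: "x \<in> fmod \<Longrightarrow> \<Psi> x \<in> carrier H"
  using H.linear_extension_closed[where K = basis and \<phi> = key_el] key_el_closed by (simp add: fmod_def)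

lemma \<Psi>_of: "b \<in> basis \<Longrightarrow> \<Psi> (frag_of b) = key_el b"
  using H.linear_extension_of[where K = basis and \<phi> = key_el] key_el_closed by simp

lemma \<Psi>_D_op:
  assumes t: "t \<in> refls" and x: "x \<in> fmod"
  shows "\<Psi> (D_op t x) = DR t \<otimes>\<^bsub>H\<^esub> \<Psi> x"
  using x
proof (induction x rule: fmod_induct)
  case (one l w)
  show ?case
  proof (cases "l \<noteq> [] \<and> hd l = t")
    case True
    then obtain l' where l: "l = t # l'" by (cases l) auto
    have "(l', w) \<in> basis" using one by (auto simp: basis_def l distinct_adj_Cons)
    from key_el_closed[OF this] one t show ?thesis
      by (simp add: l D_op_of \<Psi>_of key_el_Cons DR_square flip: H.m_assoc)
  next
    case False
    then have "(t # l, w) \<in> basis" using one t by (cases l) (auto simp: basis_def)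
    moreover have "D_op t (frag_of (l, w)) = frag_of (t # l, w)" using False by (auto simp: D_op_of)
    ultimately show ?thesis using one by (simp add: \<Psi>_of key_el_Cons)
  qed
next
  case (diff a b)
  then show ?case using t by (simp add: D_op_diff \<Psi>_diff D_op_fmod \<Psi>_closed H.minus_eq H.r_distr H.r_minus)
qed (use t in simp)

text \<open>The rules defining \<open>s_key\<close> are identities in \<open>hecke_hat\<close>:
  \<open>ss_DR\<close> for a leading factor other than \<open>\<sigma> i\<close>, and s D = s - 1 -
  D s otherwise.\<close>

lemma \<Psi>_s_op:
  assumes i: "i \<in> I" and x: "x \<in> fmod"
  shows "\<Psi> (s_op i x) = ss i \<otimes>\<^bsub>H\<^esub> \<Psi> x"
  using x
proof (induction x rule: fmod_induct)
  case (one l w)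
  then show ?case
  proof (induction l)
    case Nil
    then have "w \<in> carrier W" by (simp add: basis_def)
    then show ?case using i
      by (simp add: s_op_of \<Psi>_of basis_def key_el_Nil gp_mult gp_\<sigma>)
  next
    case (Cons t l)
    then have b: "(l, w) \<in> basis" and t: "t \<in> refls" by (auto simp: basis_def distinct_adj_Cons)
    have IH: "\<Psi> (s_key i l w) = ss i \<otimes>\<^bsub>H\<^esub> key_el (l, w)" using Cons.IH b by (simp add: s_op_of \<Psi>_of)
    have sk: "s_key i l w \<in> fmod" using s_key_modf[OF i b] by (rule modf_mod)
    have fr: "frag_of (l, w) \<in> fmod" using b by (simp add: fmod_def)
    note kc = key_el_closed[OF b]
    have kt: "key_el (t # l, w) = DR t \<otimes>\<^bsub>H\<^esub> key_el (l, w)" by (rule key_el_Cons)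
    show ?case
    proof (cases "t = \<sigma> i")
      case True
      have D: "D_op t (s_key i l w) \<in> fmod" using t sk by (rule D_op_fmod)
      have ds: "dd i \<otimes>\<^bsub>H\<^esub> ss i = ss i \<ominus>\<^bsub>H\<^esub> \<one>\<^bsub>H\<^esub> \<ominus>\<^bsub>H\<^esub> ss i \<otimes>\<^bsub>H\<^esub> dd i"
        by (rule H_solve) (use ss_dd[OF i] i in simp_all)
      have "\<Psi> (s_key i (t # l) w) = ss i \<otimes>\<^bsub>H\<^esub> key_el (l, w) \<ominus>\<^bsub>H\<^esub> key_el (l, w) \<ominus>\<^bsub>H\<^esub> (dd i \<otimes>\<^bsub>H\<^esub> ss i) \<otimes>\<^bsub>H\<^esub> key_el (l, w)"
        using i kc True t
        by (simp add: \<Psi>_diff sk fr D[unfolded True] fmod_diff \<Psi>_D_op \<Psi>_of b IH DR_\<sigma> H.m_assoc)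
      also have "\<dots> = ss i \<otimes>\<^bsub>H\<^esub> (dd i \<otimes>\<^bsub>H\<^esub> key_el (l, w))"
        unfolding ds using i kc
        by (simp add: H.minus_eq H.l_distr H.l_minus H.minus_add H.m_assoc)
          (simp add: H.a_assoc H.r_neg1 H.r_neg2 H.a_lcomm)
      finally show ?thesis using Cons.prems True i by (simp add: s_op_of \<Psi>_of key_el_Cons DR_\<sigma> del: s_key.simps)
    next
      case False
      have "\<Psi> (s_key i (t # l) w) = DR (\<sigma> i \<otimes>\<^bsub>W\<^esub> t \<otimes>\<^bsub>W\<^esub> \<sigma> i) \<otimes>\<^bsub>H\<^esub> (ss i \<otimes>\<^bsub>H\<^esub> key_el (l, w))"
        using False by (simp add: \<Psi>_D_op conj_reflection[OF i t] sk IH)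
      also have "\<dots> = ss i \<otimes>\<^bsub>H\<^esub> (DR t \<otimes>\<^bsub>H\<^esub> key_el (l, w))"
        using i t kc conj_reflection[OF i t] by (simp add: ss_DR[OF i t False] flip: H.m_assoc)
      finally show ?thesis using Cons.prems by (simp add: s_op_of \<Psi>_of kt del: s_key.simps)
    qed
  qed
next
  case (diff a b)
  then show ?case using i by (simp add: s_op_diff \<Psi>_diff s_op_fmod \<Psi>_closed H.minus_eq H.r_distr H.r_minus)
qed (use i in simp)

lemma E_fmod: "f \<in> carrier E \<Longrightarrow> x \<in> fmod \<Longrightarrow> f x \<in> fmod"
  by (simp add: end_ring_def)

lemma act_closed: "h \<in> carrier H \<Longrightarrow> x \<in> fmod \<Longrightarrow> act h x \<in> fmod"
  using ring_hom_closed[OF act_hom] by (rule E_fmod)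

lemma act_add: "h \<in> carrier H \<Longrightarrow> h' \<in> carrier H \<Longrightarrow> act (h \<oplus>\<^bsub>H\<^esub> h') x = act h x + act h' x"
  using ring_hom_add[OF act_hom, of h h'] by (simp add: end_ring_def)

text \<open>Evaluation intertwines the action with left multiplication for the generators, by
  \<open>\<Psi>_s_op\<close> and \<open>\<Psi>_D_op\<close>, and hence throughout.\<close>

lemma \<Psi>_act: "h \<in> carrier H \<Longrightarrow> x \<in> fmod \<Longrightarrow> \<Psi> (act h x) = h \<otimes>\<^bsub>H\<^esub> \<Psi> x"
proof (induction h arbitrary: x rule: hecke_induct)
  case one
  then show ?case using ring_hom_one[OF act_hom] by (simp add: end_ring_def \<Psi>_closed)
next
  case (gen g h)
  have "act (gen_el I m g \<otimes>\<^bsub>H\<^esub> h) x = gen_E g (act h x)"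
    using ring_hom_mult[OF act_hom, of "gen_el I m g" h] gen by (simp add: act_gen end_ring_def)
  moreover have "\<Psi> (gen_E g y) = gen_el I m g \<otimes>\<^bsub>H\<^esub> \<Psi> y" if "y \<in> fmod" for y
    using gen(1) that by (elim gensE) (simp_all add: gen_E_def op_E_def \<Psi>_s_op \<Psi>_D_op \<sigma>_reflection DR_\<sigma>)
  ultimately show ?case using gen act_closed[of h x] by (simp add: H.m_assoc \<Psi>_closed)
next
  case (diff h h')
  have h: "h \<ominus>\<^bsub>H\<^esub> h' \<in> carrier H" using diff by simp
  have "act h x = act (h \<ominus>\<^bsub>H\<^esub> h' \<oplus>\<^bsub>H\<^esub> h') x" using diff by (simp add: H.minus_eq H.a_assoc H.l_neg)
  also have "\<dots> = act (h \<ominus>\<^bsub>H\<^esub> h') x + act h' x" using diff h by (intro act_add)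
  finally have "act (h \<ominus>\<^bsub>H\<^esub> h') x = act h x - act h' x" by simp
  then show ?case using diff by (simp add: \<Psi>_diff act_closed \<Psi>_closed H.minus_eq H.l_distr H.l_minus)
qed

text \<open>The vector acted upon stands for 1, so evaluating the result gives back \<open>h\<close>
  by \<open>\<Psi>_act\<close>. Thus \<open>coord\<close> is an additive section of
  \<open>\<Psi>\<close>, and its coefficients are the functionals of a dual basis.\<close>

definition coord :: "('i gen list \<Rightarrow>\<^sub>0 int) set \<Rightarrow> 'i key \<Rightarrow>\<^sub>0 int" where
  "coord h = act h (frag_of ([], \<one>\<^bsub>W\<^esub>))"

lemma coord_fmod: "h \<in> carrier H \<Longrightarrow> coord h \<in> fmod"
  and \<Psi>_coord: "h \<in> carrier H \<Longrightarrow> \<Psi> (coord h) = h"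
  and coord_add: "h \<in> carrier H \<Longrightarrow> h' \<in> carrier H \<Longrightarrow> coord (h \<oplus>\<^bsub>H\<^esub> h') = coord h + coord h'"
proof -
  have b: "([], \<one>\<^bsub>W\<^esub>) \<in> basis" by (simp add: basis_def)
  then have f: "frag_of ([], \<one>\<^bsub>W\<^esub>) \<in> fmod" by (simp add: fmod_def)
  show "h \<in> carrier H \<Longrightarrow> coord h \<in> fmod" unfolding coord_def using f by (rule act_closed[rotated])
  show "h \<in> carrier H \<Longrightarrow> \<Psi> (coord h) = h"
    unfolding coord_def using \<Psi>_act[OF _ f, of h] b by (simp add: \<Psi>_of key_el_Nil gp_one)
  show "h \<in> carrier H \<Longrightarrow> h' \<in> carrier H \<Longrightarrow> coord (h \<oplus>\<^bsub>H\<^esub> h') = coord h + coord h'"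
    unfolding coord_def by (rule act_add)
qed

end

section \<open>The ideal \<open>J_ideal\<close>\<close>

lemma add_hom_finsum:
  assumes R: "abelian_group R" and S: "abelian_group S" and h: "h \<in> add_hom R S"
    and "finite A" "\<And>a. a \<in> A \<Longrightarrow> f a \<in> carrier R"
  shows "h (\<Oplus>\<^bsub>R\<^esub>a\<in>A. f a) = (\<Oplus>\<^bsub>S\<^esub>a\<in>A. h (f a))"
proof -
  interpret R: abelian_group R by fact
  interpret S: abelian_group S by fact
  show ?thesis using assms(4,5)
  proof (induction A)
    case (insert a A)
    then have "f \<in> A \<rightarrow> carrier R" "(\<lambda>a. h (f a)) \<in> A \<rightarrow> carrier S" using add_hom_closed[OF h] by auto
    then show ?case using insert add_hom_closed[OF h]
      by (simp add: add_hom_add[OF h] R.finsum_closed)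
  qed (simp add: add_hom_zero[OF R S h])
qed

lemma (in ideal) ideal_opposite: "ideal I (opposite R)"
proof (rule idealI[OF ring_opposite])
  have "add_monoid (opposite R) = add_monoid R" by (simp add: opposite_def)
  then show "subgroup I (add_monoid (opposite R))" using a_subgroup by simp
qed (auto intro: I_l_closed I_r_closed)

context ring_pair
begin

lemma tensor_span_mult:
  assumes P: "P \<in> tensor_span A B U V" and Q: "Q \<in> tensor_span A B U' V'"
    and sub: "U \<subseteq> carrier A" "V \<subseteq> carrier B" "U' \<subseteq> carrier A" "V' \<subseteq> carrier B" "U'' \<subseteq> carrier A" "V'' \<subseteq> carrier B"
    and mult: "\<And>u u'. u \<in> U \<Longrightarrow> u' \<in> U' \<Longrightarrow> u \<otimes>\<^bsub>A\<^esub> u' \<in> U''" "\<And>v v'. v \<in> V \<Longrightarrow> v' \<in> V' \<Longrightarrow> v \<otimes>\<^bsub>B\<^esub> v' \<in> V''"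
  shows "P \<otimes>\<^bsub>T\<^esub> Q \<in> tensor_span A B U'' V''"
  using P sub(1,2)
proof (induction P rule: tensor_span_induct)
  case (tensor u v)
  then have uv: "u \<in> carrier A" "v \<in> carrier B" using sub by auto
  from Q sub(3,4) show ?case
  proof (induction Q rule: tensor_span_induct)
    case (tensor u' v')
    then have "u' \<in> carrier A" "v' \<in> carrier B" using sub by auto
    then show ?case using uv tensor \<open>u \<in> U\<close> \<open>v \<in> V\<close> mult by (simp add: tensor_span_incl)
  qed (use uv sub in \<open>simp_all add: T.r_distr T.r_minus tensor_span_closed\<close>)
qed (use sub tensor_span_closed(1)[OF sub(3,4) Q] in \<open>simp_all add: T.l_distr T.l_minus tensor_span_closed\<close>)

lemma tensor_span_carrier: "P \<in> carrier T \<Longrightarrow> P \<in> tensor_span A B (carrier A) (carrier B)"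
  by (induction P rule: tensor_induct) (simp_all add: tensor_span_incl tensor_span_closed T.minus_eq)

lemma ideal_tensor_span:
  assumes U: "U = carrier A \<or> ideal U A" and V: "V = carrier B \<or> ideal V B"
  shows "ideal (tensor_span A B U V) T"
proof -
  have U': "U \<subseteq> carrier A" "\<And>x u. x \<in> carrier A \<Longrightarrow> u \<in> U \<Longrightarrow> x \<otimes>\<^bsub>A\<^esub> u \<in> U \<and> u \<otimes>\<^bsub>A\<^esub> x \<in> U"
    using U by (auto dest: ideal.axioms(1) additive_subgroup.a_subset ideal.I_l_closed ideal.I_r_closed)
  have V': "V \<subseteq> carrier B" "\<And>x u. x \<in> carrier B \<Longrightarrow> u \<in> V \<Longrightarrow> x \<otimes>\<^bsub>B\<^esub> u \<in> V \<and> u \<otimes>\<^bsub>B\<^esub> x \<in> V"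
    using V by (auto dest: ideal.axioms(1) additive_subgroup.a_subset ideal.I_l_closed ideal.I_r_closed)
  show ?thesis
  proof (rule idealI[OF tensor_ring_ring subgroup_tensor_span[OF U'(1) V'(1)]])
    fix P Q assume P: "P \<in> tensor_span A B U V" and Q: "Q \<in> carrier T"
    note Q' = tensor_span_carrier[OF Q]
    show "Q \<otimes>\<^bsub>T\<^esub> P \<in> tensor_span A B U V"
      by (rule tensor_span_mult[OF Q' P]) (use U' V' in auto)
    show "P \<otimes>\<^bsub>T\<^esub> Q \<in> tensor_span A B U V"
      by (rule tensor_span_mult[OF P Q']) (use U' V' in auto)
  qed
qed

end

context coxeter_system
begin

text \<open>The map f (x) id, with the tensor product of the integers and \<open>H\<close>
  identified with \<open>H\<close>.\<close>

definition coeff :: "(('i gen list \<Rightarrow>\<^sub>0 int) set \<Rightarrow> int) \<Rightarrow>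
    (('i gen list \<Rightarrow>\<^sub>0 int) set \<times> ('i gen list \<Rightarrow>\<^sub>0 int) set \<Rightarrow>\<^sub>0 int) set \<Rightarrow> ('i gen list \<Rightarrow>\<^sub>0 int) set" where
  "coeff f = tensor_lift H (\<lambda>a b. [f a] \<cdot>\<^bsub>H\<^esub> b)"

lemma coeff_add_hom: "f \<in> add_hom H \<Z> \<Longrightarrow> coeff f \<in> add_hom HH.T H"
  unfolding coeff_def by (rule HH.tensor_lift_add_hom[OF ring_H biadditive_scale(1)[OF ring_H]])

lemma coeff_tensor:
  "f \<in> add_hom H \<Z> \<Longrightarrow> a \<in> carrier H \<Longrightarrow> b \<in> carrier H \<Longrightarrow> coeff f (tensor H H a b) = [f a] \<cdot>\<^bsub>H\<^esub> b"
  unfolding coeff_def by (rule HH.tensor_lift_tensor[OF ring_H biadditive_scale(1)[OF ring_H]])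

abbreviation coord_at :: "'i key \<Rightarrow> ('i gen list \<Rightarrow>\<^sub>0 int) set \<Rightarrow> int" where
  "coord_at b \<equiv> (\<lambda>h. Poly_Mapping.lookup (coord h) b)"

lemma coord_at_add_hom: "coord_at b \<in> add_hom H \<Z>"
  by (rule add_homI) (simp_all add: coord_add lookup_add)

lemma scale_closed [simp]: "x \<in> carrier H \<Longrightarrow> [(k :: int)] \<cdot>\<^bsub>H\<^esub> x \<in> carrier H"
  by (rule H.add.int_pow_closed)

lemma tensor_scale:
  fixes k :: int
  assumes "a \<in> carrier H" "b \<in> carrier H"
  shows "tensor H H ([k] \<cdot>\<^bsub>H\<^esub> a) b = tensor H H a ([k] \<cdot>\<^bsub>H\<^esub> b)"
  using add_hom_int_pow[OF H.is_abelian_group HH.T.is_abelian_group HH.tensor_left_add_hom[OF assms(2)] assms(1)]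
    add_hom_int_pow[OF H.is_abelian_group HH.T.is_abelian_group HH.tensor_right_add_hom[OF assms(1)] assms(2)]
  by simp

text \<open>The elements \<open>key_el b\<close> and the functionals \<open>coord_at b\<close> form a dual basis of \<open>hecke_hat\<close> over
  \<open>\<int>\<close>, so a tensor is determined by its coefficients with respect to the left factor.\<close>

lemma tensor_expansion:
  assumes "P \<in> carrier HH.T"
  shows "\<exists>S. finite S \<and> S \<subseteq> basis \<and> (\<forall>S'. finite S' \<and> S \<subseteq> S' \<and> S' \<subseteq> basis \<longrightarrow>
    P = (\<Oplus>\<^bsub>HH.T\<^esub>b\<in>S'. tensor H H (key_el b) (coeff (coord_at b) P)))"
proof -
  let ?g = "\<lambda>b P. tensor H H (key_el b) (coeff (coord_at b) P)"
  have g: "?g b \<in> add_hom HH.T HH.T" if "b \<in> basis" for b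
    by (rule add_hom_comp[OF coeff_add_hom[OF coord_at_add_hom] HH.tensor_right_add_hom[OF key_el_closed[OF that]]])
  have gc: "?g b P \<in> carrier HH.T" if "b \<in> basis" "P \<in> carrier HH.T" for b P
    using add_hom_closed[OF g[OF that(1)] that(2)] .
  \<comment> \<open>The claim covers all larger index sets, so that in the difference case both
    expansions can be taken over a common one.\<close>
  show ?thesis using assms
  proof (induction P rule: HH.tensor_induct)
    case (tensor a y)
    let ?S = "Poly_Mapping.keys (coord a)"
    have S: "?S \<subseteq> basis" using coord_fmod[OF tensor(1)] by (simp add: fmod_def)
    have "tensor H H a y = (\<Oplus>\<^bsub>HH.T\<^esub>b\<in>S'. ?g b (tensor H H a y))" if S': "finite S'" "?S \<subseteq> S'" "S' \<subseteq> basis" for S'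
    proof -
      have kc: "key_el b \<in> carrier H" if "b \<in> S'" for b using that S' key_el_closed by blast
      have "a = (\<Oplus>\<^bsub>H\<^esub>b\<in>S'. [coord_at b a] \<cdot>\<^bsub>H\<^esub> key_el b)"
        using H.linear_extension_superset[where K = basis, OF key_el_closed S'] \<Psi>_coord[OF tensor(1)] by simp
      then have "tensor H H a y = tensor H H (\<Oplus>\<^bsub>H\<^esub>b\<in>S'. [coord_at b a] \<cdot>\<^bsub>H\<^esub> key_el b) y" by simp
      also have "\<dots> = (\<Oplus>\<^bsub>HH.T\<^esub>b\<in>S'. tensor H H ([coord_at b a] \<cdot>\<^bsub>H\<^esub> key_el b) y)"
        by (rule add_hom_finsum[OF H.is_abelian_group HH.T.is_abelian_group HH.tensor_left_add_hom[OF tensor(2)] S'(1)])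
          (simp add: kc)
      also have "\<dots> = (\<Oplus>\<^bsub>HH.T\<^esub>b\<in>S'. ?g b (tensor H H a y))"
        by (rule HH.T.finsum_cong') (use tensor kc in \<open>auto simp: tensor_scale coeff_tensor[OF coord_at_add_hom]\<close>)
      finally show ?thesis .
    qed
    then show ?case using S by (intro exI[of _ ?S]) simp
  next
    case (diff P Q)
    from diff(3) obtain S where S: "finite S" "S \<subseteq> basis"
      "\<forall>S'. finite S' \<and> S \<subseteq> S' \<and> S' \<subseteq> basis \<longrightarrow> P = (\<Oplus>\<^bsub>HH.T\<^esub>b\<in>S'. ?g b P)" by (elim exE conjE)
    from diff(4) obtain R where R: "finite R" "R \<subseteq> basis"
      "\<forall>S'. finite S' \<and> R \<subseteq> S' \<and> S' \<subseteq> basis \<longrightarrow> Q = (\<Oplus>\<^bsub>HH.T\<^esub>b\<in>S'. ?g b Q)" by (elim exE conjE)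
    have "P \<ominus>\<^bsub>HH.T\<^esub> Q = (\<Oplus>\<^bsub>HH.T\<^esub>b\<in>S'. ?g b (P \<ominus>\<^bsub>HH.T\<^esub> Q))"
      if S': "finite S'" "S \<union> R \<subseteq> S'" "S' \<subseteq> basis" for S'
    proof -
      define s where "s = (\<lambda>P. \<Oplus>\<^bsub>HH.T\<^esub>b\<in>S'. ?g b P)"
      have sb: "b \<in> basis" if "b \<in> S'" for b using that S' by blast
      have s: "s \<in> add_hom HH.T HH.T"
      proof (rule add_homI)
        fix P Q assume PQ: "P \<in> carrier HH.T" "Q \<in> carrier HH.T"
        then show "s P \<in> carrier HH.T" unfolding s_def using gc S' by (intro HH.T.finsum_closed) auto
        have "s (P \<oplus>\<^bsub>HH.T\<^esub> Q) = (\<Oplus>\<^bsub>HH.T\<^esub>b\<in>S'. ?g b P \<oplus>\<^bsub>HH.T\<^esub> ?g b Q)"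
          unfolding s_def
          by (rule HH.T.finsum_cong'[OF HOL.refl]) (simp_all add: Pi_iff sb gc PQ add_hom_add[OF g])
        also have "\<dots> = s P \<oplus>\<^bsub>HH.T\<^esub> s Q"
          unfolding s_def by (rule HH.T.finsum_addf) (simp_all add: Pi_iff sb gc PQ)
        finally show "s (P \<oplus>\<^bsub>HH.T\<^esub> Q) = s P \<oplus>\<^bsub>HH.T\<^esub> s Q" .
      qed
      have "P = s P" unfolding s_def by (rule S(3)[rule_format]) (use S' in simp)
      moreover have "Q = s Q" unfolding s_def by (rule R(3)[rule_format]) (use S' in simp)
      ultimately have "s (P \<ominus>\<^bsub>HH.T\<^esub> Q) = P \<ominus>\<^bsub>HH.T\<^esub> Q"
        using add_hom_diff[OF HH.T.is_abelian_group HH.T.is_abelian_group s diff(1,2)] by metis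
      then show ?thesis unfolding s_def ..
    qed
    then show ?case using S R by (intro exI[of _ "S \<union> R"]) simp
  qed
qed

text \<open>Membership in the image of H (x) V is reduced to the membership of coefficients in
  \<open>V\<close>, a kind of condition that passes to arbitrary intersections of sets
  \<open>V\<close>.\<close>

lemma tensor_span_coeffI:
  assumes P: "P \<in> carrier HH.T" and V: "V \<subseteq> carrier H"
    and c: "\<And>f. f \<in> add_hom H \<Z> \<Longrightarrow> coeff f P \<in> V"
  shows "P \<in> tensor_span H H (carrier H) V"
proof -
  let ?g = "\<lambda>b. tensor H H (key_el b) (coeff (coord_at b) P)"
  from tensor_expansion[OF P] obtain S where S: "finite S" "S \<subseteq> basis"
    "\<forall>S'. finite S' \<and> S \<subseteq> S' \<and> S' \<subseteq> basis \<longrightarrow> P = (\<Oplus>\<^bsub>HH.T\<^esub>b\<in>S'. ?g b)" by (elim exE conjE)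
  have g: "?g b \<in> tensor_span H H (carrier H) V" if "b \<in> basis" for b
    by (rule HH.tensor_span_incl[OF key_el_closed[OF that] c[OF coord_at_add_hom]])
  note gc = HH.tensor_span_closed(1)[OF subset_refl V g]
  define Q where "Q = (\<Oplus>\<^bsub>HH.T\<^esub>b\<in>S. ?g b)"
  have PQ: "P = Q" unfolding Q_def by (rule S(3)[rule_format]) (use S in simp)
  have "Q \<in> tensor_span H H (carrier H) V"
    unfolding Q_def using S(1,2)
  proof (induction S)
    case (insert b S)
    then have "?g \<in> S \<rightarrow> carrier HH.T" using gc by auto
    then show ?case using insert g[of b] gc[of b] HH.tensor_span_closed(3)[OF subset_refl V] by simp
  qed (simp add: HH.tensor_span_closed V)
  then show ?thesis unfolding PQ .
qed

section \<open>The coideals \<open>D_hat\<close> and \<open>K_alg\<close>, and the Hopf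
  ideal\<close>

abbreviation "Dh \<equiv> D_hat I m"
abbreviation "K \<equiv> K_alg I m"
abbreviation "J \<equiv> J_ideal I m"

lemma DR_refls_closed: "DR ` refls \<subseteq> carrier H" by auto

lemma subring_Dh: "subring Dh H"
  unfolding D_hat_def by (rule H.generate_ring_is_subring[OF DR_refls_closed])

lemma Dh_closed: "Dh \<subseteq> carrier H"
  using subring_Dh by (rule subringE(1))

lemma scale_subgroup:
  fixes k :: int
  assumes V: "subgroup V (add_monoid H)" and x: "x \<in> V"
  shows "[k] \<cdot>\<^bsub>H\<^esub> x \<in> V"
  using H.add.subgroup_int_pow_closed[OF V x] .

lemma subgroup_Dh: "subgroup Dh (add_monoid H)"
  using subring_Dh by (simp add: subring_def)

text \<open>Tensors with right factor in \<open>D_hat\<close> are closed under products, so the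
  formula for \<open>comult (DR t)\<close> suffices.\<close>

lemma comult_Dh: 
  assumes "x \<in> Dh"
  shows "comult x \<in> tensor_span H H (carrier H) Dh"
  using assms unfolding D_hat_def
proof (induction x rule: generate_ring.induct)
  case one
  show ?case using ring_hom_one[OF comult_hom]
    by (simp add: HH.tensor_one HH.tensor_span_incl generate_ring.one)
next
  case (incl h)
  then obtain t where t: "t \<in> refls" "h = DR t" by blast
  then have "h \<in> Dh" using incl by (simp add: D_hat_def generate_ring.incl)
  moreover have "\<one>\<^bsub>H\<^esub> \<in> Dh" by (simp add: D_hat_def generate_ring.one)
  ultimately show ?case using t Dh_closed HH.tensor_span_closed(3)[OF subset_refl Dh_closed]
    by (simp add: comult_DR HH.tensor_span_incl reflections_closed flip: D_hat_def)
next
  case (a_inv h)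
  then have "h \<in> carrier H" using Dh_closed by (auto simp: D_hat_def)
  then show ?case using a_inv HH.tensor_span_closed(4)[OF subset_refl Dh_closed]
    by (simp add: add_hom_neg[OF H.is_abelian_group HH.T.is_abelian_group comult_add_hom] flip: D_hat_def)
next
  case (eng_add h h')
  then have "h \<in> carrier H" "h' \<in> carrier H" using Dh_closed by (auto simp: D_hat_def)
  then show ?case using eng_add HH.tensor_span_closed(3)[OF subset_refl Dh_closed]
    by (simp add: ring_hom_add[OF comult_hom] flip: D_hat_def)
next
  case (eng_mult h h')
  then have "h \<in> carrier H" "h' \<in> carrier H" using Dh_closed by (auto simp: D_hat_def)
  moreover have "comult h \<otimes>\<^bsub>HH.T\<^esub> comult h' \<in> tensor_span H H (carrier H) Dh"
    by (rule HH.tensor_span_mult[OF eng_mult(3,4)[folded D_hat_def]])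
      (use Dh_closed subringE(6)[OF subring_Dh] in auto)
  ultimately show ?case by (simp add: ring_hom_mult[OF comult_hom] flip: D_hat_def)
qed

lemma comult_gp:
  assumes "w \<in> carrier W"
  shows "comult (gp w) = tensor H H (gp w) (gp w)"
proof -
  obtain u where u: "u \<in> lists I" "w = cls u" using assms by (rule carrierE)
  from u(1) have "comult (gp (cls u)) = tensor H H (gp (cls u)) (gp (cls u))"
  proof (induction u)
    case Nil
    then show ?case using ring_hom_one[OF comult_hom] by (simp add: gp_one HH.tensor_one flip: one_cls)
  next
    case (Cons i u)
    then show ?case by (simp add: cls_Cons gp_mult gp_\<sigma> ring_hom_mult[OF comult_hom] comult_ss)
  qed
  then show ?thesis using u by simp
qed

lemma gp_cancel:
  assumes "w \<in> carrier W" "x \<in> carrier H"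
  shows "gp w \<otimes>\<^bsub>H\<^esub> (gp (inv\<^bsub>W\<^esub> w) \<otimes>\<^bsub>H\<^esub> x) = x" "gp (inv\<^bsub>W\<^esub> w) \<otimes>\<^bsub>H\<^esub> (gp w \<otimes>\<^bsub>H\<^esub> x) = x"
  using assms gp_inv[OF assms(1)] by (simp_all flip: H.m_assoc)

lemma mem_K_iff: "x \<in> K \<longleftrightarrow> x \<in> carrier H \<and> (\<forall>w\<in>carrier W. gp (inv\<^bsub>W\<^esub> w) \<otimes>\<^bsub>H\<^esub> x \<otimes>\<^bsub>H\<^esub> gp w \<in> Dh)"
proof -
  have conj: "x \<in> (\<lambda>x. gp w \<otimes>\<^bsub>H\<^esub> x \<otimes>\<^bsub>H\<^esub> gp (inv\<^bsub>W\<^esub> w)) ` Dh \<longleftrightarrow>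
      x \<in> carrier H \<and> gp (inv\<^bsub>W\<^esub> w) \<otimes>\<^bsub>H\<^esub> x \<otimes>\<^bsub>H\<^esub> gp w \<in> Dh" if w: "w \<in> carrier W" for w
  proof
    assume "x \<in> (\<lambda>x. gp w \<otimes>\<^bsub>H\<^esub> x \<otimes>\<^bsub>H\<^esub> gp (inv\<^bsub>W\<^esub> w)) ` Dh"
    then obtain y where y: "y \<in> Dh" "x = gp w \<otimes>\<^bsub>H\<^esub> y \<otimes>\<^bsub>H\<^esub> gp (inv\<^bsub>W\<^esub> w)" by blast
    then have "y \<in> carrier H" using Dh_closed by blast
    then show "x \<in> carrier H \<and> gp (inv\<^bsub>W\<^esub> w) \<otimes>\<^bsub>H\<^esub> x \<otimes>\<^bsub>H\<^esub> gp w \<in> Dh"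
      using y w by (simp add: H.m_assoc gp_inv gp_cancel)
  next
    assume x: "x \<in> carrier H \<and> gp (inv\<^bsub>W\<^esub> w) \<otimes>\<^bsub>H\<^esub> x \<otimes>\<^bsub>H\<^esub> gp w \<in> Dh"
    then have "x = gp w \<otimes>\<^bsub>H\<^esub> (gp (inv\<^bsub>W\<^esub> w) \<otimes>\<^bsub>H\<^esub> x \<otimes>\<^bsub>H\<^esub> gp w) \<otimes>\<^bsub>H\<^esub> gp (inv\<^bsub>W\<^esub> w)"
      using w by (simp add: H.m_assoc gp_inv gp_cancel)
    then show "x \<in> (\<lambda>x. gp w \<otimes>\<^bsub>H\<^esub> x \<otimes>\<^bsub>H\<^esub> gp (inv\<^bsub>W\<^esub> w)) ` Dh" using x by blast
  qed
  have "x \<in> K \<longleftrightarrow> (\<forall>w\<in>carrier W. x \<in> carrier H \<and> gp (inv\<^bsub>W\<^esub> w) \<otimes>\<^bsub>H\<^esub> x \<otimes>\<^bsub>H\<^esub> gp w \<in> Dh)"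
    unfolding K_alg_def Let_def using conj by (simp only: INT_iff) blast
  then show ?thesis using W.one_closed by blast
qed

lemma K_closed: "K \<subseteq> carrier H"
  by (auto simp: mem_K_iff)

text \<open>This step, which interchanges an intersection with a tensor product, is where the freeness
  of \<open>hecke_hat\<close> enters.\<close>

lemma comult_K:
  assumes x: "x \<in> K"
  shows "comult x \<in> tensor_span H H (carrier H) K"
proof (rule tensor_span_coeffI[OF _ K_closed])
  have xH: "x \<in> carrier H" using x K_closed by blast
  then show cx: "comult x \<in> carrier HH.T" by (rule ring_hom_closed[OF comult_hom])
  fix f assume f: "f \<in> add_hom H \<Z>"
  have "gp (inv\<^bsub>W\<^esub> w) \<otimes>\<^bsub>H\<^esub> coeff f (comult x) \<otimes>\<^bsub>H\<^esub> gp w \<in> Dh" if w: "w \<in> carrier W" for w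
  proof -
    let ?g = "gp w" and ?g' = "gp (inv\<^bsub>W\<^esub> w)"
    let ?t = "tensor H H ?g ?g" and ?t' = "tensor H H ?g' ?g'"
    have g: "?g \<in> carrier H" "?g' \<in> carrier H" using w by auto
    have t: "?t \<in> carrier HH.T" "?t' \<in> carrier HH.T" using g by auto
    define y where "y = ?g' \<otimes>\<^bsub>H\<^esub> x \<otimes>\<^bsub>H\<^esub> ?g"
    have y: "y \<in> Dh" using x w by (simp add: y_def mem_K_iff)
    then have yH: "y \<in> carrier H" using Dh_closed by blast
    have xy: "x = ?g \<otimes>\<^bsub>H\<^esub> y \<otimes>\<^bsub>H\<^esub> ?g'" using w xH g by (simp add: y_def H.m_assoc gp_inv gp_cancel)
    \<comment> \<open>\<open>P\<close> is conjugated by w in both factors, \<open>f\<close> is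
      applied on the left, and the conjugation on the right is undone: u (x) v goes to f(w u w^-1)
      v. At \<open>comult y\<close> this is the conjugated coefficient of
      \<open>comult x\<close>.\<close>
    define \<Theta> where "\<Theta> = (\<lambda>P. ?g' \<otimes>\<^bsub>H\<^esub> (coeff f (?t \<otimes>\<^bsub>HH.T\<^esub> (P \<otimes>\<^bsub>HH.T\<^esub> ?t')) \<otimes>\<^bsub>H\<^esub> ?g))"
    have \<Theta>: "\<Theta> \<in> add_hom HH.T H"
      unfolding \<Theta>_def
      by (rule add_hom_comp[OF add_hom_comp[OF add_hom_comp[OF add_hom_comp[OF mult_add_hom(2)[OF HH.tensor_ring_ring t(2)]
                mult_add_hom(1)[OF HH.tensor_ring_ring t(1)]] coeff_add_hom[OF f]] mult_add_hom(2)[OF ring_H g(1)]]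
            mult_add_hom(1)[OF ring_H g(2)]])
    have "\<Theta> P \<in> Dh" if "P \<in> tensor_span H H (carrier H) Dh" for P
      using that subset_refl Dh_closed
    proof (induction P rule: HH.tensor_span_induct)
      case (tensor u v)
      then have v: "v \<in> carrier H" using Dh_closed by blast
      have "\<Theta> (tensor H H u v) = [f (?g \<otimes>\<^bsub>H\<^esub> (u \<otimes>\<^bsub>H\<^esub> ?g'))] \<cdot>\<^bsub>H\<^esub> v"
        using tensor(1) v g w
        by (simp add: \<Theta>_def coeff_tensor[OF f] H.add_pow_ldistr_int H.add_pow_rdistr_int H.m_assoc gp_inv gp_cancel)
      then show ?case using scale_subgroup[OF subgroup_Dh tensor(2)] by simp
    qed (use subringE[OF subring_Dh] in \<open>simp_all add: add_hom_zero[OF HH.T.is_abelian_group H.is_abelian_group \<Theta>]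
        add_hom_neg[OF HH.T.is_abelian_group H.is_abelian_group \<Theta>] add_hom_add[OF \<Theta>]\<close>)
    moreover have "comult x = ?t \<otimes>\<^bsub>HH.T\<^esub> (comult y \<otimes>\<^bsub>HH.T\<^esub> ?t')"
      unfolding xy using yH g w t
      by (simp add: ring_hom_mult[OF comult_hom] comult_gp HH.T.m_assoc ring_hom_closed[OF comult_hom])
    ultimately show ?thesis
      using comult_Dh[OF y] g add_hom_closed[OF coeff_add_hom[OF f] cx] by (simp add: \<Theta>_def H.m_assoc)
  qed
  then show "coeff f (comult x) \<in> K"
    using add_hom_closed[OF coeff_add_hom[OF f] cx] by (simp add: mem_K_iff)
qed

abbreviation "K0 \<equiv> K \<inter> {x. counit x = 0}"

lemma K0_closed: "K0 \<subseteq> carrier H"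
  using K_closed by blast

lemma ideal_J: "ideal J H"
  unfolding J_ideal_def by (rule H.genideal_ideal[OF K0_closed])

sublocale J: ideal J H by (rule ideal_J)

lemma K0_J: "x \<in> K0 \<Longrightarrow> x \<in> J"
  unfolding J_ideal_def using H.genideal_self[OF K0_closed] by blast

lemma J_minimal: "ideal I' H \<Longrightarrow> K0 \<subseteq> I' \<Longrightarrow> J \<subseteq> I'"
  unfolding J_ideal_def by (rule H.genideal_minimal)

text \<open>Scalars lie in \<open>K\<close>, being fixed by conjugation and contained in
  \<open>D_hat\<close>.\<close>

lemma augment_K:
  assumes k: "k \<in> K"
  shows "k \<ominus>\<^bsub>H\<^esub> [counit k] \<cdot>\<^bsub>H\<^esub> \<one>\<^bsub>H\<^esub> \<in> K0"
proof -
  have kH: "k \<in> carrier H" using k K_closed by blast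
  have "gp (inv\<^bsub>W\<^esub> w) \<otimes>\<^bsub>H\<^esub> (k \<ominus>\<^bsub>H\<^esub> [counit k] \<cdot>\<^bsub>H\<^esub> \<one>\<^bsub>H\<^esub>) \<otimes>\<^bsub>H\<^esub> gp w \<in> Dh" if w: "w \<in> carrier W" for w
  proof -
    have "gp (inv\<^bsub>W\<^esub> w) \<otimes>\<^bsub>H\<^esub> (k \<ominus>\<^bsub>H\<^esub> [counit k] \<cdot>\<^bsub>H\<^esub> \<one>\<^bsub>H\<^esub>) \<otimes>\<^bsub>H\<^esub> gp w =
        gp (inv\<^bsub>W\<^esub> w) \<otimes>\<^bsub>H\<^esub> k \<otimes>\<^bsub>H\<^esub> gp w \<oplus>\<^bsub>H\<^esub> \<ominus>\<^bsub>H\<^esub> ([counit k] \<cdot>\<^bsub>H\<^esub> \<one>\<^bsub>H\<^esub>)"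
      using kH w by (simp add: H.minus_eq H.r_distr H.l_distr H.r_minus H.l_minus H.add_pow_ldistr_int H.add_pow_rdistr_int gp_inv)
    also have "\<dots> \<in> Dh"
      using k w subringE(5,7)[OF subring_Dh] scale_subgroup[OF subgroup_Dh subringE(3)[OF subring_Dh]] by (simp add: mem_K_iff)
    finally show ?thesis .
  qed
  moreover have "counit (k \<ominus>\<^bsub>H\<^esub> [counit k] \<cdot>\<^bsub>H\<^esub> \<one>\<^bsub>H\<^esub>) = counit k - counit ([counit k] \<cdot>\<^bsub>H\<^esub> \<one>\<^bsub>H\<^esub>)"
    using add_hom_diff[OF H.is_abelian_group int.is_abelian_group counit_add_hom kH, of "[counit k] \<cdot>\<^bsub>H\<^esub> \<one>\<^bsub>H\<^esub>"]
    by (simp add: a_minus_def int_a_inv_eq)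
  moreover have "counit ([n] \<cdot>\<^bsub>H\<^esub> \<one>\<^bsub>H\<^esub>) = n" for n :: int
  proof -
    have add: "[(k + l)] \<cdot>\<^bsub>\<Z>\<^esub> (1 :: int) = [k] \<cdot>\<^bsub>\<Z>\<^esub> 1 + [l] \<cdot>\<^bsub>\<Z>\<^esub> 1" for k l :: int
      using int.add.int_pow_mult[of 1 k l] by simp
    have one: "[(1 :: int)] \<cdot>\<^bsub>\<Z>\<^esub> (1 :: int) = 1"
      using int.add.int_pow_1[of 1] by simp
    have "[n] \<cdot>\<^bsub>\<Z>\<^esub> (1 :: int) = n"
    proof (induction n rule: int_induct[of _ 0])
      case base
      show ?case by (simp add: add_pow_def)
    next
      case (step1 i)
      then show ?case using add[of i 1] one by simp
    next
      case (step2 i)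
      then show ?case using add[of "i - 1" 1] one by simp
    qed
    then show ?thesis
      using add_hom_int_pow[OF H.is_abelian_group int.is_abelian_group counit_add_hom H.one_closed, of n]
        ring_hom_one[OF counit_hom] by simp
  qed
  ultimately show ?thesis using kH by (simp add: mem_K_iff)
qed

text \<open>The map \<open>\<Theta>\<close>, which subtracts (id (x) counit)(P) (x) 1 from P, sends
  u (x) k to u (x) (k - counit k) and so takes right factors in \<open>K\<close> to right factors in
  \<open>K0\<close>. At \<open>comult x\<close> the subtracted term is x (x) 1 by the counit
  axiom.\<close>

lemma comult_K0:
  assumes x: "x \<in> K0"
  obtains P where "P \<in> tensor_span H H (carrier H) K0" "comult x = P \<oplus>\<^bsub>HH.T\<^esub> tensor H H x \<one>\<^bsub>H\<^esub>"
proof -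
  have xH: "x \<in> carrier H" using x K_closed by blast
  define \<epsilon>r where "\<epsilon>r = tensor_lift H (\<lambda>a b. [counit b] \<cdot>\<^bsub>H\<^esub> a)"
  note bi = biadditive_scale(2)[OF ring_H counit_add_hom]
  have \<epsilon>r: "\<epsilon>r \<in> add_hom HH.T H"
    unfolding \<epsilon>r_def by (rule HH.tensor_lift_add_hom[OF ring_H bi])
  note \<epsilon>c = add_hom_closed[OF \<epsilon>r]
  define \<Theta> where "\<Theta> = (\<lambda>P. P \<ominus>\<^bsub>HH.T\<^esub> tensor H H (\<epsilon>r P) \<one>\<^bsub>H\<^esub>)"
  have \<Theta>: "\<Theta> \<in> add_hom HH.T HH.T"
    by (rule add_homI)
      (simp_all add: \<Theta>_def \<epsilon>c add_hom_add[OF \<epsilon>r] HH.tensor_add_left HH.T.minus_eq HH.T.minus_add HH.T.a_ac)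
  have in_span: "\<Theta> P \<in> tensor_span H H (carrier H) K0" if "P \<in> tensor_span H H (carrier H) K" for P
    using that subset_refl K_closed
  proof (induction P rule: HH.tensor_span_induct)
    case (tensor u k)
    have k: "k \<in> carrier H" using tensor K_closed by blast
    have "\<Theta> (tensor H H u k) = tensor H H u k \<ominus>\<^bsub>HH.T\<^esub> tensor H H u ([counit k] \<cdot>\<^bsub>H\<^esub> \<one>\<^bsub>H\<^esub>)"
      using tensor k by (simp add: \<Theta>_def \<epsilon>r_def HH.tensor_lift_tensor[OF ring_H bi] tensor_scale)
    also have "\<dots> = tensor H H u (k \<ominus>\<^bsub>H\<^esub> [counit k] \<cdot>\<^bsub>H\<^esub> \<one>\<^bsub>H\<^esub>)"
      using add_hom_diff[OF H.is_abelian_group HH.T.is_abelian_group HH.tensor_right_add_hom[OF tensor(1)] k, of "[counit k] \<cdot>\<^bsub>H\<^esub> \<one>\<^bsub>H\<^esub>"]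
      by simp
    also have "\<dots> \<in> tensor_span H H (carrier H) K0"
      by (rule HH.tensor_span_incl[OF tensor(1) augment_K[OF tensor(2)]])
    finally show ?case .
  qed (use HH.tensor_span_closed[OF subset_refl K0_closed] in \<open>simp_all add:
      add_hom_zero[OF HH.T.is_abelian_group HH.T.is_abelian_group \<Theta>]
      add_hom_neg[OF HH.T.is_abelian_group HH.T.is_abelian_group \<Theta>] add_hom_add[OF \<Theta>]\<close>)
  have "\<epsilon>r (comult x) = x" unfolding \<epsilon>r_def by (rule counital(2)[OF xH])
  then have "comult x = \<Theta> (comult x) \<oplus>\<^bsub>HH.T\<^esub> tensor H H x \<one>\<^bsub>H\<^esub>"
    using xH ring_hom_closed[OF comult_hom xH] by (simp add: \<Theta>_def HH.T.minus_eq HH.T.a_assoc HH.T.l_neg)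
  then show thesis using that[OF in_span[OF comult_K]] x by blast
qed

text \<open>Preimages of ideals under ring homomorphisms are ideals, so each condition need only be
  checked on the generating set \<open>K0\<close> of \<open>J\<close>; for the antipode,
  \<open>J\<close> is regarded as an ideal of the opposite ring.\<close>

lemma hopf_ideal_J: "hopf_ideal H comult counit antipode J"
proof (intro hopf_ideal.intro hopf_algebra_hecke ideal_J hopf_ideal_axioms.intro)
  let ?Q = "tensor_span H H J (carrier H) <+>\<^bsub>HH.T\<^esub> tensor_span H H (carrier H) J"
  have i1: "ideal (tensor_span H H J (carrier H)) HH.T" and i2: "ideal (tensor_span H H (carrier H) J) HH.T"
    using ideal_J by (auto intro!: HH.ideal_tensor_span)
  have Q: "ideal ?Q HH.T" by (rule HH.T.add_ideals[OF i1 i2])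
  interpret c: ring_hom_ring H HH.T comult
    by (rule ring_hom_ringI2[OF ring_H HH.tensor_ring_ring comult_hom])
  have "J \<subseteq> {x \<in> carrier H. comult x \<in> ?Q}"
  proof (rule J_minimal[OF c.ideal_vimage[OF Q]], rule subsetI, rule CollectI, rule conjI)
    fix x assume x: "x \<in> K0"
    then show xH: "x \<in> carrier H" using K0_closed by blast
    obtain P where P: "P \<in> tensor_span H H (carrier H) K0" "comult x = P \<oplus>\<^bsub>HH.T\<^esub> tensor H H x \<one>\<^bsub>H\<^esub>"
      using x by (rule comult_K0)
    have "P \<in> tensor_span H H (carrier H) J"
      using P(1) HH.tensor_span_mono[of "carrier H" "carrier H" K0 J] K0_J by blast
    moreover have "tensor H H x \<one>\<^bsub>H\<^esub> \<in> tensor_span H H J (carrier H)"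
      using x K0_J by (simp add: HH.tensor_span_incl)
    moreover have "comult x = tensor H H x \<one>\<^bsub>H\<^esub> \<oplus>\<^bsub>HH.T\<^esub> P"
      using P HH.tensor_span_closed(1)[OF subset_refl K0_closed P(1)] xH by (simp add: HH.T.a_comm)
    ultimately show "comult x \<in> ?Q" by (auto simp: set_add_def')
  qed
  then show "comult ` J \<subseteq> ?Q" by blast
  have "counit x = \<zero>\<^bsub>\<Z>\<^esub>" if "x \<in> J" for x
    using that unfolding J_ideal_def
    by (rule vanish_genideal[OF ring_H int.ring_axioms counit_hom K0_closed, rotated]) simp
  then show "counit ` J \<subseteq> {0}" by auto
  interpret a: ring_hom_ring H "opposite H" antipode
    by (rule ring_hom_ringI2[OF ring_H H.ring_opposite antipode_hom_opposite])
  have "J \<subseteq> {x \<in> carrier H. antipode x \<in> J}"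
  proof (rule J_minimal[OF a.ideal_vimage[OF J.ideal_opposite]], rule subsetI, rule CollectI, rule conjI)
    fix x assume x: "x \<in> K0"
    then show xH: "x \<in> carrier H" using K0_closed by blast
    obtain P where P: "P \<in> tensor_span H H (carrier H) K0" "comult x = P \<oplus>\<^bsub>HH.T\<^esub> tensor H H x \<one>\<^bsub>H\<^esub>"
      using x by (rule comult_K0)
    have PT: "P \<in> carrier HH.T" using HH.tensor_span_closed(1)[OF subset_refl K0_closed P(1)] .
    let ?l = "tensor_lift H (\<lambda>a b. antipode a \<otimes>\<^bsub>H\<^esub> b)"
    note la = HH.tensor_lift_add_hom[OF ring_H biadditive_antipode(1)]
    note lv = HH.tensor_lift_tensor[OF ring_H biadditive_antipode(1)]
    have lJ: "?l P \<in> J"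
      using P(1) subset_refl K0_closed
    proof (induction P rule: HH.tensor_span_induct)
      case (tensor u v)
      then show ?case using K0_J[OF tensor(2)] K0_closed by (auto simp: lv intro!: J.I_l_closed)
    qed (simp_all add: add_hom_zero[OF HH.T.is_abelian_group H.is_abelian_group la]
        add_hom_neg[OF HH.T.is_abelian_group H.is_abelian_group la] add_hom_add[OF la])
    have "?l P \<oplus>\<^bsub>H\<^esub> antipode x = ?l (comult x)"
      using P(2) PT xH by (simp add: add_hom_add[OF la] lv)
    also have "\<dots> = \<zero>\<^bsub>H\<^esub>" using antipode_convolution[OF xH] x zero_scale by simp
    finally have "antipode x = \<ominus>\<^bsub>H\<^esub> ?l P"
      using xH add_hom_closed[OF la PT] by (metis H.a_comm H.minus_equality antipode_closed)
    then show "antipode x \<in> J" using lJ by simp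
  qed
  then show "antipode ` J \<subseteq> J" by blast
qed

end

theorem theorem1p17:
  fixes I :: "'i set" and m :: "'i \<Rightarrow> 'i \<Rightarrow> nat"
  assumes "coxeter_matrix I m"
  shows "hopf_ideal (hecke_hat I m) (hecke_comult I m) (hecke_counit I m) (hecke_antipode I m)
           (J_ideal I m) \<and>
         hopf_algebra (hecke_hopf I m)
           (quot_comult (hecke_hat I m) (J_ideal I m) (hecke_comult I m))
           (quot_counit (hecke_counit I m))
           (quot_antipode (hecke_hat I m) (J_ideal I m) (hecke_antipode I m))"
proof -
  interpret coxeter_system I m by (rule coxeter_system.intro) fact
  from hopf_ideal_J show ?thesis
    unfolding hecke_hopf_def by (intro conjI hopf_algebra_quotient)
qed

end
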